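(* Let $q$ be a power of an odd prime and $E,F\subset\mathbb F_q^d$. (1) If $d\geq 2$ is even and $|E||F|\geq 16q^d$, then $$ |\Delta(E,F)|\geq \begin{cases} \frac{q}{144} &\text{if } 1\le |E|< q^{\frac{d-1}{2}},\\[2pt] \frac{1}{144} \min\left\{ q, \frac{|F|}{ 2q^{\frac{d-1}{2}}}\right\} &\text{if } q^{\frac{d-1}{2}}\leq |E|< q^{\frac{d+1}{2}},\\[2pt] \frac{1}{144} \min\left\{ q, \frac{2|E||F|}{q^d}\right\} &\text{if } q^{\frac{d+1}{2}}\leq |E|\leq q^{d}.\end{cases}$$ (2) If $d=2$ and $|E||F|\geq 16q^2$, then $$|\Delta(E,F)|\geq \frac{1}{72}\min\left\{\frac{q}{2},\ \frac{|E|^{1/2}|F|}{\sqrt3\, q}\right\}.$$ (3) If $d=2$, $E,F$ are nonempty, and $-1$ is not a square in $\mathbb F_q$ (no hypothesis on $|E||F|$), then $$|\Delta(E,F)|\geq \min\left\{\frac{q}{2},\ \frac{|E|^{1/2}|F|}{2(\sqrt3+1)q}\right\}.$$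
   Context: $\mathbb F_q$ is the finite field with $q$ elements, of characteristic greater than two. For $m=(m_1,\dots,m_d)\in\mathbb F_q^d$ put $\|m\|=m_1^2+\dots+m_d^2\in\mathbb F_q$. For $E,F\subset\mathbb F_q^d$ the distance set is $\Delta(E,F)=\{\|x-y\|\in\mathbb F_q: x\in E,\ y\in F\}$. *)

theory Defs
  imports "HOL-Analysis.Analysis"
begin

definition sqnorm :: "'a::comm_ring_1 ^ 'n \<Rightarrow> 'a" where
  "sqnorm m = (\<Sum>i\<in>UNIV. m $ i * m $ i)"

definition dist_set :: "('a::comm_ring_1 ^ 'n) set \<Rightarrow> ('a ^ 'n) set \<Rightarrow> 'a set" where
  "dist_set E F = {sqnorm (x - y) | x y. x \<in> E \<and> y \<in> F}"

end

theory Submission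
  imports Defs "HOL-Algebra.Algebraic_Closure_Type" "HOL-Computational_Algebra.Computational_Algebra"
begin

text \<open>Let $\nu(t)$ count the pairs of $E \times F$ at distance $t$, and let $A(r)$ be the sum of
  $\hat E \overline{\hat F}$ over the sphere $\|m\| = r$. Completing the square expresses the
  one-dimensional transform of $\nu$ through that of $A$, so by Parseval $\sum \nu^2$ equals the expected
  main term plus a multiple of $\sum |A|^2$. In even dimension the Gauss sums of all $u \ne 0$ agree, whence the
  contributions of $\nu(0)$ and of $A(0)$ cancel up to a harmless error; for $d = 2$ and $-1$ a
  nonsquare the cone is a point. Cauchy-Schwarz then reduces everything to bounding the energy of
  $\hat E$ on a sphere of nonzero radius: trivially, by Kloosterman sums, or, on a circle, by an
  $L^4$ argument resting on the fact that two circles meet in at most two points.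

  The bound $|K| \le 3 \sqrt q$ for Kloosterman sums is obtained as follows. Counting monic quadratics
  gives $K_{2N} = 2 q^N - K_N^2$ for the sums over the extensions of degree $N$ and $2N$, so it suffices to show
  $K_N = O(q^{N/2})$ with a constant that may depend on $q$. That is a point count on the curve $s^q - s + t_0 = x + a/x$,
  for which Stepanov's auxiliary function is found by the pigeonhole principle: with $R^2 = q^N$ one
  chooses $G = \sum u_i v_i^R \ne 0$ with $\sum u_i^R v_i = 0$; then $G^R$ vanishes at all points over the field of order $R^2$.\<close>

hide_const (open) Polynomials.degree Polynomials.lead_coeff up_ring.coeff up_ring.monom
  Coset.order module.smult Divisibility.prime

section \<open>Finite subfields of an algebraically closed field\<close>

text \<open>A bound with a constant depending on \<open>q\<close> suffices because of the shape of
  the recursion: in units of q^(N/2) it reads c -> 2 - c^2, which at least doubles every modulus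
  that is 3 or more, so a value beyond 3 would outgrow any fixed constant. Stepanov's method bounds
  the number of points only from above; the matching lower bound is free, since the trace classes
  together have exactly q^N - 1 elements. The parameter t_0 has two tasks: it selects a trace class,
  and it is chosen such that two different points of the curve lie over s = 0; comparing these two
  points is what proves G \<noteq> 0. Kloosterman sums enter the distance problem because in even
  dimension Fourier inversion turns A(r) into a sum, over pairs (x, y), of Kloosterman sums with
  parameters built from r and the distance of x and y. The hypothesis on |E||F| ensures that at most
  7/12 of all pairs are at distance 0; the remaining 5/12, squared by Cauchy-Schwarz, is the origin
  of 144 = 12^2.\<close>

lemma card_roots_separable:
  fixes p :: "'b::alg_closed_field poly"
  assumes "p \<noteq> 0" and sep: "\<And>x. poly p x = 0 \<Longrightarrow> poly (pderiv p) x \<noteq> 0"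
  shows "card {x. poly p x = 0} = degree p"
proof -
  obtain A where A: "size A = degree p" "p = smult (lead_coeff p) (\<Prod>x\<in>#A. [:-x, 1:])"
    using alg_closed_imp_factorization[OF \<open>p \<noteq> 0\<close>] by blast
  have pr: "proots p = A"
  proof -
    have "proots p = proots (\<Prod>x\<in>#A. [:-x, 1:])"
      using A(2) \<open>p \<noteq> 0\<close> by (metis leading_coeff_0_iff proots_smult)
    also have "\<dots> = A"
    proof (induction A)
      case (add x A)
      have "(\<Prod>x\<in>#A. [:-x, 1:]) \<noteq> 0" by (auto simp: prod_mset_zero_iff)
      then have "proots ([:-x, 1:] * (\<Prod>x\<in>#A. [:-x, 1:])) = {#x#} + A"
        using add by (subst proots_mult) auto
      then show ?case by (simp del: mult_pCons_left)
    qed simp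
    finally show ?thesis .
  qed
  have one: "count (proots p) x = 1" if "x \<in># proots p" for x
  proof -
    have r: "poly p x = 0" using that \<open>p \<noteq> 0\<close> by simp
    have "Polynomial.order x p = 1"
    proof (rule ccontr)
      assume "Polynomial.order x p \<noteq> 1"
      moreover have "Polynomial.order x p \<noteq> 0" using r \<open>p \<noteq> 0\<close> order_root by blast
      ultimately have "[:-x,1:]^2 dvd p"
        by (metis One_nat_def Suc_1 Suc_leI nat_neq_iff less_one order_divides le_eq_less_or_eq not_less_eq_eq)
      then obtain g where "p = [:-x,1:]^2 * g" by (auto simp: dvd_def)
      then have "poly (pderiv p) x = 0"
        by (simp add: pderiv_mult pderiv_power_Suc pderiv_pCons numeral_2_eq_2 del: mult_pCons_left)
      with sep[OF r] show False by simp
    qed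
    then show ?thesis by (simp add: \<open>p \<noteq> 0\<close>)
  qed
  have "size (proots p) = (\<Sum>x\<in>set_mset (proots p). count (proots p) x)"
    by (simp add: size_multiset_overloaded_eq)
  also have "\<dots> = card (set_mset (proots p))" using one by simp
  finally show ?thesis using A(1) pr set_count_proots[OF \<open>p \<noteq> 0\<close>] by simp
qed

lemma pderiv_sum: "pderiv (\<Sum>i\<in>I. f i) = (\<Sum>i\<in>I. pderiv (f i))"
  by (induction I rule: infinite_finite_induct) (auto simp: pderiv_add)

text \<open>Were the field finite, the product of all X - x, increased by 1, would have positive
  degree and no root.\<close>

lemma infinite_alg_closed: "infinite (UNIV :: 'b::alg_closed_field set)"
proof
  assume fin: "finite (UNIV :: 'b set)"
  define p where "p = (\<Prod>x\<in>(UNIV::'b set). [:-x, 1:]) + 1"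
  have "degree (\<Prod>x\<in>(UNIV::'b set). [:-x, 1:]) = (\<Sum>x\<in>(UNIV::'b set). degree [:-x, 1:])"
    by (rule degree_prod_eq_sum_degree) auto
  also have "\<dots> = CARD('b)" by simp
  finally have "degree (\<Prod>x\<in>(UNIV::'b set). [:-x, 1:]) > 0"
    using fin by (simp add: finite_UNIV_card_ge_0)
  then have "degree p > 0" unfolding p_def by (subst degree_add_eq_left) auto
  then obtain x where "poly p x = 0" using alg_closed_imp_poly_has_root by blast
  moreover have "poly p x = 1" unfolding p_def using fin by (auto simp: poly_prod)
  ultimately show False by simp
qed

text \<open>Lets polynomial identities be checked at points, where Frobenius is additive and both
  roots of a quadratic are at hand.\<close>

lemma poly_eqI_alg_closed:
  fixes p q :: "'b::alg_closed_field poly"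
  assumes "\<And>x. poly p x = poly q x" shows "p = q"
proof -
  have "infinite {x. poly (p - q) x = 0}" using assms infinite_alg_closed by simp
  then show ?thesis using poly_roots_finite[of "p - q"] by auto
qed

lemma alg_closed_quadratic_roots:
  fixes u v :: "'b::alg_closed_field"
  obtains x y where "x + y = u" "x * y = v"
proof -
  have "degree [:v, -u, 1:] > 0" by simp
  then obtain x where "poly [:v, -u, 1:] x = 0" using alg_closed_imp_poly_has_root by blast
  then have "x + (u - x) = u" "x * (u - x) = v" by (auto simp: algebra_simps eq_neg_iff_add_eq_0)
  then show ?thesis using that by blast
qed

text \<open>The intended instance is the algebraic closure of a field of odd order \<open>q\<close>.
  Working inside one algebraically closed type makes all finite extensions subsets of it, so that
  degrees N and 2N can be compared directly.\<close>

locale frobenius =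
  fixes q :: nat and ty :: "'b::alg_closed_field itself"
  assumes q_odd: "odd q" and q_gt1: "q > 1"
    and q_zero: "of_nat q = (0::'b)"
    and frob_add1: "\<And>x y::'b. (x + y) ^ q = x ^ q + y ^ q"
begin

definition fld :: "nat \<Rightarrow> 'b set" where
  "fld N = {x. x ^ (q ^ N) = x}"

text \<open>The trace from \<open>fld N\<close> to \<open>fld 1\<close>. It is defined on the whole
  closure so that \<open>tr_of_frob_minus\<close> applies to an s that is not yet known to lie in
  \<open>fld N\<close>.\<close>

definition tr :: "nat \<Rightarrow> 'b \<Rightarrow> 'b" where
  "tr N y = (\<Sum>i<N. y ^ (q ^ i))"

lemma q_ge3: "q \<ge> 3" using q_odd q_gt1 by presburger

lemma frob_add: "(x + y :: 'b) ^ (q ^ N) = x ^ (q ^ N) + y ^ (q ^ N)"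
  by (induction N) (auto simp: power_mult frob_add1 mult.commute[of q])

lemma frob_minus: "(- x :: 'b) ^ (q ^ N) = - (x ^ (q ^ N))"
  using q_odd by simp

lemma frob_diff: "(x - y :: 'b) ^ (q ^ N) = x ^ (q ^ N) - y ^ (q ^ N)"
  using frob_add[of x "-y" N] by (simp add: frob_minus)

lemma frob_sum: "(\<Sum>i\<in>I. f i :: 'b) ^ (q ^ N) = (\<Sum>i\<in>I. f i ^ (q ^ N))"
  using q_gt1 by (induction I rule: infinite_finite_induct) (auto simp: frob_add zero_power)

lemma frob_poly_diff: "(A - B :: 'b poly) ^ (q ^ N) = A ^ (q ^ N) - B ^ (q ^ N)"
  by (rule poly_eqI_alg_closed) (simp add: poly_power frob_diff)

lemma of_nat_q_power: "N > 0 \<Longrightarrow> of_nat (q ^ N) = (0::'b)"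
  using q_zero by (simp add: zero_power)

lemma q_power_gt1: "N > 0 \<Longrightarrow> q ^ N > 1"
  using q_gt1 one_less_power by blast

lemma fld_0: "0 \<in> fld N" using q_gt1 by (simp add: fld_def zero_power)
lemma fld_1: "1 \<in> fld N" by (simp add: fld_def)
lemma fld_add: "x \<in> fld N \<Longrightarrow> y \<in> fld N \<Longrightarrow> x + y \<in> fld N"
  by (simp add: fld_def frob_add)
lemma fld_diff: "x \<in> fld N \<Longrightarrow> y \<in> fld N \<Longrightarrow> x - y \<in> fld N"
  by (simp add: fld_def frob_diff)
lemma fld_minus: "x \<in> fld N \<Longrightarrow> - x \<in> fld N"
  by (simp add: fld_def frob_minus)
lemma fld_mult: "x \<in> fld N \<Longrightarrow> y \<in> fld N \<Longrightarrow> x * y \<in> fld N"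
  by (simp add: fld_def power_mult_distrib)
lemma fld_divide: "x \<in> fld N \<Longrightarrow> y \<in> fld N \<Longrightarrow> x / y \<in> fld N"
  by (simp add: fld_def power_divide)
lemma fld_sum: "(\<And>i. i \<in> I \<Longrightarrow> f i \<in> fld N) \<Longrightarrow> (\<Sum>i\<in>I. f i) \<in> fld N"
  by (induction I rule: infinite_finite_induct) (auto intro: fld_0 fld_add)

lemma fld_mono_mult: "x \<in> fld N \<Longrightarrow> x \<in> fld (N * k)"
proof (induction k)
  case 0 show ?case by (simp add: fld_def)
next
  case (Suc k)
  then have "x ^ (q ^ (N * k)) = x" "x ^ q ^ N = x" by (auto simp: fld_def)
  then show ?case by (simp add: fld_def power_add power_mult)
qed

text \<open>The polynomial X^(q^N) - X has derivative -1, hence only simple roots.\<close>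

lemma card_fld: assumes "N > 0" shows "card (fld N) = q ^ N" "finite (fld N)"
proof -
  define p :: "'b poly" where "p = monom 1 (q ^ N) + monom (-1) 1"
  have gt: "q ^ N > 1" using q_power_gt1 assms by blast
  have deg: "degree p = q ^ N"
    unfolding p_def using gt by (subst degree_add_eq_left) (auto simp: degree_monom_eq)
  have p0: "p \<noteq> 0" using deg gt by (metis degree_0 less_zeroE)
  have "pderiv p = -1" unfolding p_def using of_nat_q_power[OF assms]
    by (simp add: pderiv_add pderiv_monom monom_0 one_pCons)
  then have "card {x. poly p x = 0} = degree p" by (intro card_roots_separable p0) auto
  moreover have eq: "{x. poly p x = 0} = fld N" by (auto simp: p_def fld_def poly_monom)
  ultimately show "card (fld N) = q ^ N" using deg by simp
  show "finite (fld N)" using eq poly_roots_finite[OF p0] by metis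
qed

section \<open>Traces and Artin-Schreier equations\<close>

lemma tr_add: "tr N (x + y) = tr N x + tr N y"
  by (simp add: tr_def frob_add sum.distrib)

lemma tr_diff: "tr N (x - y) = tr N x - tr N y"
  by (simp add: tr_def frob_diff sum_subtractf)

lemma tr_frob_minus: "tr N y ^ q - tr N y = y ^ (q ^ N) - y"
proof -
  have "tr N y ^ q = (\<Sum>i<N. y ^ (q ^ Suc i))"
    using frob_sum[of "\<lambda>i. y ^ (q ^ i)" "{..<N}" 1]
    by (simp add: tr_def mult.commute flip: power_mult)
  then have "tr N y ^ q - tr N y = (\<Sum>i<N. y ^ (q ^ Suc i) - y ^ (q ^ i))"
    by (simp add: tr_def sum_subtractf)
  also have "\<dots> = y ^ (q ^ N) - y" by (subst sum_lessThan_telescope) simp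
  finally show ?thesis .
qed

lemma tr_of_frob_minus: "tr N (s ^ q - s) = s ^ (q ^ N) - s"
proof -
  have "tr N (s ^ q - s) = (\<Sum>i<N. s ^ (q ^ Suc i) - s ^ (q ^ i))"
    by (simp add: tr_def frob_diff power_mult mult.commute flip: power_mult)
  also have "\<dots> = s ^ (q ^ N) - s" by (subst sum_lessThan_telescope) simp
  finally show ?thesis .
qed

lemma tr_in_fld: "y \<in> fld N \<Longrightarrow> tr N y \<in> fld 1"
  using tr_frob_minus[of N y] by (simp add: fld_def)

text \<open>The argument y + y^(q^N) is the relative trace from degree 2N to degree N; this is the
  form in which the sum over the larger field enters the doubling identity.\<close>

lemma tr_double: "tr (2 * N) y = tr N (y + y ^ (q ^ N))"
proof -
  have "tr N (y + y ^ (q ^ N)) = (\<Sum>i<N. y ^ (q ^ i)) + (\<Sum>i<N. y ^ (q ^ (N + i)))"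
    by (simp add: tr_def frob_add sum.distrib power_add power_mult)
  also have "(\<Sum>i<N. y ^ (q ^ (N + i))) = (\<Sum>i=N..<N+N. y ^ (q ^ i))"
    using sum.shift_bounds_nat_ivl[of "\<lambda>i. y ^ (q ^ i)" 0 N N]
    by (simp add: lessThan_atLeast0 add.commute)
  also have "(\<Sum>i<N. y ^ (q ^ i)) + \<dots> = tr (2 * N) y"
    by (simp add: tr_def mult_2 lessThan_atLeast0 sum.atLeastLessThan_concat)
  finally show ?thesis by simp
qed

lemma card_artin_schreier:
  fixes y :: 'b
  shows "card {s. s ^ q - s = y} = q"
proof -
  define p :: "'b poly" where "p = monom 1 q + [:-y, -1:]"
  have deg: "degree p = q"
    unfolding p_def using q_gt1 by (subst degree_add_eq_left) (auto simp: degree_monom_eq)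
  have p0: "p \<noteq> 0" using deg q_gt1 by auto
  have "pderiv p = -1" unfolding p_def using q_zero
    by (simp add: pderiv_diff pderiv_add pderiv_monom pderiv_pCons monom_0 one_pCons)
  then have "card {x. poly p x = 0} = degree p" by (intro card_roots_separable p0) auto
  moreover have eq: "{x. poly p x = 0} = {s. s ^ q - s = y}"
    by (auto simp: p_def poly_monom algebra_simps)
  ultimately show ?thesis using deg by simp
qed

text \<open>As a polynomial, \<open>tr N\<close> - c has degree q^(N-1) and derivative 1, because
  X^(q^i) differentiates to 0 for i > 0. Every root lies in \<open>fld N\<close>: by
  \<open>tr_frob_minus\<close> a trace fixed by Frobenius forces t^(q^N) = t. In particular the
  trace is onto.\<close>

lemma card_trace_fibre:
  fixes c :: 'b
  assumes "N > 0" "c \<in> fld 1"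
  shows "card {t \<in> fld N. tr N t = c} = q ^ (N - 1)"
proof -
  define p :: "'b poly" where "p = (\<Sum>i<N. monom 1 (q ^ i)) + [:-c:]"
  obtain M where M: "N = Suc M" using assms by (cases N) auto
  have pe: "poly p x = tr N x - c" for x by (simp add: p_def tr_def poly_sum poly_monom)
  have dl: "degree (\<Sum>i<M. monom (1::'b) (q ^ i) ) < q ^ M" if "M > 0"
  proof -
    have "degree (\<Sum>i<M. monom (1::'b) (q ^ i)) \<le> q ^ (M - 1)"
      by (rule degree_sum_le) (use that q_gt1 in \<open>auto simp: degree_monom_eq intro!: power_increasing\<close>)
    also have "\<dots> < q ^ M" using that q_gt1 by (intro power_strict_increasing) auto
    finally show ?thesis .
  qed
  have deg: "degree p = q ^ M"
  proof (cases "M = 0")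
    case True then show ?thesis unfolding p_def M by (subst degree_add_eq_left) (auto simp: degree_monom_eq)
  next
    case False
    have "degree ((\<Sum>i<M. monom (1::'b) (q ^ i)) + [:-c:]) < q ^ M"
      using dl False q_gt1 by (intro degree_add_less) auto
    moreover have "p = monom 1 (q ^ M) + ((\<Sum>i<M. monom (1::'b) (q ^ i)) + [:-c:])"
      by (simp add: p_def M)
    ultimately show ?thesis by (metis degree_add_eq_left degree_monom_eq one_neq_zero)
  qed
  have p0: "p \<noteq> 0" using deg q_gt1 by auto
  have "pderiv p = (\<Sum>i<N. monom (of_nat (q ^ i)) (q ^ i - 1))"
    by (simp add: p_def pderiv_add pderiv_sum pderiv_monom pderiv_pCons)
  also have "\<dots> = (\<Sum>i<N. if i = 0 then 1 else 0)"
    by (rule sum.cong) (use of_nat_q_power in \<open>auto simp: monom_0 one_pCons simp del: of_nat_power\<close>)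
  also have "\<dots> = 1" using M by (simp add: sum.lessThan_Suc_shift)
  finally have "card {x. poly p x = 0} = degree p" by (intro card_roots_separable p0) auto
  moreover have eq: "{x. poly p x = 0} = {t \<in> fld N. tr N t = c}"
  proof -
    have "t \<in> fld N" if "tr N t = c" for t
      using tr_frob_minus[of N t] that assms(2) by (simp add: fld_def)
    then show ?thesis by (auto simp: pe)
  qed
  ultimately show ?thesis using deg M by simp
qed

end

section \<open>Stepanov's method\<close>

text \<open>The coefficients of $x^n$ with respect to $1, x$ modulo $x^2 = h x - a$.\<close>

primrec xpow :: "'b::comm_ring_1 poly \<Rightarrow> 'b \<Rightarrow> nat \<Rightarrow> 'b poly \<times> 'b poly" where
  "xpow h a 0 = (1, 0)"
| "xpow h a (Suc n) = (smult (-a) (snd (xpow h a n)), fst (xpow h a n) + h * snd (xpow h a n))"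

lemma xpow_eval:
  assumes "x * x = poly h s * x - a"
  shows "x ^ n = poly (fst (xpow h a n)) s + poly (snd (xpow h a n)) s * x"
proof (induction n)
  case (Suc n)
  define A B where "A = poly (fst (xpow h a n)) s" and "B = poly (snd (xpow h a n)) s"
  have "x ^ Suc n = (A + B * x) * x" using Suc by (simp add: A_def B_def mult.commute)
  also have "\<dots> = A * x + B * (x * x)" by (simp add: algebra_simps)
  also have "\<dots> = - a * B + (A + poly h s * B) * x" by (simp add: assms algebra_simps)
  finally show ?case by (simp add: A_def B_def)
qed simp

text \<open>Here x carries the weight k of h, and the second coefficient is a factor of x, whence
  the n - 1. This saving of k is what later balances the degrees of the two components in the
  pigeonhole count.\<close>

lemma xpow_degree:
  assumes "degree h \<le> k"
  shows "degree (fst (xpow h a n)) \<le> k * n" "degree (snd (xpow h a n)) \<le> k * (n - 1)"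
proof (induction n)
  case (Suc n)
  { case 1 
    have "degree (fst (xpow h a (Suc n))) \<le> k * (n - 1)"
      using Suc(2) degree_smult_le[of "-a" "snd (xpow h a n)"] by (simp del: minus_mult_left)
    then show ?case by (rule order.trans) (rule mult_le_mono2, simp) }
  { case 2
    have "degree (h * snd (xpow h a n)) \<le> k * n"
    proof (cases n)
      case (Suc m)
      have "degree (h * snd (xpow h a n)) \<le> degree h + degree (snd (xpow h a n))"
        by (rule degree_mult_le)
      also have "\<dots> \<le> k + k * (n - 1)" using assms Suc.IH(2) by (intro add_mono) auto
      finally show ?thesis using Suc by simp
    qed simp
    then show ?case using Suc(1) by (simp add: degree_add_le) }
qed simp_all

text \<open>The norm of C + D x down to polynomials in s, where x is a root of x^2 = h x - a and the
  conjugate root is h - x.\<close>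

definition quad_norm :: "'b::comm_ring_1 poly \<Rightarrow> 'b \<Rightarrow> 'b poly \<Rightarrow> 'b poly \<Rightarrow> 'b poly" where
  "quad_norm h a C D = C * C + C * D * h + smult a (D * D)"

lemma poly_quad_norm:
  assumes "x + y = poly h s" "x * y = a"
  shows "poly (quad_norm h a C D) s = (poly C s + poly D s * x) * (poly C s + poly D s * y)"
  by (simp add: quad_norm_def flip: assms) (simp add: algebra_simps)

lemma degree_quad_norm:
  assumes "degree h \<le> k" "degree C \<le> n" "degree D + k \<le> n"
  shows "degree (quad_norm h a C D) \<le> 2 * n"
proof -
  have "degree (C * C) \<le> 2 * n" using degree_mult_le[of C C] assms by linarith
  moreover have "degree (C * D * h) \<le> 2 * n"
    using degree_mult_le[of "C * D" h] degree_mult_le[of C D] assms by linarith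
  moreover have "degree (smult a (D * D)) \<le> 2 * n"
    using degree_mult_le[of D D] degree_smult_le[of a "D * D"] assms by linarith
  ultimately show ?thesis unfolding quad_norm_def by (intro degree_add_le)
qed

text \<open>The form is anisotropic because $x + a/x = h$ has no solution in $K(s)$: a common root of
  numerator and denominator can be cancelled.\<close>

lemma quad_norm_eq_0:
  fixes h :: "'b::alg_closed_field poly"
  assumes h: "degree h > 0" and a: "a \<noteq> 0" and "quad_norm h a C D = 0"
  shows "C = 0 \<and> D = 0"
  using assms(3)
proof (induction "degree D" arbitrary: C D rule: less_induct)
  case less
  have eq: "C * C + C * D * h + smult a (D * D) = 0" using less.prems by (simp add: quad_norm_def)
  show ?case
  proof (cases "D = 0")
    case True then show ?thesis using eq by simp
  next
    case D0: False
    show ?thesis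
    proof (cases "degree D > 0")
      case True
      then obtain r where r: "poly D r = 0" using alg_closed_imp_poly_has_root by blast
      have "poly (C * C + C * D * h + smult a (D * D)) r = 0" using eq by simp
      then have "poly C r = 0" using r by simp
      then obtain C' D' where CD: "C = [:-r,1:] * C'" "D = [:-r,1:] * D'"
        using r by (auto simp: poly_eq_0_iff_dvd dvd_def)
      have "D' \<noteq> 0" using D0 CD by auto
      then have dD: "degree D = Suc (degree D')" unfolding CD by (subst degree_mult_eq) auto
      have "[:-r,1:] * [:-r,1:] * quad_norm h a C' D' = quad_norm h a C D"
        unfolding quad_norm_def CD by (simp add: algebra_simps del: mult_pCons_left mult_pCons_right)
      then have "quad_norm h a C' D' = 0" using less.prems by (metis mult_eq_0_iff one_neq_zero pCons_eq_0_iff)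
      then have "C' = 0 \<and> D' = 0" using less.hyps[of D' C'] dD by simp
      then show ?thesis using CD by simp
    next
      case False
      then obtain b where b: "D = [:b:]" by (auto elim: degree_eq_zeroE)
      with D0 have b0: "b \<noteq> 0" by simp
      \<comment> \<open>For a nonzero constant D the equation is a product of two polynomials equal
        to a nonzero constant. Both factors are then constant, and so is their difference D * h,
        against degree h > 0.\<close>
      have "C * (C + D * h) + [:a * b * b:] = 0"
        using eq by (simp add: b algebra_simps)
      then have e2: "C * (C + D * h) = - [:a * b * b:]" by (simp only: eq_neg_iff_add_eq_0)
      then have "C * (C + D * h) \<noteq> 0" using a b0 by simp
      then have "C \<noteq> 0" "C + D * h \<noteq> 0" by (metis mult_zero_left, metis mult_zero_right)
      then have "degree C + degree (C + D * h) = 0"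
        using degree_mult_eq[of C "C + D * h"] unfolding e2 by simp
      then have "degree C = 0" "degree (C + D * h) = 0" by auto
      then have "degree ((C + D * h) - C) = 0" using degree_diff_le by (metis le_zero_eq)
      then have "degree (D * h) = 0" by simp
      then show ?thesis using b b0 h by simp
    qed
  qed
qed

text \<open>After division by s^(jR), where j is the first index that may contribute, all later
  terms still contain the factor s^R.\<close>

lemma monom_dvd_lowest_term:
  fixes C :: "nat \<Rightarrow> 'b::idom poly"
  assumes "(\<Sum>i\<le>e. monom 1 (i * R) * C i) = 0" "\<And>i. i < j \<Longrightarrow> C i = 0" "j \<le> e"
  shows "monom 1 R dvd C j"
proof -
  have "(\<Sum>i\<le>e. monom 1 (i * R) * C i) = monom 1 (j * R) * C j + (\<Sum>i\<in>{..e}-{j}. monom 1 (i * R) * C i)"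
    using assms(3) by (subst sum.remove[of _ j]) auto
  then have "monom 1 (j * R) * C j = - (\<Sum>i\<in>{..e}-{j}. monom 1 (i * R) * C i)"
    using assms(1) by (simp add: eq_neg_iff_add_eq_0)
  moreover have "monom 1 (j * R) * monom 1 R dvd (\<Sum>i\<in>{..e}-{j}. monom 1 (i * R) * C i)"
  proof (rule dvd_sum)
    fix i assume i: "i \<in> {..e}-{j}"
    show "monom 1 (j * R) * monom 1 R dvd monom 1 (i * R) * C i"
    proof (cases "i < j")
      case True then show ?thesis using assms(2) by simp
    next
      case False
      then obtain k where "i = j + 1 + k" using i by (auto dest: less_imp_Suc_add simp: not_less_iff_gr_or_eq)
      then have "monom (1::'b) (i * R) = monom 1 (j * R) * monom 1 R * monom 1 (k * R)"
        by (simp add: mult_monom algebra_simps)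
      then show ?thesis by (simp add: mult.assoc)
    qed
  qed
  ultimately have "monom 1 (j * R) * monom 1 R dvd monom 1 (j * R) * C j" by simp
  then show ?thesis by (simp add: dvd_mult_cancel_left)
qed

lemma dvd_degree_imp_0:
  fixes p :: "'b::field poly"
  assumes "monom 1 R dvd p" "degree p < R" shows "p = 0"
proof (rule ccontr)
  assume "p \<noteq> 0"
  then have "degree (monom (1::'b) R) \<le> degree p" using assms(1) by (intro dvd_imp_degree_le)
  then show False using assms(2) by (simp add: degree_monom_eq)
qed

section \<open>Nonvanishing of the auxiliary function\<close>

context frobenius
begin

text \<open>Since \<open>h\<close> takes the value \<open>t0\<close> at 0, \<xi> is a value of x
  over s = 0. Modulo s^R the function A + B x + (A' + B' x) x^R is 0, and replacing x^R by the
  constant \<xi>^R changes it by (x^R - \<xi>^R)(A' + B' x), whose norm is divisible by s^R. What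
  remains is C + D x with C = A + \<xi>^R A' and D = B + \<xi>^R B'. Its norm is divisible by s^R
  but has degree at most 2d < R, so it is 0, and the norm form is anisotropic.\<close>

lemma stepanov_cancel:
  fixes h A B A' B' :: "'b poly" and a t0 \<xi> :: 'b and m :: nat
  defines "R \<equiv> q ^ m"
  assumes h: "h = monom 1 q + [:t0, -1:]" and a: "a \<noteq> 0"
    and \<xi>: "\<xi> * \<xi> - t0 * \<xi> + a = 0"
    and deg: "degree A \<le> d" "degree A' \<le> d" "degree B + q \<le> d" "degree B' + q \<le> d"
    and dR: "2 * d < R"
    and dv1: "monom 1 R dvd A + fst (xpow h a R) * A' + fst (xpow h a (Suc R)) * B'"
    and dv2: "monom 1 R dvd B + snd (xpow h a R) * A' + snd (xpow h a (Suc R)) * B'"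
  shows "A + smult (\<xi> ^ R) A' = 0" "B + smult (\<xi> ^ R) B' = 0"
proof -
  define al be where "al = fst (xpow h a R)" and "be = snd (xpow h a R)"
  define c where "c = [:\<xi> ^ R:]"
  define P where "P = al - c"
  have degh: "degree h = q" unfolding h using q_gt1
    by (subst degree_add_eq_left) (auto simp: degree_monom_eq)
  \<comment> \<open>\<open>P\<close> + \<open>be\<close> x is x^R - \<xi>^R. Its norm is the R-th
    power of (x - \<xi>)(y - \<xi>) = \<xi> (s - s^q), which vanishes at s = 0.\<close>
  have nP: "quad_norm h a P be = smult (\<xi> ^ R) ((monom 1 1 - monom 1 q) ^ R)"
  proof (rule poly_eqI_alg_closed)
    fix s :: 'b
    obtain x y where xy: "x + y = poly h s" "x * y = a" using alg_closed_quadratic_roots by blast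
    have hx: "x * x = poly h s * x - a" "y * y = poly h s * y - a"
      by (auto simp flip: xy simp: algebra_simps)
    have "poly (quad_norm h a P be) s = (poly al s + poly be s * x - \<xi> ^ R) * (poly al s + poly be s * y - \<xi> ^ R)"
      by (subst poly_quad_norm[OF xy]) (simp add: P_def c_def algebra_simps)
    also have "\<dots> = (x ^ R - \<xi> ^ R) * (y ^ R - \<xi> ^ R)"
      using xpow_eval[OF hx(1), of R] xpow_eval[OF hx(2), of R] by (simp add: al_def be_def)
    also have "\<dots> = ((x - \<xi>) * (y - \<xi>)) ^ R"
      by (simp add: R_def frob_diff power_mult_distrib)
    also have "(x - \<xi>) * (y - \<xi>) = a - \<xi> * poly h s + \<xi> * \<xi>"
      unfolding xy(1)[symmetric] xy(2)[symmetric] by (simp add: algebra_simps)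
    also have "\<dots> = \<xi> * (s - s ^ q)"
      using \<xi> by (simp add: h poly_monom algebra_simps)
    finally show "poly (quad_norm h a P be) s = poly (smult (\<xi> ^ R) ((monom 1 1 - monom 1 q) ^ R)) s"
      by (simp add: power_mult_distrib poly_power poly_monom)
  qed
  have "monom (1::'b) 1 - monom 1 q = monom 1 1 * (1 - monom 1 (q - 1))"
    using q_gt1 by (simp add: algebra_simps mult_monom)
  then have dP: "monom 1 R dvd quad_norm h a P be"
    unfolding nP by (simp add: power_mult_distrib monom_power dvd_smult)
  define C where "C = A + c * A'"
  define D where "D = B + c * B'"
  obtain k1 where k1: "A + al * A' - smult a be * B' = monom 1 R * k1"
    using dv1 by (auto simp: al_def be_def dvd_def)
  obtain k2 where k2: "B + be * A' + (al + h * be) * B' = monom 1 R * k2"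
    using dv2 by (auto simp: al_def be_def dvd_def)
  \<comment> \<open>U + V x is the product (x^R - \<xi>^R)(A' + B' x), and C + D x is congruent to
    -(U + V x) modulo s^R.\<close>
  define U where "U = P * A' - smult a be * B'"
  define V where "V = P * B' + be * A' + h * be * B'"
  have C: "C = monom 1 R * k1 - U" unfolding C_def U_def P_def k1[symmetric] by (simp add: algebra_simps)
  have D: "D = monom 1 R * k2 - V" unfolding D_def V_def P_def k2[symmetric] by (simp add: algebra_simps)
  have nUV: "quad_norm h a U V = quad_norm h a P be * quad_norm h a A' B'"
    unfolding quad_norm_def U_def V_def by (simp add: algebra_simps smult_add_right)
  have "monom 1 R dvd quad_norm h a C D - quad_norm h a U V"
  proof -
    have "quad_norm h a C D - quad_norm h a U V =
      (C + U) * (C - U) + (C + U) * D * h - U * (D + V) * h + smult a ((D + V) * (D - V))"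
      unfolding quad_norm_def by (simp add: algebra_simps smult_diff_right)
    moreover have "C + U = monom 1 R * k1" "D + V = monom 1 R * k2" by (simp_all add: C D)
    ultimately show ?thesis by (auto intro!: dvd_add dvd_diff dvd_smult simp: mult.assoc mult.left_commute[of U])
  qed
  moreover have "monom 1 R dvd quad_norm h a U V" unfolding nUV using dP by simp
  ultimately have dC: "monom 1 R dvd quad_norm h a C D" using dvd_add[of "monom 1 R" "quad_norm h a C D - quad_norm h a U V" "quad_norm h a U V"] by simp
  have "degree (quad_norm h a C D) \<le> 2 * d"
  proof (rule degree_quad_norm)
    show "degree h \<le> q" using degh by simp
    have *: "degree (S + c * T) \<le> max (degree S) (degree T)" for S T :: "'b poly"
      by (rule order.trans[OF degree_add_le_max]) (auto simp: c_def intro: order.trans[OF degree_smult_le])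
    show "degree C \<le> d" using *[of A A'] deg by (simp add: C_def)
    show "degree D + q \<le> d" using *[of B B'] deg by (simp add: D_def max_def split: if_splits)
  qed
  then have "quad_norm h a C D = 0" using dvd_degree_imp_0[OF dC] dR by simp
  then have "C = 0 \<and> D = 0" using quad_norm_eq_0[of h a C D] degh q_gt1 a by simp
  then show "A + smult (\<xi> ^ R) A' = 0" "B + smult (\<xi> ^ R) B' = 0" by (simp_all add: C_def D_def c_def)
qed

text \<open>By the discriminant condition two distinct points (0, x) and (0, y) lie over s = 0. At
  the lowest index not yet known to vanish, \<open>stepanov_cancel\<close> at both points gives A j
  + x^R A' j = 0 = A j + y^R A' j, and likewise for B and B'. As Frobenius is injective, x^R
  \<noteq> y^R, so all four vanish.\<close>

lemma stepanov_nonzero: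
  fixes h :: "'b poly" and A B A' B' :: "nat \<Rightarrow> 'b poly" and a t0 :: 'b and m :: nat
  defines "R \<equiv> q ^ m"
  assumes h: "h = monom 1 q + [:t0, -1:]" and a: "a \<noteq> 0" and disc: "t0 * t0 \<noteq> 4 * a"
    and deg: "\<And>j. degree (A j) \<le> d" "\<And>j. degree (A' j) \<le> d" "\<And>j. degree (B j) + q \<le> d" "\<And>j. degree (B' j) + q \<le> d"
    and dR: "2 * d < R"
    and Ga: "(\<Sum>j\<le>e. monom 1 (j * R) * (A j + fst (xpow h a R) * A' j + fst (xpow h a (Suc R)) * B' j)) = 0"
    and Gb: "(\<Sum>j\<le>e. monom 1 (j * R) * (B j + snd (xpow h a R) * A' j + snd (xpow h a (Suc R)) * B' j)) = 0"
    and "j \<le> e"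
  shows "A j = 0 \<and> B j = 0 \<and> A' j = 0 \<and> B' j = 0"
  using \<open>j \<le> e\<close>
proof (induction j rule: less_induct)
  case (less j)
  then have z: "A i = 0" "B i = 0" "A' i = 0" "B' i = 0" if "i < j" for i using that by auto
  obtain x y where xy: "x + y = t0" "x * y = a" using alg_closed_quadratic_roots by blast
  have "x \<noteq> y" using disc by (auto simp flip: xy simp: algebra_simps)
  have xr: "x * x - t0 * x + a = 0" and yr: "y * y - t0 * y + a = 0"
    by (simp_all flip: xy add: algebra_simps)
  have d1: "monom 1 R dvd A j + fst (xpow h a R) * A' j + fst (xpow h a (Suc R)) * B' j"
    by (rule monom_dvd_lowest_term[OF Ga _ \<open>j \<le> e\<close>]) (simp add: z)
  have d2: "monom 1 R dvd B j + snd (xpow h a R) * A' j + snd (xpow h a (Suc R)) * B' j"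
    by (rule monom_dvd_lowest_term[OF Gb _ \<open>j \<le> e\<close>]) (simp add: z)
  have e1: "A j + smult (x ^ R) (A' j) = 0" "B j + smult (x ^ R) (B' j) = 0"
    using stepanov_cancel[OF h a xr deg(1)[of j] deg(2)[of j] deg(3)[of j] deg(4)[of j], of m]
      dR d1 d2 unfolding R_def by auto
  have e2: "A j + smult (y ^ R) (A' j) = 0" "B j + smult (y ^ R) (B' j) = 0"
    using stepanov_cancel[OF h a yr deg(1)[of j] deg(2)[of j] deg(3)[of j] deg(4)[of j], of m]
      dR d1 d2 unfolding R_def by auto
  have "x ^ R - y ^ R \<noteq> 0" using \<open>x \<noteq> y\<close> by (simp add: R_def flip: frob_diff)
  moreover have "smult (x ^ R - y ^ R) (A' j) = 0" "smult (x ^ R - y ^ R) (B' j) = 0"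
    using e1 e2 by (simp_all add: smult_diff_left) (metis add_left_cancel)+
  ultimately have "A' j = 0" "B' j = 0" by auto
  with e1 show ?case by simp
qed

end

text \<open>Over a given s there are at most two points, and the order of s as a root of the norm
  pays for them: one zero makes the norm vanish at s, and if both conjugate points are zeros, then
  \<open>Ga\<close> and \<open>Gb\<close> themselves vanish at s and (X - s)^2 divides the
  norm.\<close>

lemma card_curve_zeros_le:
  fixes h Ga Gb :: "'b::field poly"
  assumes nz: "quad_norm h a Ga Gb \<noteq> 0" and fin: "finite S"
    and Z: "Z \<subseteq> S \<times> S" "\<And>s x. (s, x) \<in> Z \<Longrightarrow> x * x = poly h s * x - a"
    and van: "\<And>s x. (s, x) \<in> Z \<Longrightarrow> poly Ga s + poly Gb s * x = 0"
  shows "card Z \<le> degree (quad_norm h a Ga Gb)"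
proof -
  define n where "n = quad_norm h a Ga Gb"
  have finX: "finite Z" using Z(1) fin by (meson finite_SigmaI finite_subset)
  define T where "T = fst ` Z"
  have finT: "finite T" using finX T_def by simp
  have fibre: "card {x. (s, x) \<in> Z} \<le> Polynomial.order s n" if "s \<in> T" for s
  proof -
    have finF: "finite {x. (s, x) \<in> Z}"
      by (rule finite_subset[of _ "snd ` Z"]) (use finX in force)+
    obtain x where x: "(s, x) \<in> Z" using \<open>s \<in> T\<close> by (auto simp: T_def)
    define y where "y = poly h s - x"
    have xy: "x + y = poly h s" "x * y = a" using Z(2)[OF x] by (auto simp: y_def algebra_simps)
    have sub: "{x. (s, x) \<in> Z} \<subseteq> {x, y}"
    proof
      fix z assume "z \<in> {x. (s, x) \<in> Z}"
      then have z: "(s, z) \<in> Z" by simp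
      have "(z - x) * (z - y) = z * z - (x + y) * z + x * y" by (simp add: algebra_simps)
      also have "\<dots> = 0" using Z(2)[OF z] xy by simp
      finally show "z \<in> {x, y}" by auto
    qed
    have root: "poly n s = 0" using van[OF x] by (simp add: n_def poly_quad_norm[OF xy])
    show ?thesis
    proof (cases "y \<noteq> x \<and> (s, y) \<in> Z")
      case True
      then have "poly Ga s + poly Gb s * x = 0" "poly Ga s + poly Gb s * y = 0" using van x by auto
      then have "poly Gb s * (x - y) = 0" by (metis add_left_cancel right_diff_distrib eq_iff_diff_eq_0)
      then have "poly Gb s = 0" "poly Ga s = 0" using True van[OF x] by auto
      then obtain g1 g2 where g: "Ga = [:-s,1:] * g1" "Gb = [:-s,1:] * g2"
        by (auto simp: poly_eq_0_iff_dvd dvd_def)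
      have "n = [:-s,1:] ^ 2 * quad_norm h a g1 g2"
        unfolding n_def quad_norm_def g power2_eq_square
        by (simp add: algebra_simps del: mult_pCons_left mult_pCons_right)
      then have "2 \<le> Polynomial.order s n" using nz unfolding n_def[symmetric]
        by (metis dvd_triv_left order_divides)
      moreover have "card {x. (s, x) \<in> Z} \<le> 2"
        using card_mono[OF _ sub] card_2_iff[of "{x, y}"] True by auto
      ultimately show ?thesis by simp
    next
      case False
      then have "{x. (s, x) \<in> Z} \<subseteq> {x}" using sub by auto
      then have "card {x. (s, x) \<in> Z} \<le> 1" using card_mono[of "{x}"] by fastforce
      moreover have "Polynomial.order s n \<noteq> 0" using root nz order_root n_def by blast
      ultimately show ?thesis by simp
    qed
  qed
  have "Z = Sigma T (\<lambda>s. {x. (s, x) \<in> Z})" by (force simp: T_def)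
  then have "card Z = card (Sigma T (\<lambda>s. {x. (s, x) \<in> Z}))" by simp
  also have "\<dots> = (\<Sum>s\<in>T. card {x. (s, x) \<in> Z})"
  proof (rule card_SigmaI[OF finT], rule ballI)
    show "finite {x. (s, x) \<in> Z}" for s
      by (rule finite_subset[of _ "snd ` Z"]) (use finX in force)+
  qed
  also have "\<dots> \<le> (\<Sum>s\<in>T. Polynomial.order s n)" by (rule sum_mono) (rule fibre)
  also have "\<dots> = (\<Sum>s\<in>T. count (proots n) s)" using nz by (simp add: n_def)
  also have "\<dots> \<le> size (proots n)"
  proof -
    have "(\<Sum>s\<in>T. count (proots n) s) = (\<Sum>s\<in>T \<inter> set_mset (proots n). count (proots n) s)"
      by (rule sum.mono_neutral_right) (auto simp: finT count_eq_zero_iff simp del: count_proots set_count_proots)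
    also have "\<dots> \<le> (\<Sum>s\<in>set_mset (proots n). count (proots n) s)"
      by (rule sum_mono2) auto
    finally show ?thesis by (simp add: size_multiset_overloaded_eq)
  qed
  also have "\<dots> \<le> degree n" by (rule size_proots_le)
  finally show ?thesis by (simp add: n_def)
qed

section \<open>The auxiliary function by the pigeonhole principle\<close>

context frobenius
begin

definition cfs :: "nat \<Rightarrow> 'b poly set" where
  "cfs N = {p. \<forall>i. coeff p i \<in> fld N}"

lemma cfs_0: "0 \<in> cfs N" by (simp add: cfs_def fld_0)
lemma cfs_1: "1 \<in> cfs N" by (auto simp: cfs_def fld_0 fld_1)
lemma cfs_add: "p \<in> cfs N \<Longrightarrow> r \<in> cfs N \<Longrightarrow> p + r \<in> cfs N"
  by (simp add: cfs_def fld_add)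
lemma cfs_mult: "p \<in> cfs N \<Longrightarrow> r \<in> cfs N \<Longrightarrow> p * r \<in> cfs N"
  by (auto simp: cfs_def coeff_mult intro!: fld_sum fld_mult)
lemma cfs_smult: "c \<in> fld N \<Longrightarrow> r \<in> cfs N \<Longrightarrow> smult c r \<in> cfs N"
  by (auto simp: cfs_def intro!: fld_mult)
lemma cfs_monom: "c \<in> fld N \<Longrightarrow> monom c n \<in> cfs N"
  by (auto simp: cfs_def fld_0)
lemma cfs_power: "p \<in> cfs N \<Longrightarrow> p ^ n \<in> cfs N"
  by (induction n) (auto intro: cfs_mult cfs_1)
lemma cfs_sum: "(\<And>i. i \<in> I \<Longrightarrow> f i \<in> cfs N) \<Longrightarrow> (\<Sum>i\<in>I. f i) \<in> cfs N"
  by (induction I rule: infinite_finite_induct) (auto intro: cfs_0 cfs_add)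

lemma cfs_xpow:
  assumes "h \<in> cfs N" "a \<in> fld N"
  shows "fst (xpow h a n) \<in> cfs N \<and> snd (xpow h a n) \<in> cfs N"
  by (induction n) (use assms in \<open>auto intro!: cfs_0 cfs_1 cfs_add cfs_mult cfs_smult fld_minus simp del: smult_minus_left\<close>)

text \<open>Coefficients are confined to a finite field so that the candidates can be counted;
  counting replaces linear algebra, since the conditions imposed later involve R-th powers and are
  only additive.\<close>

definition pol :: "nat \<Rightarrow> nat \<Rightarrow> 'b poly set" where
  "pol N d = {p \<in> cfs N. degree p \<le> d}"

lemma card_pol:
  assumes "N > 0" shows "finite (pol N d)" "card (pol N d) = (q ^ N) ^ (d + 1)"
proof -
  have "bij_betw (\<lambda>p. restrict (coeff p) {..d}) (pol N d) (PiE {..d} (\<lambda>_. fld N))"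
  proof (rule bij_betw_byWitness[where f' = "\<lambda>f. \<Sum>i\<le>d. monom (f i) i"])
    show "\<forall>p\<in>pol N d. (\<Sum>i\<le>d. monom (restrict (coeff p) {..d} i) i) = p"
      by (auto simp: pol_def poly_as_sum_of_monoms')
    show "\<forall>f\<in>PiE {..d} (\<lambda>_. fld N). restrict (coeff (\<Sum>i\<le>d. monom (f i) i)) {..d} = f"
      by (auto simp: coeff_sum fun_eq_iff PiE_def extensional_def restrict_def)
    show "(\<lambda>p. restrict (coeff p) {..d}) ` pol N d \<subseteq> PiE {..d} (\<lambda>_. fld N)"
      by (rule image_subsetI) (simp add: pol_def cfs_def)
    show "(\<lambda>f. \<Sum>i\<le>d. monom (f i) i) ` PiE {..d} (\<lambda>_. fld N) \<subseteq> pol N d"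
    proof safe
      fix f assume f: "f \<in> PiE {..d} (\<lambda>_. fld N)"
      have "degree (\<Sum>i\<le>d. monom (f i) i) \<le> d"
        by (rule degree_sum_le) (auto intro: order.trans[OF degree_monom_le])
      then show "(\<Sum>i\<le>d. monom (f i) i) \<in> pol N d"
        using f by (auto simp: pol_def intro!: cfs_sum cfs_monom)
    qed
  qed
  then have "card (pol N d) = card (PiE {..d} (\<lambda>_. fld N))"
    and "finite (pol N d) \<longleftrightarrow> finite (PiE {..d} (\<lambda>_. fld N))"
    by (rule bij_betw_same_card, rule bij_betw_finite)
  then show "finite (pol N d)" "card (pol N d) = (q ^ N) ^ (d + 1)"
    using card_fld[OF assms] by (auto simp: card_PiE intro!: finite_PiE)
qed

lemma pol_sum_monom:
  assumes "\<And>j. j \<in> J \<Longrightarrow> f j \<in> cfs N" "\<And>j. j \<in> J \<Longrightarrow> j + degree (f j) \<le> n"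
  shows "(\<Sum>j\<in>J. monom 1 j * f j) \<in> pol N n"
proof -
  have "degree (monom 1 j * f j) \<le> n" if "j \<in> J" for j
    using assms(2)[OF that] degree_mult_le[of "monom 1 j" "f j"] degree_monom_le[of "1::'b" j] by linarith
  then have "degree (\<Sum>j\<in>J. monom 1 j * f j) \<le> n"
    by (cases "finite J") (auto intro: degree_sum_le)
  then show ?thesis using assms(1) by (auto simp: pol_def intro!: cfs_sum cfs_mult cfs_monom fld_1)
qed

lemma pol_add: "p \<in> pol N n \<Longrightarrow> r \<in> pol N n \<Longrightarrow> p + r \<in> pol N n"
  by (auto simp: pol_def intro: cfs_add degree_add_le)

lemma degree_mult_power_le:
  "degree u \<le> i \<Longrightarrow> degree v \<le> j \<Longrightarrow> degree (u * v ^ R :: 'b poly) \<le> i + R * j"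
  by (rule order.trans[OF degree_mult_le add_mono[OF _ order.trans[OF degree_power_le]]])
    (simp_all add: mult.commute)

text \<open>The function sought is G, the sum over j of s^(jR) (A_j + B_j x + A'_j x^R + B'_j
  x^(R+1)). At points over the field of order R^2 its R-th power is the sum of s^j (A_j^R + B_j^R
  x^R + A'_j^R x + B'_j^R x^(R+1)). The last two equations say that the coefficients of 1 and x in
  this expression vanish identically. They are additive in the unknowns because \<open>R\<close> is
  a power of \<open>q\<close>, so two families with the same image yield a solution by
  subtraction.\<close>

lemma stepanov_kernel:
  fixes h :: "'b poly" and a :: 'b and m d :: nat
  defines "R \<equiv> q ^ m" and "N \<equiv> 2 * m" and "e \<equiv> d + q"
  assumes h: "h \<in> cfs N" "degree h \<le> q" and a: "a \<in> fld N" and m: "m > 0"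
    and Rd: "R = 2 * d + 1" and qd: "q \<le> d" and big: "q * q + q < 2 * R"
  obtains A A' B B' where
    "\<And>j. degree (A j) \<le> d" "\<And>j. degree (A' j) \<le> d"
    "\<And>j. degree (B j) + q \<le> d" "\<And>j. degree (B' j) + q \<le> d"
    "\<And>j. j > d \<Longrightarrow> A' j = 0 \<and> B' j = 0"
    "\<exists>j\<le>e. \<not> (A j = 0 \<and> B j = 0 \<and> A' j = 0 \<and> B' j = 0)"
    "(\<Sum>j\<le>e. monom 1 j * (A j ^ R + fst (xpow h a R) * B j ^ R + fst (xpow h a (Suc R)) * B' j ^ R)) = 0"
    "(\<Sum>j\<le>e. monom 1 j * (A' j ^ R + snd (xpow h a R) * B j ^ R + snd (xpow h a (Suc R)) * B' j ^ R)) = 0"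
proof -
  define al be al1 be1 where "al = fst (xpow h a R)" and "be = snd (xpow h a R)"
    and "al1 = fst (xpow h a (Suc R))" and "be1 = snd (xpow h a (Suc R))"
  have cf: "al \<in> cfs N" "be \<in> cfs N" "al1 \<in> cfs N" "be1 \<in> cfs N"
    unfolding al_def be_def al1_def be1_def using cfs_xpow[OF h(1) a] by blast+
  have R0: "R > 0" using Rd by simp
  have dg: "degree al \<le> q * R" "degree be \<le> q * (R - 1)" "degree al1 \<le> q * (R + 1)" "degree be1 \<le> q * R"
    unfolding al_def be_def al1_def be1_def using xpow_degree[OF h(2)] by (metis Suc_eq_plus1 diff_Suc_1)+
  define PA where "PA = pol N d \<times> pol N (d - q)"
  \<comment> \<open>The index ranges exhaust the degree bounds of both components. In the first,
    \<open>al1\<close> of degree up to q(R+1) costs q extra, so its index stops at d = e - q; in the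
    second, \<open>be\<close> of degree up to q(R-1) leaves q to spare, so its index may run up to
    e.\<close>
  define Dom where "Dom = PiE {..e} (\<lambda>_. PA) \<times> PiE {..d} (\<lambda>_. PA)"
  define Tgt where "Tgt = pol N (e + R * d) \<times> pol N (d + R * d)"
  define F0 where "F0 = (\<lambda>(f, g). (\<Sum>j\<le>e. monom 1 j * (fst (f j) ^ R + al * snd (f j) ^ R))
      + (\<Sum>j\<le>d. monom 1 j * (al1 * snd (g j :: 'b poly \<times> 'b poly) ^ R)))"
  define F1 where "F1 = (\<lambda>(f, g). (\<Sum>j\<le>e. monom 1 j * (be * snd (f j :: 'b poly \<times> 'b poly) ^ R))
      + (\<Sum>j\<le>d. monom 1 j * (fst (g j) ^ R + be1 * snd (g j) ^ R)))"
  have N0: "N > 0" using m by (simp add: N_def)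
  have Rdq: "R * (d - q) + q * R = R * d"
    using qd by (simp add: diff_mult_distrib2 mult.commute[of q])
  have Rdq': "q * (R - 1) + R * (d - q) + q = R * d"
  proof -
    obtain R' u where "R = Suc R'" "d = q + u" using R0 qd by (metis gr0_conv_Suc le_iff_add)
    then show ?thesis by (simp add: algebra_simps)
  qed
  have into: "(\<lambda>z. (F0 z, F1 z)) ` Dom \<subseteq> Tgt"
  proof safe
    fix f g assume fg: "(f, g) \<in> Dom"
    have f: "fst (f j) \<in> pol N d" "snd (f j) \<in> pol N (d - q)" if "j \<le> e" for j
      using fg that by (auto simp: Dom_def PA_def PiE_iff mem_Times_iff)
    have g: "fst (g j) \<in> pol N d" "snd (g j) \<in> pol N (d - q)" if "j \<le> d" for j
      using fg that by (auto simp: Dom_def PA_def PiE_iff mem_Times_iff)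
    have df: "degree (fst (f j)) \<le> d" "degree (snd (f j)) \<le> d - q" if "j \<le> e" for j
      using f[OF that] by (auto simp: pol_def)
    have dg': "degree (fst (g j)) \<le> d" "degree (snd (g j)) \<le> d - q" if "j \<le> d" for j
      using g[OF that] by (auto simp: pol_def)
    have pw: "degree (p ^ R) \<le> R * n" if "degree p \<le> n" for p :: "'b poly" and n
      using degree_mult_power_le[of 1 0 p n R] that by simp
    have "F0 (f, g) \<in> pol N (e + R * d)"
      unfolding F0_def case_prod_conv
    proof (intro pol_add pol_sum_monom)
      fix j assume j: "j \<in> {..e}"
      show "fst (f j) ^ R + al * snd (f j) ^ R \<in> cfs N"
        using f j cf by (auto simp: pol_def intro!: cfs_add cfs_mult cfs_power)
      have "degree (al * snd (f j) ^ R) \<le> R * d"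
        using degree_mult_power_le[OF dg(1) df(2), of j R] j Rdq by simp
      then have "degree (fst (f j) ^ R + al * snd (f j) ^ R) \<le> R * d"
        using pw[OF df(1)] j by (intro degree_add_le) auto
      then show "j + degree (fst (f j) ^ R + al * snd (f j) ^ R) \<le> e + R * d" using j by simp
    next
      fix j assume j: "j \<in> {..d}"
      show "al1 * snd (g j) ^ R \<in> cfs N"
        using g j cf by (auto simp: pol_def intro!: cfs_add cfs_mult cfs_power)
      have "degree (al1 * snd (g j) ^ R) \<le> q + R * d"
        using degree_mult_power_le[OF dg(3) dg'(2), of j R] j Rdq by (simp add: algebra_simps)
      then show "j + degree (al1 * snd (g j) ^ R) \<le> e + R * d" using j by (simp add: e_def)
    qed
    moreover have "F1 (f, g) \<in> pol N (d + R * d)"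
      unfolding F1_def case_prod_conv
    proof (intro pol_add pol_sum_monom)
      fix j assume j: "j \<in> {..e}"
      show "be * snd (f j) ^ R \<in> cfs N"
        using f j cf by (auto simp: pol_def intro!: cfs_add cfs_mult cfs_power)
      have "degree (be * snd (f j) ^ R) \<le> q * (R - 1) + R * (d - q)"
        using degree_mult_power_le[OF dg(2) df(2), of j R] j by simp
      then show "j + degree (be * snd (f j) ^ R) \<le> d + R * d" using j Rdq' by (simp add: e_def)
    next
      fix j assume j: "j \<in> {..d}"
      show "fst (g j) ^ R + be1 * snd (g j) ^ R \<in> cfs N"
        using g j cf by (auto simp: pol_def intro!: cfs_add cfs_mult cfs_power)
      have "degree (be1 * snd (g j) ^ R) \<le> R * d"
        using degree_mult_power_le[OF dg(4) dg'(2), of j R] j Rdq by simp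
      then have "degree (fst (g j) ^ R + be1 * snd (g j) ^ R) \<le> R * d"
        using pw[OF dg'(1)] j by (intro degree_add_le) auto
      then show "j + degree (fst (g j) ^ R + be1 * snd (g j) ^ R) \<le> d + R * d" using j by simp
    qed
    ultimately show "(F0 (f, g), F1 (f, g)) \<in> Tgt" by (simp add: Tgt_def)
  qed
  have "card Tgt < card Dom"
  proof -
    define u where "u = d - q"
    have du: "d = u + q" using qd by (simp add: u_def)
    have "card PA = (q ^ N) ^ ((d + 1) + (d - q + 1))"
      by (simp add: PA_def card_cartesian_product card_pol[OF N0] power_add)
    then have "card Dom = ((q ^ N) ^ ((d + 1) + (d - q + 1))) ^ ((e + 1) + (d + 1))"
      by (simp add: Dom_def card_cartesian_product card_PiE power_add)
    then have "card Dom = (q ^ N) ^ (((d + 1) + (d - q + 1)) * ((e + 1) + (d + 1)))"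
      by (simp only: power_mult)
    moreover have "card Tgt = (q ^ N) ^ ((e + R * d + 1) + (d + R * d + 1))"
      by (simp add: Tgt_def card_cartesian_product card_pol[OF N0] power_add)
    \<comment> \<open>With R = 2d + 1 there are (2d + 2)^2 - q^2 free coefficients and 4d^2 + 4d + q
      + 2 coefficients in the image. The surplus is 2R - q^2 - q, positive by
      \<open>big\<close>.\<close>
    moreover have "(e + R * d + 1) + (d + R * d + 1) < ((d + 1) + (d - q + 1)) * ((e + 1) + (d + 1))"
      using big unfolding e_def Rd u_def[symmetric] unfolding du
      by (simp add: algebra_simps)
    ultimately show ?thesis using q_power_gt1[OF N0] by (metis power_strict_increasing)
  qed
  moreover have "finite Tgt" unfolding Tgt_def using card_pol[OF N0] by blast
  ultimately have "\<not> inj_on (\<lambda>z. (F0 z, F1 z)) Dom"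
    using into card_inj_on_le by (metis linorder_not_less)
  then obtain f1 g1 f2 g2 where D: "(f1, g1) \<in> Dom" "(f2, g2) \<in> Dom" "(f1, g1) \<noteq> (f2, g2)"
    and eq0: "F0 (f1, g1) = F0 (f2, g2)" and eq1: "F1 (f1, g1) = F1 (f2, g2)"
    by (fastforce simp: inj_on_def)
  \<comment> \<open>Differences of the two colliding families; the value 0 beyond the range lets all
    sums run up to \<open>e\<close>.\<close>
  define A where "A = (\<lambda>j. if j \<le> e then fst (f1 j) - fst (f2 j) else 0)"
  define B where "B = (\<lambda>j. if j \<le> e then snd (f1 j) - snd (f2 j) else 0)"
  define A' where "A' = (\<lambda>j. if j \<le> d then fst (g1 j) - fst (g2 j) else 0)"
  define B' where "B' = (\<lambda>j. if j \<le> d then snd (g1 j) - snd (g2 j) else 0)"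
  have mem: "fst (f j) \<in> pol N d \<and> snd (f j) \<in> pol N (d - q)" if "j \<le> e" "(f, g) \<in> Dom" for f g j
    using that by (auto simp: Dom_def PA_def PiE_iff mem_Times_iff)
  have mem': "fst (g j) \<in> pol N d \<and> snd (g j) \<in> pol N (d - q)" if "j \<le> d" "(f, g) \<in> Dom" for f g j
    using that by (auto simp: Dom_def PA_def PiE_iff mem_Times_iff)
  have ext: "\<And>j. (j \<le> d \<Longrightarrow> f j = f' j) \<Longrightarrow> f j = f' j" if "f \<in> PiE {..d} X1" "f' \<in> PiE {..d} X1"
    for f f' :: "nat \<Rightarrow> 'b poly \<times> 'b poly" and X1 d
    using that by (metis PiE_arb atMost_iff)
  show ?thesis
  proof (rule that)
    show "degree (A j) \<le> d" for j using mem[OF _ D(1)] mem[OF _ D(2)]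
      by (auto simp: A_def pol_def intro: degree_diff_le)
    show "degree (A' j) \<le> d" for j using mem'[OF _ D(1)] mem'[OF _ D(2)]
      by (auto simp: A'_def pol_def intro: degree_diff_le)
    have "degree (B j) \<le> d - q" for j using mem[OF _ D(1)] mem[OF _ D(2)]
      by (auto simp: B_def pol_def intro: degree_diff_le)
    then show "degree (B j) + q \<le> d" for j using qd by (simp add: le_diff_conv2)
    have "degree (B' j) \<le> d - q" for j using mem'[OF _ D(1)] mem'[OF _ D(2)]
      by (auto simp: B'_def pol_def intro: degree_diff_le)
    then show "degree (B' j) + q \<le> d" for j using qd by (simp add: le_diff_conv2)
    show "A' j = 0 \<and> B' j = 0" if "j > d" for j using that by (simp add: A'_def B'_def)
    show "\<exists>j\<le>e. \<not> (A j = 0 \<and> B j = 0 \<and> A' j = 0 \<and> B' j = 0)"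
    proof (rule ccontr)
      assume "\<not> ?thesis"
      then have z: "A j = 0" "B j = 0" "A' j = 0" "B' j = 0" if "j \<le> e" for j using that by blast+
      have "f1 j = f2 j" if "j \<le> e" for j
        using z(1,2)[OF that] that by (simp add: A_def B_def prod_eq_iff)
      then have "f1 = f2" using D(1,2) ext[of f1 e _ f2] by (auto simp: Dom_def fun_eq_iff)
      moreover have "g1 j = g2 j" if "j \<le> d" for j
        using z(3,4)[of j] that by (simp add: A'_def B'_def prod_eq_iff e_def)
      then have "g1 = g2" using D(1,2) ext[of g1 d _ g2] by (auto simp: Dom_def fun_eq_iff)
      ultimately show False using D(3) by simp
    qed
    have wide: "(\<Sum>j\<le>d. monom 1 j * T j) = (\<Sum>j\<le>e. monom 1 j * T j)" if "\<And>j. j > d \<Longrightarrow> T j = 0" for T :: "nat \<Rightarrow> 'b poly"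
      by (rule sum.mono_neutral_left) (use that in \<open>auto simp: e_def\<close>)
    have z': "p ^ R = 0" if "p = 0" for p :: "'b poly" using that R0 by simp
    have "(\<Sum>j\<le>e. monom 1 j * (A j ^ R + al * B j ^ R + al1 * B' j ^ R)) =
        (\<Sum>j\<le>e. monom 1 j * (A j ^ R + al * B j ^ R)) + (\<Sum>j\<le>d. monom 1 j * (al1 * B' j ^ R))"
      by (subst wide) (simp_all add: B'_def z' sum.distrib[symmetric] distrib_left)
    also have "(\<Sum>j\<le>e. monom 1 j * (A j ^ R + al * B j ^ R)) = (\<Sum>j\<le>e. monom 1 j * (fst (f1 j) ^ R + al * snd (f1 j) ^ R)) - (\<Sum>j\<le>e. monom 1 j * (fst (f2 j) ^ R + al * snd (f2 j) ^ R))"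
      by (simp add: A_def B_def R_def frob_poly_diff algebra_simps flip: sum_subtractf)
    also have "(\<Sum>j\<le>d. monom 1 j * (al1 * B' j ^ R)) = (\<Sum>j\<le>d. monom 1 j * (al1 * snd (g1 j) ^ R)) - (\<Sum>j\<le>d. monom 1 j * (al1 * snd (g2 j) ^ R))"
      by (simp add: B'_def R_def frob_poly_diff algebra_simps flip: sum_subtractf)
    also have "(\<Sum>j\<le>e. monom 1 j * (fst (f1 j) ^ R + al * snd (f1 j) ^ R)) - (\<Sum>j\<le>e. monom 1 j * (fst (f2 j) ^ R + al * snd (f2 j) ^ R)) + \<dots> = F0 (f1, g1) - F0 (f2, g2)"
      by (simp add: F0_def)
    finally show "(\<Sum>j\<le>e. monom 1 j * (A j ^ R + fst (xpow h a R) * B j ^ R + fst (xpow h a (Suc R)) * B' j ^ R)) = 0"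
      using eq0 by (simp add: al_def al1_def)
    have "(\<Sum>j\<le>e. monom 1 j * (A' j ^ R + be * B j ^ R + be1 * B' j ^ R)) =
        (\<Sum>j\<le>e. monom 1 j * (be * B j ^ R)) + (\<Sum>j\<le>d. monom 1 j * (A' j ^ R + be1 * B' j ^ R))"
      by (subst wide) (simp_all add: B'_def A'_def z' sum.distrib[symmetric] distrib_left add_ac)
    also have "(\<Sum>j\<le>e. monom 1 j * (be * B j ^ R)) = (\<Sum>j\<le>e. monom 1 j * (be * snd (f1 j) ^ R)) - (\<Sum>j\<le>e. monom 1 j * (be * snd (f2 j) ^ R))"
      by (simp add: B_def R_def frob_poly_diff algebra_simps flip: sum_subtractf)
    also have "(\<Sum>j\<le>d. monom 1 j * (A' j ^ R + be1 * B' j ^ R)) = (\<Sum>j\<le>d. monom 1 j * (fst (g1 j) ^ R + be1 * snd (g1 j) ^ R)) - (\<Sum>j\<le>d. monom 1 j * (fst (g2 j) ^ R + be1 * snd (g2 j) ^ R))"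
      by (simp add: A'_def B'_def R_def frob_poly_diff algebra_simps flip: sum_subtractf)
    also have "(\<Sum>j\<le>e. monom 1 j * (be * snd (f1 j) ^ R)) - (\<Sum>j\<le>e. monom 1 j * (be * snd (f2 j) ^ R)) + \<dots> = F1 (f1, g1) - F1 (f2, g2)"
      by (simp add: F1_def)
    finally show "(\<Sum>j\<le>e. monom 1 j * (A' j ^ R + snd (xpow h a R) * B j ^ R + snd (xpow h a (Suc R)) * B' j ^ R)) = 0"
      using eq1 by (simp add: be_def be1_def)
  qed
qed

end

lemma degree_sum_monom_le:
  fixes f :: "nat \<Rightarrow> 'b::comm_ring_1 poly"
  assumes "\<And>j. j \<le> e \<Longrightarrow> degree (monom 1 (j * R) * f j) \<le> n"
  shows "degree (\<Sum>j\<le>e. monom 1 (j * R) * f j) \<le> n"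
  by (rule degree_sum_le) (use assms in auto)

section \<open>The point count on the curve\<close>

context frobenius
begin

text \<open>The field has R^2 elements, so the main term has coefficient 1 with an error of the
  order of its square root. The norm of G has degree at most 2 (d + e R), and R = 2d + 1, e = d + q
  make this R^2 - 1 + 2 q R. The assumption m \<ge> 2 gives q^2 \<le> R, which implies the size
  conditions of the pigeonhole step.\<close>

lemma card_curve_points:
  fixes a t0 :: 'b and m :: nat
  defines "R \<equiv> q ^ m" and "N \<equiv> 2 * m"
  assumes a: "a \<in> fld N" "a \<noteq> 0" and t0: "t0 \<in> fld N" "t0 * t0 \<noteq> 4 * a" and m: "m \<ge> 2"
  shows "card {(s, x). s \<in> fld N \<and> x \<in> fld N \<and> x * x = (s ^ q - s + t0) * x - a} \<le> R\<^sup>2 + 2 * q * R"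
proof -
  define h where "h = monom 1 q + [:t0, -1:]"
  have degh: "degree h = q" unfolding h_def using q_gt1
    by (subst degree_add_eq_left) (auto simp: degree_monom_eq)
  have ph: "poly h s = s ^ q - s + t0" for s by (simp add: h_def poly_monom)
  have cfh: "h \<in> cfs N" unfolding h_def
    by (intro cfs_add cfs_monom fld_1) (auto simp: cfs_def coeff_pCons fld_0 t0 fld_minus fld_1 split: nat.splits)
  have "odd R" using q_odd by (simp add: R_def)
  then obtain d where Rd: "R = 2 * d + 1" by (auto elim: oddE)
  have "q ^ 2 \<le> R" unfolding R_def using m q_gt1 by (intro power_increasing) auto
  then have Rq: "q * q \<le> R" by (simp add: power2_eq_square)
  have "3 * q \<le> q * q" using q_ge3 by simp
  then have qd: "q \<le> d" and big: "q * q + q < 2 * R" using Rq Rd q_ge3 by linarith+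
  define e where "e = d + q"
  have N0: "N > 0" using m by (simp add: N_def)
  have kc: "h \<in> cfs (2 * m)" "degree h \<le> q" "a \<in> fld (2 * m)" "m > 0" "q ^ m = 2 * d + 1"
      "q \<le> d" "q * q + q < 2 * q ^ m"
    using cfh degh a(1) m Rd qd big by (auto simp: R_def N_def)
  obtain A B A' B' where deg: "\<And>j. degree (A j) \<le> d" "\<And>j. degree (A' j) \<le> d"
    "\<And>j. degree (B j) + q \<le> d" "\<And>j. degree (B' j) + q \<le> d"
    and z: "\<And>j. j > d \<Longrightarrow> A' j = 0 \<and> B' j = 0"
    and nz: "\<exists>j\<le>e. \<not> (A j = 0 \<and> B j = 0 \<and> A' j = 0 \<and> B' j = 0)"
    and Phi0: "(\<Sum>j\<le>e. monom 1 j * (A j ^ R + fst (xpow h a R) * B j ^ R + fst (xpow h a (Suc R)) * B' j ^ R)) = 0"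
    and Phi1: "(\<Sum>j\<le>e. monom 1 j * (A' j ^ R + snd (xpow h a R) * B j ^ R + snd (xpow h a (Suc R)) * B' j ^ R)) = 0"
  proof (rule stepanov_kernel[OF kc, folded R_def e_def], goal_cases)
    case 1
    show ?case by (rule 1(1)[OF 1(2-9)])
  qed
  define al be al1 be1 where "al = fst (xpow h a R)" and "be = snd (xpow h a R)"
    and "al1 = fst (xpow h a (Suc R))" and "be1 = snd (xpow h a (Suc R))"
  have dg: "degree al \<le> q * R" "degree be \<le> q * (R - 1)" "degree al1 \<le> q * (R + 1)" "degree be1 \<le> q * R"
    unfolding al_def be_def al1_def be1_def using xpow_degree[OF eq_refl[OF degh]] by (metis Suc_eq_plus1 diff_Suc_1)+
  define Ga where "Ga = (\<Sum>j\<le>e. monom 1 (j * R) * (A j + al * A' j + al1 * B' j))"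
  define Gb where "Gb = (\<Sum>j\<le>e. monom 1 (j * R) * (B j + be * A' j + be1 * B' j))"
  have "\<not> (Ga = 0 \<and> Gb = 0)"
  proof
    assume G: "Ga = 0 \<and> Gb = 0"
    obtain j where j: "j \<le> e" "\<not> (A j = 0 \<and> B j = 0 \<and> A' j = 0 \<and> B' j = 0)" using nz by blast
    have dR: "2 * d < R" using Rd by linarith
    have "A j = 0 \<and> B j = 0 \<and> A' j = 0 \<and> B' j = 0"
      by (rule stepanov_nonzero[OF h_def a(2) t0(2) deg dR[unfolded R_def]
            conjunct1[OF G, unfolded Ga_def al_def al1_def R_def]
            conjunct2[OF G, unfolded Gb_def be_def be1_def R_def] j(1)])
    then show False using j(2) by simp
  qed
  then have nn: "quad_norm h a Ga Gb \<noteq> 0" using quad_norm_eq_0[of h a Ga Gb] degh q_gt1 a(2) by auto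
  define E where "E = d + e * R"
  have E': "E = d + d * R + q * R" by (simp add: E_def e_def algebra_simps)
  have mdeg: "degree (monom 1 (j * R) * p) \<le> j * R + degree p" for j and p :: "'b poly"
    using degree_mult_le[of "monom 1 (j * R)" p] degree_monom_le[of "1::'b" "j * R"] by linarith
  have dm: "degree (u * v) \<le> i + k" if "degree u \<le> i" "degree v \<le> k" for u v :: "'b poly" and i k
    using degree_mult_le[of u v] that by linarith
  have dGa: "degree Ga \<le> E" unfolding Ga_def
  proof (rule degree_sum_monom_le)
    fix j assume j: "j \<le> e"
    \<comment> \<open>For j > d only A j is left, so the degree q R brought in by x^R is absent
      exactly where s^(jR) has its largest degrees.\<close>
    show "degree (monom 1 (j * R) * (A j + al * A' j + al1 * B' j)) \<le> E"
    proof (cases "j \<le> d")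
      case False
      then have "degree (A j + al * A' j + al1 * B' j) \<le> d" using z deg(1) by simp
      moreover have "j * R \<le> e * R" using j by simp
      ultimately show ?thesis using mdeg[of j "A j + al * A' j + al1 * B' j"] unfolding E_def by linarith
    next
      case True
      have "degree (al * A' j) \<le> q * R + d" using dm[OF dg(1) deg(2)] .
      moreover have "degree (al1 * B' j) \<le> q * R + d"
        using dm[OF dg(3), of "B' j" "d - q"] deg(4)[of j] by (simp add: algebra_simps)
      moreover have "degree (A j) \<le> q * R + d" using deg(1)[of j] by simp
      ultimately have "degree (A j + al * A' j + al1 * B' j) \<le> q * R + d"
        by (intro degree_add_le)
      moreover have "j * R \<le> d * R" using True by simp
      ultimately show ?thesis using mdeg[of j "A j + al * A' j + al1 * B' j"]
        unfolding E' by linarith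
    qed
  qed
  have dGb: "degree Gb \<le> E - q" unfolding Gb_def
  proof (rule degree_sum_monom_le)
    fix j assume j: "j \<le> e"
    show "degree (monom 1 (j * R) * (B j + be * A' j + be1 * B' j)) \<le> E - q"
    proof (cases "j \<le> d")
      case False
      then have "degree (B j + be * A' j + be1 * B' j) + q \<le> d" using z deg(3) by simp
      moreover have "j * R \<le> e * R" using j by simp
      ultimately show ?thesis using mdeg[of j "B j + be * A' j + be1 * B' j"] unfolding E_def by linarith
    next
      case True
      have qR: "q * (R - 1) + q = q * R" using Rd by (simp add: algebra_simps)
      have "degree (be * A' j) \<le> q * (R - 1) + d" using dm[OF dg(2) deg(2)] .
      then have "degree (be * A' j) \<le> q * R + d - q" using qR by linarith
      moreover have "degree (be1 * B' j) \<le> q * R + (d - q)"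
        using dm[OF dg(4), of "B' j" "d - q"] deg(4)[of j] by simp
      moreover have "degree (B j) \<le> q * R + (d - q)" using deg(3)[of j] by simp
      ultimately have "degree (B j + be * A' j + be1 * B' j) \<le> q * R + (d - q)"
        using qd by (intro degree_add_le) auto
      moreover have "j * R \<le> d * R" using True by simp
      ultimately show ?thesis using mdeg[of j "B j + be * A' j + be1 * B' j"] qd
        unfolding E' by linarith
    qed
  qed
  have Eq: "q \<le> E" using qd by (simp add: E_def)
  define Z where "Z = {(s, x). s \<in> fld N \<and> x \<in> fld N \<and> x * x = (s ^ q - s + t0) * x - a}"
  have RR: "R * R = q ^ N" by (simp add: R_def N_def mult_2 power_add)
  have "card Z \<le> degree (quad_norm h a Ga Gb)"
  proof (rule card_curve_zeros_le[OF nn card_fld(2)[OF N0]])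
    show "Z \<subseteq> fld N \<times> fld N" by (auto simp: Z_def)
    show "x * x = poly h s * x - a" if "(s, x) \<in> Z" for s x using that by (simp add: Z_def ph)
    show "poly Ga s + poly Gb s * x = 0" if "(s, x) \<in> Z" for s x
    proof -
      have sx: "s ^ (R * R) = s" "x ^ (R * R) = x" using that by (auto simp: Z_def fld_def RR)
      have q: "x * x = poly h s * x - a" using that by (simp add: Z_def ph)
      have x1: "x ^ R = poly al s + poly be s * x" and x2: "x ^ R * x = poly al1 s + poly be1 s * x"
        using xpow_eval[OF q, of R] xpow_eval[OF q, of "Suc R"]
        by (simp_all add: al_def be_def al1_def be1_def mult.commute del: xpow.simps)
      define g where "g = (\<lambda>j. s ^ (j * R) * (poly (A j) s + poly (B j) s * x + poly (A' j) s * x ^ R + poly (B' j) s * (x ^ R * x)))"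
      have "poly Ga s + poly Gb s * x = (\<Sum>j\<le>e. s ^ (j * R) * (poly (A j) s + poly (B j) s * x
          + poly (A' j) s * (poly al s + poly be s * x) + poly (B' j) s * (poly al1 s + poly be1 s * x)))"
        unfolding Ga_def Gb_def poly_sum sum_distrib_right sum.distrib[symmetric]
        by (rule sum.cong[OF refl]) (simp add: poly_monom algebra_simps)
      then have "poly Ga s + poly Gb s * x = (\<Sum>j\<le>e. g j)"
        unfolding g_def x1[symmetric] x2[symmetric] .
      \<comment> \<open>It suffices that the R-th power vanishes. It is additive, and s^(R^2) = s,
        x^(R^2) = x at the points counted, so it becomes the expression annihilated by
        \<open>Phi0\<close> and \<open>Phi1\<close>.\<close>
      then have "(poly Ga s + poly Gb s * x) ^ R = (\<Sum>j\<le>e. g j ^ R)"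
        by (simp add: R_def frob_sum)
      also have "\<dots> = (\<Sum>j\<le>e. s ^ j * (poly (A j) s ^ R + poly (B j) s ^ R * x ^ R + poly (A' j) s ^ R * x + poly (B' j) s ^ R * (x ^ R * x)))"
      proof (rule sum.cong[OF refl])
        fix j
        have "(s ^ (j * R)) ^ R = s ^ j" using sx(1) by (metis mult.assoc mult.commute power_mult)
        moreover have "(x ^ R) ^ R = x" using sx(2) by (simp add: power_mult)
        moreover have "(u + v) ^ R = u ^ R + v ^ R" for u v :: 'b by (simp add: R_def frob_add)
        ultimately show "g j ^ R = s ^ j * (poly (A j) s ^ R + poly (B j) s ^ R * x ^ R + poly (A' j) s ^ R * x + poly (B' j) s ^ R * (x ^ R * x))"
          by (simp add: g_def power_mult_distrib mult.commute[of x])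
      qed
      also have "\<dots> = poly (\<Sum>j\<le>e. monom 1 j * (A j ^ R + al * B j ^ R + al1 * B' j ^ R)) s
          + poly (\<Sum>j\<le>e. monom 1 j * (A' j ^ R + be * B j ^ R + be1 * B' j ^ R)) s * x"
      proof -
        have "s ^ j * (poly (A j) s ^ R + poly (B j) s ^ R * x ^ R + poly (A' j) s ^ R * x + poly (B' j) s ^ R * (x ^ R * x))
          = poly (monom 1 j * (A j ^ R + al * B j ^ R + al1 * B' j ^ R)) s
            + poly (monom 1 j * (A' j ^ R + be * B j ^ R + be1 * B' j ^ R)) s * x" for j
          unfolding x2 by (subst x1) (simp add: poly_monom poly_power algebra_simps)
        then show ?thesis unfolding poly_sum sum_distrib_right sum.distrib[symmetric] by (rule sum.cong[OF refl])
      qed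
      also have "\<dots> = 0" using Phi0 Phi1 by (simp add: al_def be_def al1_def be1_def del: xpow.simps)
      finally show ?thesis by simp
    qed
  qed
  also have "\<dots> \<le> 2 * E" using degree_quad_norm[of h q Ga E Gb a] degh dGa dGb Eq by simp
  also have "\<dots> \<le> R\<^sup>2 + 2 * q * R" by (simp add: E_def e_def Rd power2_eq_square algebra_simps)
  finally show ?thesis by (simp add: Z_def)
qed

end

section \<open>Kloosterman sums\<close>

context frobenius
begin

text \<open>For t_0 of trace c, each x in the fibre makes x + a/x - t_0 an element of trace 0. Then
  all q solutions s of s^q - s = x + a/x - t_0 lie in \<open>fld N\<close>, and each gives a point
  of the curve.\<close>

lemma card_kloosterman_fibre:
  fixes a c :: 'b and m :: nat
  defines "R \<equiv> q ^ m" and "N \<equiv> 2 * m"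
  assumes a: "a \<in> fld N" "a \<noteq> 0" and c: "c \<in> fld 1" and m: "m \<ge> 2"
  shows "q * card {x \<in> fld N - {0}. tr N (x + a / x) = c} \<le> R\<^sup>2 + 2 * q * R"
proof -
  have N0: "N > 0" using m by (simp add: N_def)
  define T where "T = {t \<in> fld N. tr N t = c}"
  have finT: "finite T" using card_fld(2)[OF N0] by (simp add: T_def)
  have "card T = q ^ (N - 1)" unfolding T_def by (rule card_trace_fibre[OF N0 c])
  moreover have "q ^ 1 \<le> q ^ (N - 1)" using q_gt1 m by (intro power_increasing) (auto simp: N_def)
  \<comment> \<open>Three elements of trace c are enough to avoid the two roots b and -b of t^2 =
    4a, for which the points over s = 0 would coincide.\<close>
  ultimately have "card T \<ge> 3" using q_ge3 by simp
  moreover obtain b where b: "b ^ 2 = 4 * a" using nth_root_exists[of 2 "4 * a"] by auto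
  have "card {b, -b} \<le> 2" using card_insert_le_m1[of 2 "{-b}" b] by simp
  ultimately have "\<not> T \<subseteq> {b, -b}" using card_mono[of "{b,-b}" T] by auto
  then obtain t0 where t0: "t0 \<in> fld N" "tr N t0 = c" "t0 \<noteq> b" "t0 \<noteq> -b" by (auto simp: T_def)
  have "t0 * t0 \<noteq> 4 * a"
  proof
    assume "t0 * t0 = 4 * a"
    then have "(t0 - b) * (t0 + b) = 0" using b by (simp add: algebra_simps power2_eq_square)
    then show False using t0 by (auto simp: eq_neg_iff_add_eq_0)
  qed
  note cp = card_curve_points[of a m t0, folded N_def R_def, OF a t0(1) this m]
  define Fib where "Fib = {x \<in> fld N - {0}. tr N (x + a / x) = c}"
  have finF: "finite Fib" using card_fld(2)[OF N0] by (simp add: Fib_def)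
  define W where "W = (SIGMA x:Fib. {s. s ^ q - s = x + a / x - t0})"
  have "card W = q * card Fib"
  proof -
    have "finite {s. s ^ q - s = y}" for y :: 'b
      using card_artin_schreier[of y] q_gt1 card.infinite by fastforce
    then show ?thesis unfolding W_def using finF
      by (subst card_SigmaI) (auto simp: card_artin_schreier)
  qed
  moreover have "card W \<le> card {(s, x). s \<in> fld N \<and> x \<in> fld N \<and> x * x = (s ^ q - s + t0) * x - a}"
  proof (rule card_inj_on_le[of prod.swap])
    show "inj_on prod.swap W" by simp
    show "prod.swap ` W \<subseteq> {(s, x). s \<in> fld N \<and> x \<in> fld N \<and> x * x = (s ^ q - s + t0) * x - a}"
    proof (clarsimp simp: W_def Fib_def)
      fix x s assume x: "x \<in> fld N" "x \<noteq> 0" "c = tr N (x + a / x)" and s: "s ^ q - s = x + a / x - t0"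
      have "s ^ (q ^ N) - s = tr N (x + a / x - t0)" by (simp add: s flip: tr_of_frob_minus)
      also have "\<dots> = 0" using x t0(2) by (simp add: tr_diff)
      finally show "s \<in> fld N \<and> x * x = (x + a / x) * x - a"
        using x by (simp add: fld_def algebra_simps)
    qed
    show "finite {(s, x). s \<in> fld N \<and> x \<in> fld N \<and> x * x = (s ^ q - s + t0) * x - a}"
      by (rule finite_subset[of _ "fld N \<times> fld N"]) (auto simp: card_fld(2)[OF N0])
  qed
  ultimately show ?thesis using cp by (simp add: Fib_def)
qed

text \<open>The counts n(c) are at most R^2/q + 2R and add up to R^2 - 1, so their deviations from
  R^2/q add up to -1; upper bounds for the single deviations therefore bound the sum of their
  absolute values. As \<psi> sums to 0, the counts may be replaced by the deviations.\<close>

lemma kloosterman_stepanov: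
  fixes a :: 'b and m :: nat and \<psi> :: "'b \<Rightarrow> complex"
  defines "R \<equiv> q ^ m" and "N \<equiv> 2 * m"
  assumes a: "a \<in> fld N" "a \<noteq> 0" and m: "m \<ge> 2"
    and unit: "\<And>c. c \<in> fld 1 \<Longrightarrow> cmod (\<psi> c) \<le> 1" and sum0: "(\<Sum>c\<in>fld 1. \<psi> c) = 0"
  shows "cmod (\<Sum>x\<in>fld N - {0}. \<psi> (tr N (x + a / x))) \<le> 5 * q * R"
proof -
  have N0: "N > 0" using m by (simp add: N_def)
  have fin: "finite (fld N - {0})" "finite (fld 1)" using card_fld(2)[OF N0] card_fld(2)[of 1] by auto
  define n where "n = (\<lambda>c. real (card {x \<in> fld N - {0}. tr N (x + a / x) = c}))"
  define y where "y = (\<lambda>c. n c - real (R\<^sup>2) / real q)"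
  have im: "(\<lambda>x. tr N (x + a / x)) ` (fld N - {0}) \<subseteq> fld 1"
    using a by (auto intro!: tr_in_fld fld_add fld_divide simp del: One_nat_def)
  have q0: "real q > 0" using q_gt1 by simp
  have c1: "card (fld 1) = q" using card_fld(1)[of 1] by simp
  have ny: "y c \<le> 2 * R" if "c \<in> fld 1" for c
  proof -
    have "real (q * card {x \<in> fld N - {0}. tr N (x + a / x) = c}) \<le> real (R\<^sup>2 + 2 * q * R)"
      using card_kloosterman_fibre[of a m c] a that m unfolding N_def R_def of_nat_le_iff by blast
    then have "real q * n c \<le> real (R\<^sup>2) + 2 * q * R" by (simp add: n_def)
    then show ?thesis using q0 by (simp add: y_def field_simps)
  qed
  have RR: "R * R = q ^ N" by (simp add: R_def N_def mult_2 power_add)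
  have "(\<Sum>c\<in>fld 1. n c) = real (card (fld N - {0}))"
    unfolding n_def using sum.group[OF fin im, of "\<lambda>_. 1::real"] by simp
  also have "\<dots> = real (R\<^sup>2) - 1"
    using card_fld[OF N0] fld_0[of N] q_power_gt1[OF N0]
    by (simp add: card_Diff_subset RR power2_eq_square flip: of_nat_power of_nat_mult)
  finally have "(\<Sum>c\<in>fld 1. y c) = -1"
    using q0 by (simp add: y_def sum_subtractf c1 del: One_nat_def)
  \<comment> \<open>For y c \<ge> 0 this is y c \<le> 2R, and for y c < 0 it is trivial.\<close>
  moreover have "\<bar>y c\<bar> \<le> 4 * R - y c" if "c \<in> fld 1" for c
    using ny[OF that] by linarith
  then have "(\<Sum>c\<in>fld 1. \<bar>y c\<bar>) \<le> (\<Sum>c\<in>fld 1. 4 * real R - y c)" by (intro sum_mono) auto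
  ultimately have ysum: "(\<Sum>c\<in>fld 1. \<bar>y c\<bar>) \<le> 4 * q * R + 1"
    by (simp add: sum_subtractf c1 mult_ac del: One_nat_def)
  have "(\<Sum>x\<in>fld N - {0}. \<psi> (tr N (x + a / x))) =
      (\<Sum>c\<in>fld 1. \<Sum>x\<in>{x \<in> fld N - {0}. tr N (x + a / x) = c}. \<psi> (tr N (x + a / x)))"
    by (rule sum.group[OF fin im, symmetric])
  also have "\<dots> = (\<Sum>c\<in>fld 1. of_real (n c) * \<psi> c)"
    by (rule sum.cong) (auto simp: n_def)
  also have "\<dots> = (\<Sum>c\<in>fld 1. of_real (y c) * \<psi> c)"
  proof -
    have "(\<Sum>c\<in>fld 1. of_real (y c) * \<psi> c) =
        (\<Sum>c\<in>fld 1. of_real (n c) * \<psi> c) - of_real (real (R\<^sup>2) / real q) * (\<Sum>c\<in>fld 1. \<psi> c)"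
      by (simp only: y_def of_real_diff left_diff_distrib sum_subtractf sum_distrib_left)
    then show ?thesis using sum0 by simp
  qed
  finally have "cmod (\<Sum>x\<in>fld N - {0}. \<psi> (tr N (x + a / x))) \<le> (\<Sum>c\<in>fld 1. cmod (of_real (y c) * \<psi> c))"
    using norm_sum[of "\<lambda>c. of_real (y c) * \<psi> c" "fld 1"] by simp
  also have "\<dots> \<le> (\<Sum>c\<in>fld 1. \<bar>y c\<bar>)"
    by (rule sum_mono) (use unit in \<open>auto simp: norm_mult intro: mult_left_le\<close>)
  also have "\<dots> \<le> 4 * q * R + 1" by (rule ysum)
  also have "\<dots> \<le> 5 * q * R"
  proof -
    have "q * R \<ge> 1" using q_gt1 by (simp add: R_def)
    then have "real (q * R) \<ge> 1" by linarith
    then show ?thesis by (simp add: mult.commute)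
  qed
  finally show ?thesis .
qed

lemma sum_fld_mult_eq_0:
  fixes \<psi> :: "'b \<Rightarrow> complex"
  assumes c: "c \<in> fld N" "c \<noteq> 0" and "(\<Sum>u\<in>fld N. \<psi> u) = 0"
  shows "(\<Sum>u\<in>fld N. \<psi> (u * c)) = 0"
proof -
  have "(\<Sum>u\<in>fld N. \<psi> (u * c)) = (\<Sum>u\<in>fld N. \<psi> u)"
    by (rule sum.reindex_bij_witness[of _ "\<lambda>u. u / c" "\<lambda>u. u * c"]) (use c in \<open>auto intro: fld_mult fld_divide\<close>)
  then show ?thesis using assms by simp
qed

text \<open>A monic quadratic over the field of order $q^N$ either splits over it, or has two conjugate roots
  in the quadratic extension; a double root is counted once on each side.\<close>

lemma card_quadratic_roots:
  fixes u v :: 'b and N :: nat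
  defines "k \<equiv> fld N" and "k2 \<equiv> fld (2 * N)" and "F \<equiv> q ^ N"
  assumes N: "N > 0" and uv: "u \<in> k" "v \<in> k" "v \<noteq> 0"
  shows "card {p \<in> (k - {0}) \<times> (k - {0}). (fst p + snd p, fst p * snd p) = (u, v)}
       + card {z \<in> k2 - {0}. (z + z ^ F, z * z ^ F) = (u, v)} = 2" (is "card ?P + card ?Z = 2")
proof -
  obtain x y where xy: "x + y = u" "x * y = v" using alg_closed_quadratic_roots by blast
  have nz: "x \<noteq> 0" "y \<noteq> 0" using xy uv by auto
  have root: "z = x \<or> z = y" if "z + w = u" "z * w = v" for z w
  proof -
    have "(z - x) * (z - y) = z * z - (x + y) * z + x * y" by (simp add: algebra_simps)
    also have "\<dots> = 0" unfolding xy unfolding that[symmetric] by (simp add: algebra_simps)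
    finally show ?thesis by auto
  qed
  have other: "w = u - z" if "z + w = u" for z w using that by (simp add: algebra_simps)
  have yx: "y = u - x" "x = u - y" using xy by auto
  have xy': "y + x = u" "y * x = v" using xy by (simp_all add: add.commute mult.commute)
  show ?thesis
  proof (cases "x \<in> k")
    case True
    then have yk: "y \<in> k" unfolding yx(1) using uv fld_diff by (simp add: k_def)
    have P: "?P = {(x, y), (y, x)}"
    proof
      show "?P \<subseteq> {(x, y), (y, x)}"
      proof
        fix p assume p: "p \<in> ?P"
        then have zw: "fst p + snd p = u" "fst p * snd p = v" by auto
        have "snd p = u - fst p" by (rule other[OF zw(1)])
        then show "p \<in> {(x, y), (y, x)}" using root[OF zw] yx by (metis insertCI prod.collapse)
      qed
      show "{(x, y), (y, x)} \<subseteq> ?P" using True yk nz xy xy' by simp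
    qed
    have Fx: "x ^ F = x" "y ^ F = y" using True yk by (auto simp: k_def fld_def F_def)
    have Z: "?Z = (if x = y then {x} else {})"
    proof -
      have "z = x \<and> x = y" if z: "z + z ^ F = u" "z * z ^ F = v" for z
      proof -
        have "z ^ F = z" using root[OF z] Fx by auto
        then have "z + z = u" using z(1) by simp
        then have "z = u - z" by (rule other)
        then show ?thesis using root[OF z] yx by metis
      qed
      moreover have "x \<in> k2" using True fld_mono_mult[of x N 2] by (simp add: k_def k2_def mult.commute)
      ultimately show ?thesis using xy nz(1) Fx(1) by (cases "x = y") auto
    qed
    show ?thesis unfolding P Z by (cases "x = y") auto
  next
    case False
    have yk: "y \<notin> k" using False yx(2) uv fld_diff k_def by metis
    have P: "?P = {}" using False yk root by auto
    have uF: "u ^ F = u" "v ^ F = v" using uv by (auto simp: k_def fld_def F_def)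
    have "x ^ F + y ^ F = u" "x ^ F * y ^ F = v"
      using uF xy by (simp_all add: F_def flip: frob_add power_mult_distrib)
    then have xF: "x ^ F = y" "y ^ F = x"
      using root[of "x ^ F" "y ^ F"] root[of "y ^ F" "x ^ F"] False yk
      unfolding k_def fld_def F_def mem_Collect_eq by (metis add.commute mult.commute)+
    have "F * F = q ^ (2 * N)" by (simp add: F_def mult_2 power_add)
    then have k2: "x \<in> k2" "y \<in> k2" using xF unfolding k2_def fld_def by (metis (mono_tags, lifting) mem_Collect_eq power_mult)+
    have "?Z = {x, y}"
    proof
      show "?Z \<subseteq> {x, y}" using root by blast
      show "{x, y} \<subseteq> ?Z" using k2 nz xF xy xy' by simp
    qed
    moreover have "x \<noteq> y" using xF False by (auto simp: k_def fld_def F_def)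
    ultimately show ?thesis unfolding P by simp
  qed
qed

text \<open>With u = x + y and v = x y one has x + a/x + y + a/y = u + a u/v. So both sums run over
  monic quadratics with coefficients (u, v), and each quadratic is counted twice in total. For fixed
  v the sum over u is a complete sum of \<psi>(u (1 + a/v)), which vanishes unless v = -a.\<close>

lemma kloosterman_doubling:
  fixes a :: 'b and N :: nat and \<psi> :: "'b \<Rightarrow> complex"
  assumes N: "N > 0" and a: "a \<in> fld N" "a \<noteq> 0"
    and hom: "\<And>x y. x \<in> fld N \<Longrightarrow> y \<in> fld N \<Longrightarrow> \<psi> (x + y) = \<psi> x * \<psi> y"
    and sum0: "(\<Sum>u\<in>fld N. \<psi> u) = 0" and psi0: "\<psi> 0 = 1"
  shows "(\<Sum>x\<in>fld N - {0}. \<psi> (x + a / x))\<^sup>2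
      + (\<Sum>z\<in>fld (2 * N) - {0}. \<psi> ((z + a / z) + (z + a / z) ^ (q ^ N))) = 2 * of_nat (q ^ N)"
proof -
  define k k2 F where "k = fld N" and "k2 = fld (2 * N)" and "F = q ^ N"
  define w where "w = (\<lambda>(u, v). \<psi> (u + a * u / v))"
  define mp where "mp = (\<lambda>p::'b \<times> 'b. (fst p + snd p, fst p * snd p))"
  define mz where "mz = (\<lambda>z::'b. (z + z ^ F, z * z ^ F))"
  define P where "P = (k - {0}) \<times> (k - {0})"
  define UV where "UV = k \<times> (k - {0})"
  have fin: "finite k" "finite k2" using card_fld(2) N by (auto simp: k_def k2_def)
  have finP: "finite P" "finite (k2 - {0})" "finite UV" using fin by (auto simp: P_def UV_def)
  have imP: "mp ` P \<subseteq> UV" by (auto simp: mp_def P_def UV_def k_def fld_add fld_mult)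
  have FF: "F * F = q ^ (2 * N)" by (simp add: F_def mult_2 power_add)
  have zF: "(z ^ F) ^ F = z" if "z \<in> k2" for z
    using that by (simp add: k2_def fld_def FF flip: power_mult)
  have imZ: "mz ` (k2 - {0}) \<subseteq> UV"
  proof (rule image_subsetI)
    fix z assume "z \<in> k2 - {0}"
    then have z: "z \<in> k2" "z \<noteq> 0" by auto
    have "(z + z ^ F) ^ F = z + z ^ F" "(z * z ^ F) ^ F = z * z ^ F"
      using zF[OF z(1)] frob_add[of z "z ^ F" N] by (simp_all add: F_def power_mult_distrib add.commute mult.commute)
    then show "mz z \<in> UV" using z by (simp add: mz_def UV_def k_def fld_def F_def)
  qed
  have S1: "(\<Sum>x\<in>k - {0}. \<psi> (x + a / x))\<^sup>2 = (\<Sum>p\<in>P. w (mp p))"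
  proof -
    have "(\<Sum>x\<in>k - {0}. \<psi> (x + a / x))\<^sup>2 = (\<Sum>p\<in>P. \<psi> (fst p + a / fst p) * \<psi> (snd p + a / snd p))"
      by (simp add: power2_eq_square sum_product sum.cartesian_product P_def case_prod_beta)
    also have "\<dots> = (\<Sum>p\<in>P. w (mp p))"
    proof (rule sum.cong[OF refl])
      fix p assume "p \<in> P"
      then have p: "fst p \<in> k" "fst p \<noteq> 0" "snd p \<in> k" "snd p \<noteq> 0" by (auto simp: P_def)
      have "\<psi> (fst p + a / fst p) * \<psi> (snd p + a / snd p) = \<psi> ((fst p + a / fst p) + (snd p + a / snd p))"
        using p a by (intro hom[symmetric]) (auto simp: k_def intro!: fld_add fld_divide)
      also have "(fst p + a / fst p) + (snd p + a / snd p) = (fst p + snd p) + a * (fst p + snd p) / (fst p * snd p)"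
        using p by (simp add: field_simps)
      finally show "\<psi> (fst p + a / fst p) * \<psi> (snd p + a / snd p) = w (mp p)" by (simp add: w_def mp_def)
    qed
    finally show ?thesis .
  qed
  have S2: "\<psi> ((z + a / z) + (z + a / z) ^ F) = w (mz z)" if "z \<in> k2 - {0}" for z
  proof -
    have "a ^ F = a" using a by (simp add: fld_def F_def)
    then have "(z + a / z) ^ F = z ^ F + a / z ^ F" by (simp add: F_def frob_add power_divide)
    moreover have "(z + a / z) + (z ^ F + a / z ^ F) = (z + z ^ F) + a * (z + z ^ F) / (z * z ^ F)"
      using that by (simp add: field_simps)
    ultimately show ?thesis unfolding w_def mz_def case_prod_conv by (simp only:)
  qed
  have "(\<Sum>p\<in>P. w (mp p)) = (\<Sum>c\<in>UV. \<Sum>p\<in>{p\<in>P. mp p = c}. w (mp p))"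
    by (rule sum.group[OF finP(1,3) imP, symmetric])
  also have "\<dots> = (\<Sum>c\<in>UV. of_nat (card {p\<in>P. mp p = c}) * w c)"
    by (rule sum.cong) auto
  finally have T1: "(\<Sum>p\<in>P. w (mp p)) = (\<Sum>c\<in>UV. of_nat (card {p\<in>P. mp p = c}) * w c)" .
  have "(\<Sum>z\<in>k2 - {0}. w (mz z)) = (\<Sum>c\<in>UV. \<Sum>z\<in>{z\<in>k2 - {0}. mz z = c}. w (mz z))"
    by (rule sum.group[OF finP(2,3) imZ, symmetric])
  also have "\<dots> = (\<Sum>c\<in>UV. of_nat (card {z\<in>k2 - {0}. mz z = c}) * w c)"
    by (rule sum.cong) auto
  finally have T2: "(\<Sum>z\<in>k2 - {0}. w (mz z)) = (\<Sum>c\<in>UV. of_nat (card {z\<in>k2 - {0}. mz z = c}) * w c)" .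
  have two: "card {p\<in>P. mp p = c} + card {z\<in>k2 - {0}. mz z = c} = 2" if "c \<in> UV" for c
    using card_quadratic_roots[OF N, of "fst c" "snd c"] that
    by (cases c) (simp add: P_def mp_def mz_def UV_def k_def k2_def F_def)
  have "(\<Sum>p\<in>P. w (mp p)) + (\<Sum>z\<in>k2 - {0}. w (mz z)) = (\<Sum>c\<in>UV. 2 * w c)"
    unfolding T1 T2 sum.distrib[symmetric]
    by (rule sum.cong[OF refl]) (simp only: two distrib_right[symmetric] of_nat_add[symmetric] of_nat_numeral)
  also have "\<dots> = 2 * (\<Sum>v\<in>k - {0}. \<Sum>u\<in>k. w (u, v))"
    unfolding UV_def sum_distrib_left by (subst sum.swap) (simp add: sum.cartesian_product)
  also have "(\<Sum>v\<in>k - {0}. \<Sum>u\<in>k. w (u, v)) = (\<Sum>v\<in>k - {0}. if v = -a then of_nat F else 0)"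
  proof (rule sum.cong[OF refl])
    fix v assume v: "v \<in> k - {0}"
    have e: "w (u, v) = \<psi> (u * (1 + a / v))" for u by (simp add: w_def algebra_simps)
    show "(\<Sum>u\<in>k. w (u, v)) = (if v = -a then of_nat F else 0)"
    proof (cases "v = -a")
      case True
      have "1 + a / v = 0" using True a by simp
      then have "(\<Sum>u\<in>k. w (u, v)) = of_nat (card k)" by (simp only: e mult_zero_right psi0 sum_constant mult_1_right)
      then show ?thesis using card_fld(1)[OF N] True by (simp add: k_def F_def)
    next
      case False
      have "1 + a / v \<in> fld N" using a v by (auto simp: k_def intro!: fld_add fld_1 fld_divide)
      moreover have "1 + a / v \<noteq> 0" using False v by (auto simp: field_simps eq_neg_iff_add_eq_0)
      ultimately show ?thesis using sum_fld_mult_eq_0[OF _ _ sum0, of "1 + a / v"] False by (simp add: e k_def)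
    qed
  qed
  also have "\<dots> = of_nat F" using a fin fld_minus by (simp add: k_def)
  finally show ?thesis using S1 S2 by (simp add: k_def k2_def F_def)
qed

text \<open>All fibres of the trace have the same size.\<close>

lemma sum_trace_eq_0:
  fixes \<psi> :: "'b \<Rightarrow> complex"
  assumes N: "N > 0" and sum0: "(\<Sum>c\<in>fld 1. \<psi> c) = 0"
  shows "(\<Sum>u\<in>fld N. \<psi> (tr N u)) = 0"
proof -
  have "(\<Sum>u\<in>fld N. \<psi> (tr N u)) = (\<Sum>c\<in>fld 1. \<Sum>u\<in>{u\<in>fld N. tr N u = c}. \<psi> (tr N u))"
    by (rule sum.group[symmetric]) (use card_fld(2) N in \<open>auto intro: tr_in_fld simp del: One_nat_def\<close>)
  also have "\<dots> = (\<Sum>c\<in>fld 1. of_nat (q ^ (N - 1)) * \<psi> c)"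
    by (rule sum.cong) (auto simp: card_trace_fibre[OF N])
  finally show ?thesis using sum0 by (simp flip: sum_distrib_left)
qed

text \<open>If the sum exceeded $3\sqrt q$, then passing repeatedly to the quadratic extension would make the
  normalised sums grow without bound, against the Stepanov estimate.\<close>

theorem kloosterman_bound:
  fixes a :: 'b and \<psi> :: "'b \<Rightarrow> complex"
  assumes a: "a \<in> fld 1" "a \<noteq> 0"
    and hom: "\<And>x y. x \<in> fld 1 \<Longrightarrow> y \<in> fld 1 \<Longrightarrow> \<psi> (x + y) = \<psi> x * \<psi> y"
    and unit: "\<And>c. c \<in> fld 1 \<Longrightarrow> cmod (\<psi> c) = 1"
    and sum0: "(\<Sum>u\<in>fld 1. \<psi> u) = 0"
  shows "cmod (\<Sum>x\<in>fld 1 - {0}. \<psi> (x + a / x)) \<le> 3 * sqrt q"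
proof (rule ccontr)
  assume contr: "\<not> ?thesis"
  define S where "S = (\<lambda>N. \<Sum>x\<in>fld N - {0}. \<psi> (tr N (x + a / x)))"
  have psi0: "\<psi> 0 = 1"
    using hom[of 0 0] unit[of 0] fld_0[of 1] by auto
  have aN: "a \<in> fld N" for N using fld_mono_mult[OF a(1), of N] by simp
  have dbl: "(S N)\<^sup>2 + S (2 * N) = 2 * of_nat (q ^ N)" if N: "N > 0" for N
  proof -
    have tr0: "tr N 0 = 0" using tr_diff[of N 0 0] by simp
    show ?thesis unfolding S_def tr_double
      by (rule kloosterman_doubling[OF N aN a(2), where \<psi> = "\<lambda>u. \<psi> (tr N u)"])
        (auto simp: tr_add tr0 psi0 intro!: hom tr_in_fld sum_trace_eq_0[OF N sum0])
  qed
  \<comment> \<open>The map c -> c^2 - 2 has fixed point 2. Starting from 3 leaves room for a factor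
    2 at each step, since 9 t^2 - 2 \<ge> 6 t for t = 2^k.\<close>
  have grow: "cmod (S (2 ^ k)) \<ge> 3 * 2 ^ k * sqrt (q ^ (2 ^ k))" for k
  proof (induction k)
    case 0
    show ?case using contr by (simp add: S_def tr_def)
  next
    case (Suc k)
    define s where "s = sqrt (q ^ (2 ^ k))"
    have s2: "s * s = q ^ (2 ^ k)" by (simp add: s_def)
    have s0: "s \<ge> 0" by (simp add: s_def)
    have e: "S (2 ^ Suc k) = 2 * of_nat (q ^ 2 ^ k) - (S (2 ^ k))\<^sup>2"
      using dbl[of "2 ^ k"] by (simp add: algebra_simps)
    have "cmod ((S (2 ^ k))\<^sup>2) - cmod (2 * of_nat (q ^ 2 ^ k)) \<le> cmod (S (2 ^ Suc k))"
      unfolding e by (subst norm_minus_commute) (rule norm_triangle_ineq2)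
    moreover have "cmod (2 * of_nat (q ^ 2 ^ k)) = 2 * (s * s)"
      unfolding s2 by (simp add: norm_mult norm_power)
    moreover have "cmod ((S (2 ^ k))\<^sup>2) \<ge> (3 * 2 ^ k * s)\<^sup>2"
      unfolding norm_power using Suc s0 by (intro power_mono) (auto simp: s_def)
    moreover have "(3 * 2 ^ k * s)\<^sup>2 - 2 * (s * s) \<ge> 3 * 2 ^ Suc k * (s * s)"
    proof -
      have "(9 * (2 ^ k * 2 ^ k) - 2 :: real) \<ge> 6 * 2 ^ k"
      proof -
        have "(2::real) ^ k \<ge> 1" by simp
        moreover have "(2::real) ^ k * 2 ^ k \<ge> 2 ^ k" by simp
        ultimately show ?thesis by linarith
      qed
      then have "6 * 2 ^ k * (s * s) \<le> (9 * (2 ^ k * 2 ^ k) - 2) * (s * s)"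
        by (intro mult_right_mono) auto
      then show ?thesis by (simp add: power2_eq_square algebra_simps)
    qed
    moreover have "sqrt (q ^ (2 ^ Suc k)) = s * s"
      unfolding s2 by (simp add: power_mult mult.commute[of 2] real_sqrt_abs power_even_eq)
    ultimately show ?case by (simp add: mult.assoc)
  qed
  \<comment> \<open>The Stepanov bound has constant 5q, which 2^k > k exceeds. Writing 2^k = 2m
    presents the degree of the extension in the even form that this bound is stated for.\<close>
  define k where "k = 5 * q"
  have k2: "k \<ge> 2" using q_gt1 by (simp add: k_def)
  define m :: nat where "m = 2 ^ (k - 1)"
  have "(2::nat) ^ 1 \<le> 2 ^ (k - 1)" using k2 by (intro power_increasing) auto
  then have m: "m \<ge> 2" by (simp add: m_def)
  have m2: "2 ^ k = 2 * m" using k2 by (cases k) (auto simp: m_def)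
  have "cmod (S (2 * m)) \<le> 5 * q * q ^ m"
    unfolding S_def by (rule kloosterman_stepanov[OF aN a(2) m _ sum0]) (simp add: unit)
  moreover have "sqrt (q ^ (2 * m)) = q ^ m" by (simp add: power_mult mult.commute[of 2] real_sqrt_abs power_even_eq)
  ultimately have "3 * 2 ^ k * real (q ^ m) \<le> 5 * q * q ^ m" using grow[of k] unfolding m2 by (simp add: m2)
  moreover have "real (q ^ m) > 0" using q_gt1 by simp
  ultimately have "3 * 2 ^ k \<le> real (5 * q)" by simp
  moreover have "real k < 2 ^ k" by (rule of_nat_less_two_power)
  ultimately show False by (simp add: k_def)
qed

end

section \<open>Additive characters of a finite field\<close>

lemma card_field_gt1: "CARD('a::{field,finite}) > 1"
proof -
  have "card {0, 1::'a} \<le> CARD('a)" by (rule card_mono) auto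
  then show ?thesis by simp
qed

text \<open>Multiplication by x \<noteq> 0 permutes the nonzero elements; compare the products of
  all of them.\<close>

lemma power_card_field: "x ^ CARD('a) = (x :: 'a::{field,finite})"
proof (cases "x = 0")
  case True then show ?thesis using card_field_gt1[where 'a='a] by (simp add: zero_power)
next
  case False
  have "(\<Prod>y\<in>UNIV - {0::'a}. x * y) = (\<Prod>y\<in>UNIV - {0}. y)"
    by (rule prod.reindex_bij_witness[of _ "\<lambda>y. y / x" "\<lambda>y. x * y"]) (use False in auto)
  then have "x ^ (CARD('a) - 1) * (\<Prod>y\<in>UNIV - {0}. y) = (\<Prod>y\<in>UNIV - {0::'a}. y)"
    by (simp add: prod.distrib card_Diff_subset)
  then have "x ^ (CARD('a) - 1) = 1" by simp
  then have "x ^ Suc (CARD('a) - 1) = x" by (simp only: power_Suc mult_1_right)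
  moreover have "Suc (CARD('a) - 1) = CARD('a)" using card_field_gt1[where 'a='a] by linarith
  ultimately show ?thesis by (simp only:)
qed

text \<open>Translation by 1 permutes the field; compare the sums of all elements.\<close>

lemma of_nat_card_field: "of_nat CARD('a) = (0 :: 'a::{field,finite})"
proof -
  have "(\<Sum>x\<in>(UNIV::'a set). x + 1) = (\<Sum>x\<in>UNIV. x)"
    by (rule sum.reindex_bij_witness[of _ "\<lambda>x. x - 1" "\<lambda>x. x + 1"]) auto
  then show ?thesis by (simp add: sum.distrib)
qed

text \<open>The polynomial $(X+1)^q - X^q - 1$ has degree below $q$ and $q$ roots.\<close>

lemma binomial_card_field:
  assumes "0 < i" "i < CARD('a)"
  shows "of_nat (CARD('a) choose i) = (0 :: 'a::{field,finite})"
proof -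
  define q where "q = CARD('a)"
  define p :: "'a poly" where "p = (\<Sum>i=1..q-1. monom (of_nat (q choose i)) i)"
  have q1: "q > 1" using card_field_gt1 by (simp add: q_def)
  have "poly p x = 0" for x
  proof -
    have "x ^ q + 1 = x + 1" by (simp add: q_def power_card_field)
    also have "\<dots> = (x + 1) ^ q" by (simp add: q_def power_card_field)
    also have "\<dots> = (\<Sum>k\<le>q. of_nat (q choose k) * x ^ k)" by (simp add: binomial_ring)
    also have "{..q} = insert 0 (insert q {1..q-1})" using q1 by auto
    also have "(\<Sum>k\<in>insert 0 (insert q {1..q-1}). of_nat (q choose k) * x ^ k) = 1 + (x ^ q + poly p x)"
      using q1 by (simp add: p_def poly_sum poly_monom)
    finally show ?thesis by (simp add: algebra_simps)
  qed
  then have r: "{x. poly p x = 0} = UNIV" by auto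
  have "degree p \<le> q - 1"
    unfolding p_def by (rule degree_sum_le) (auto intro: order.trans[OF degree_monom_le])
  then have "p = 0" using card_poly_roots_bound[of p] q1 r by (fastforce simp: q_def)
  then have "coeff p i = 0" by simp
  moreover have "i \<le> q - 1" using assms by (simp add: q_def)
  ultimately show ?thesis using assms by (simp add: p_def coeff_sum q_def)
qed

text \<open>The inner binomial coefficients vanish in the field, hence in its closure. Oddness then
  follows from 2 \<noteq> 0: for even \<open>q\<close>, additivity at 1 and -1 would give 0 =
  2.\<close>

lemma frobenius_alg_closure:
  assumes "(2::'a::{field,finite}) \<noteq> 0"
  shows "frobenius TYPE('a alg_closure) CARD('a)"
proof
  define q where "q = CARD('a)"
  show q1: "q > 1" using card_field_gt1 by (simp add: q_def)
  show "of_nat q = (0::'a alg_closure)"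
    using arg_cong[OF of_nat_card_field[where 'a='a], of to_ac] by (simp add: q_def)
  show fr: "(x + y) ^ q = x ^ q + y ^ q" for x y :: "'a alg_closure"
  proof -
    have z: "of_nat (q choose i) = (0::'a alg_closure)" if "i \<in> {1..q-1}" for i
    proof -
      have "0 < i" "i < CARD('a)" using that q1 by (auto simp: q_def)
      then show ?thesis using arg_cong[OF binomial_card_field, of i to_ac] by (simp add: q_def)
    qed
    have "(x + y) ^ q = (\<Sum>k\<le>q. of_nat (q choose k) * x ^ k * y ^ (q - k))" by (rule binomial_ring)
    also have "{..q} = insert 0 (insert q {1..q-1})" using q1 by auto
    also have "(\<Sum>k\<in>insert 0 (insert q {1..q-1}). of_nat (q choose k) * x ^ k * y ^ (q - k)) = y ^ q + x ^ q"
      using q1 z by simp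
    finally show ?thesis by simp
  qed
  have two: "(2::'a alg_closure) \<noteq> 0"
    using assms by (metis to_ac_eq_0_iff to_ac_numeral)
  show "odd q"
  proof
    assume "even q"
    then have "(1 + -1) ^ q = (2 :: 'a alg_closure)" by (subst fr) simp
    then show False using two q1 by (simp add: zero_power)
  qed
qed

text \<open>A maximal additive subgroup $H$ not containing $1$ satisfies $x \in k + H$ for some natural $k$,
  unique modulo the characteristic.\<close>

lemma exists_additive_character:
  obtains \<phi> :: "'a::{field,finite} \<Rightarrow> complex" where
    "\<And>x y. \<phi> (x + y) = \<phi> x * \<phi> y" "\<And>x. cmod (\<phi> x) = 1" "\<phi> 1 \<noteq> 1"
proof -
  define p where "p = CHAR('a)"
  have p0: "p > 0" unfolding p_def by (rule finite_imp_CHAR_pos) simp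
  have pp: "prime p" using p0 unfolding p_def by (rule prime_CHAR_semidom)
  have ofp: "of_nat p = (0::'a)" by (simp add: p_def)
  define sg :: "'a set \<Rightarrow> bool" where "sg = (\<lambda>H. 0 \<in> H \<and> (\<forall>x\<in>H. \<forall>y\<in>H. x - y \<in> H))"
  have sg_minus: "- x \<in> H" if "sg H" "x \<in> H" for H x
  proof -
    have "0 - x \<in> H" using that unfolding sg_def by blast
    then show ?thesis by simp
  qed
  have sg_add: "x + y \<in> H" if "sg H" "x \<in> H" "y \<in> H" for H x y
  proof -
    have "x - (- y) \<in> H" using sg_minus[OF that(1,3)] that unfolding sg_def by blast
    then show ?thesis by simp
  qed
  have sg_mult: "of_nat n * x \<in> H" if "sg H" "x \<in> H" for H x n
  proof (induction n)
    case 0 then show ?case using that by (simp add: sg_def)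
  next
    case (Suc n) then show ?case using sg_add[OF that Suc] by (simp add: distrib_right)
  qed
  have inv: "\<exists>m. of_nat m * of_nat j = (1::'a)" if "of_nat j \<noteq> (0::'a)" for j
  proof -
    \<comment> \<open>The inverse of a nonzero multiple of 1 is again a multiple of 1, namely its
      (q-2)-th power.\<close>
    define n where "n = CARD('a) - 2"
    have n: "CARD('a) = Suc (Suc n)" using card_field_gt1[where 'a='a] unfolding n_def by linarith
    have "of_nat j * (of_nat j ^ n * of_nat j) = (of_nat j :: 'a) ^ Suc (Suc n)"
      by (simp only: power_Suc[of _ "Suc n"] power_Suc2[of _ n])
    also have "\<dots> = of_nat j * 1"
      using power_card_field[of "of_nat j :: 'a"] unfolding n by (simp only: mult_1_right)
    finally have "of_nat j * (of_nat j ^ n * of_nat j) = (of_nat j :: 'a) * 1" .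
    then have "of_nat j ^ n * of_nat j = (1::'a)" using that mult_cancel_left by blast
    then show ?thesis by (intro exI[of _ "j ^ n"]) simp
  qed
  define \<A> where "\<A> = {H. sg H \<and> 1 \<notin> H}"
  have "{0} \<in> \<A>" by (simp add: sg_def \<A>_def)
  then have "\<A> \<noteq> {}" by blast
  then obtain H where HA: "H \<in> \<A>" and mx: "\<And>H'. H' \<in> \<A> \<Longrightarrow> H \<subseteq> H' \<Longrightarrow> H = H'"
    using finite_has_maximal[of \<A>] by auto
  have H: "sg H" "1 \<notin> H" using HA by (simp_all add: \<A>_def)
  have max: "H = H'" if "sg H'" "1 \<notin> H'" "H \<subseteq> H'" for H'
    using mx[of H'] that by (simp add: \<A>_def)
  have ex: "\<exists>k. x - of_nat k \<in> H" for x
  proof (cases "x \<in> H")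
    case True then show ?thesis by (intro exI[of _ 0]) simp
  next
    case False
    \<comment> \<open>The subgroup generated by H and x. It is strictly larger than H, so by
      maximality it contains 1, and 1 = h + j x can be solved for x modulo H.\<close>
    define H' where "H' = {h + of_nat j * x | h j. h \<in> H}"
    have "sg H'"
      unfolding sg_def
    proof safe
      have "0 = 0 + of_nat 0 * x" by simp
      then show "0 \<in> H'" unfolding H'_def using H(1) unfolding sg_def by blast
    next
      fix u v assume "u \<in> H'" "v \<in> H'"
      then obtain h j h' j' where *: "u = h + of_nat j * x" "v = h' + of_nat j' * x" "h \<in> H" "h' \<in> H"
        by (auto simp: H'_def)
      \<comment> \<open>Only natural multiples of x occur in \<open>H'\<close>, so minus j' is
        written as (p - 1) j'.\<close>
      have "of_nat ((p - 1) * j') = - (of_nat j' :: 'a)"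
        using p0 ofp by (simp add: of_nat_diff)
      then have "u - v = (h - h') + of_nat (j + (p - 1) * j') * x"
        unfolding * by (simp only: of_nat_add) (simp add: algebra_simps)
      moreover have "h - h' \<in> H" using H(1) * unfolding sg_def by blast
      ultimately show "u - v \<in> H'" unfolding H'_def by blast
    qed
    moreover have "H \<subseteq> H'"
    proof
      fix h assume "h \<in> H"
      moreover have "h = h + of_nat 0 * x" by simp
      ultimately show "h \<in> H'" unfolding H'_def by blast
    qed
    moreover have "x \<in> H'"
    proof -
      have "x = 0 + of_nat 1 * x" by simp
      then show ?thesis unfolding H'_def using H(1) unfolding sg_def by blast
    qed
    ultimately have "1 \<in> H'" using max[of H'] False by auto
    then obtain h j where hj: "1 = h + of_nat j * x" "h \<in> H" by (auto simp: H'_def)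
    then have "of_nat j \<noteq> (0::'a)" using H(2) by auto
    then obtain m where m: "of_nat m * of_nat j = (1::'a)" using inv by blast
    have "of_nat m = of_nat m * h + of_nat m * of_nat j * x"
      using arg_cong[OF hj(1), of "\<lambda>z. of_nat m * z"] by (simp add: algebra_simps)
    then have "of_nat m = of_nat m * h + x" using m by simp
    then have "x - of_nat m = x - (of_nat m * h + x)" by (rule arg_cong)
    then have "x - of_nat m = - (of_nat m * h)" by simp
    then show ?thesis using sg_minus[OF H(1) sg_mult[OF H(1) hj(2), of m]] by metis
  qed
  have uniq0: "p dvd n" if "of_nat n \<in> H" for n
  proof (rule ccontr)
    assume "\<not> p dvd n"
    then have "of_nat n \<noteq> (0::'a)" by (simp add: p_def of_nat_eq_0_iff_char_dvd)
    then obtain m where "of_nat m * of_nat n = (1::'a)" using inv by blast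
    then show False using sg_mult[OF H(1) that, of m] H(2) by simp
  qed
  \<comment> \<open>A character of the integers modulo p; it is constant on the possible choices of
    k for a given x, because they agree modulo p.\<close>
  define e where "e = (\<lambda>k::nat. cis (2 * pi * k / p))"
  have e_add: "e (k + l) = e k * e l" for k l by (simp add: e_def cis_mult ring_distribs add_divide_distrib)
  have e_p: "e n = 1" if "p dvd n" for n
  proof -
    obtain t where "n = p * t" using \<open>p dvd n\<close> by (auto simp: dvd_def)
    then have "2 * pi * n / p = 2 * pi * t" using p0 by simp
    then have "e n = cis (2 * pi * t)" by (simp only: e_def)
    then show ?thesis by (simp add: cis_multiple_2pi)
  qed
  have e_eq: "e k = e l" if "of_nat k - of_nat l \<in> H" for k l
  proof (cases "l \<le> k")
    case True
    then have "of_nat (k - l) \<in> H" using that by (simp add: of_nat_diff)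
    then have "e (k - l) = 1" using uniq0 e_p by blast
    then show ?thesis using e_add[of "k - l" l] True by simp
  next
    case False
    then have "of_nat (l - k) \<in> H" using sg_minus[OF H(1) that] by (simp add: of_nat_diff)
    then have "e (l - k) = 1" using uniq0 e_p by blast
    then show ?thesis using e_add[of "l - k" k] False by simp
  qed
  define kk where "kk = (\<lambda>x. SOME k. x - of_nat k \<in> H)"
  have kk: "x - of_nat (kk x) \<in> H" for x unfolding kk_def using someI_ex[OF ex[of x]] .
  define \<phi> where "\<phi> = (\<lambda>x. e (kk x))"
  have val: "\<phi> x = e k" if "x - of_nat k \<in> H" for x k
  proof -
    have "(x - of_nat k) - (x - of_nat (kk x)) \<in> H" using H(1) that kk unfolding sg_def by blast
    then show ?thesis unfolding \<phi>_def by (intro e_eq) simp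
  qed
  show ?thesis
  proof (rule that[of \<phi>])
    fix x y
    have "(x - of_nat (kk x)) + (y - of_nat (kk y)) \<in> H" by (rule sg_add[OF H(1) kk kk])
    then have "(x + y) - of_nat (kk x + kk y) \<in> H" by (simp add: algebra_simps)
    then have "\<phi> (x + y) = e (kk x + kk y)" by (rule val)
    then show "\<phi> (x + y) = \<phi> x * \<phi> y" by (simp add: e_add \<phi>_def)
  next
    show "cmod (\<phi> x) = 1" for x by (simp add: \<phi>_def e_def)
  next
    have "1 - of_nat 1 \<in> H" using H(1) by (simp add: sg_def)
    then have "\<phi> 1 = e 1" by (rule val)
    also have "\<dots> \<noteq> 1"
    proof
      assume "e 1 = 1"
      then have "Re (e 1) = 1" by simp
      then have "cos (2 * pi / p) = 1" by (simp add: e_def)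
      then obtain n :: int where "2 * pi / p = real_of_int n * 2 * pi" using cos_one_2pi_int by blast
      then have "1 = real_of_int (n * int p)" using p0 by (simp add: field_simps)
      then have "n * int p = 1" by linarith
      then have "int p dvd 1" by (metis dvd_triv_right)
      then show False using pp by (simp add: prime_nat_iff)
    qed
    finally show "\<phi> 1 \<noteq> 1" .
  qed
qed

locale additive_character =
  fixes \<phi> :: "'a::{field,finite} \<Rightarrow> complex"
  assumes hom: "\<phi> (x + y) = \<phi> x * \<phi> y"
    and norm1: "cmod (\<phi> x) = 1"
    and nontriv: "\<phi> 1 \<noteq> 1"
    and two: "(2::'a) \<noteq> 0"
begin

lemma phi_0: "\<phi> 0 = 1"
proof -
  have "\<phi> 0 * \<phi> 0 = \<phi> 0" using hom[of 0 0] by simp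
  moreover have "\<phi> 0 \<noteq> 0" using norm1[of 0] by auto
  ultimately show ?thesis by simp
qed

lemma phi_minus: "\<phi> (- x) = cnj (\<phi> x)"
proof -
  have "\<phi> x * \<phi> (- x) = 1" using hom[of x "-x"] phi_0 by simp
  moreover have "\<phi> x * cnj (\<phi> x) = 1" using norm1[of x] by (simp add: complex_norm_square[symmetric])
  ultimately have "\<phi> x * \<phi> (-x) = \<phi> x * cnj (\<phi> x)" by simp
  moreover have "\<phi> x \<noteq> 0" using norm1[of x] by auto
  ultimately show ?thesis by simp
qed

lemma phi_diff: "\<phi> (x - y) = \<phi> x * cnj (\<phi> y)"
  using hom[of x "-y"] by (simp add: phi_minus)

lemma sum_phi_UNIV: "(\<Sum>x\<in>UNIV. \<phi> x) = 0"
proof -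
  have "(\<Sum>x\<in>UNIV. \<phi> (x + 1)) = (\<Sum>x\<in>UNIV. \<phi> x)"
    by (rule sum.reindex_bij_witness[of _ "\<lambda>x. x - 1" "\<lambda>x. x + 1"]) auto
  then have "(\<Sum>x\<in>UNIV. \<phi> x) * \<phi> 1 = (\<Sum>x\<in>UNIV. \<phi> x)" by (simp add: hom sum_distrib_right)
  then show ?thesis using nontriv by simp
qed

lemma sum_phi_mult: "(\<Sum>x\<in>UNIV. \<phi> (c * x)) = (if c = 0 then of_nat CARD('a) else 0)"
proof (cases "c = 0")
  case False
  have "(\<Sum>x\<in>UNIV. \<phi> (c * x)) = (\<Sum>x\<in>UNIV. \<phi> x)"
    by (rule sum.reindex_bij_witness[of _ "\<lambda>x. x / c" "\<lambda>x. c * x"]) (use False in auto)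
  then show ?thesis using False sum_phi_UNIV by simp
qed (simp add: phi_0)

text \<open>The substitution x = r u turns r u + k/u into x + r k/x, and \<open>to_ac\<close>
  identifies the field with \<open>fld 1\<close>, both having q elements. For k = 0 the sum is a
  complete character sum without its term at 0, that is, -1.\<close>

lemma kloosterman:
  assumes r: "r \<noteq> 0"
  shows "cmod (\<Sum>u\<in>UNIV - {0}. \<phi> (r * u + k / u)) \<le> 3 * sqrt CARD('a)"
proof (cases "k = 0")
  case True
  have "(\<Sum>u\<in>UNIV. \<phi> (r * u)) = 1 + (\<Sum>u\<in>UNIV - {0}. \<phi> (r * u))"
    by (subst sum.remove[of _ 0]) (auto simp: phi_0)
  then have "(\<Sum>u\<in>UNIV - {0}. \<phi> (r * u)) = -1" using sum_phi_mult[of r] r by (simp add: eq_neg_iff_add_eq_0 add.commute)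
  then have "cmod (\<Sum>u\<in>UNIV - {0}. \<phi> (r * u + k / u)) = 1" using True by simp
  moreover have "1 \<le> sqrt CARD('a)" using card_field_gt1[where 'a='a] by simp
  ultimately show ?thesis by linarith
next
  case False
  interpret frobenius "CARD('a)" "TYPE('a alg_closure)" by (rule frobenius_alg_closure[OF two])
  have sub: "range to_ac \<subseteq> (fld 1 :: 'a alg_closure set)"
    by (auto simp: fld_def power_card_field simp flip: to_ac_power)
  have crd: "card (range (to_ac :: 'a \<Rightarrow> _)) = card (fld 1 :: 'a alg_closure set)"
    using card_fld(1)[of 1] by (simp add: card_image inj_to_ac)
  have fld1: "fld 1 = range (to_ac :: 'a \<Rightarrow> _)"
    by (rule card_subset_eq[OF card_fld(2)[OF zero_less_one] sub crd, symmetric])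
  define \<psi> where "\<psi> = (\<lambda>x :: 'a alg_closure. \<phi> (of_ac x))"
  have psi: "\<psi> (to_ac x) = \<phi> x" for x by (simp add: \<psi>_def)
  define a where "a = r * k"
  have "cmod (\<Sum>x\<in>fld 1 - {0}. \<psi> (x + to_ac a / x)) \<le> 3 * sqrt CARD('a)"
  proof (rule kloosterman_bound)
    show "to_ac a \<in> fld 1" unfolding fld1 by (rule rangeI)
    show "to_ac a \<noteq> 0" using r False by (simp add: a_def)
    show "\<psi> (x + y) = \<psi> x * \<psi> y" if "x \<in> fld 1" "y \<in> fld 1" for x y
      using that unfolding fld1 by (auto simp: psi hom simp flip: to_ac_add)
    show "cmod (\<psi> c) = 1" for c by (simp add: \<psi>_def norm1)
    show "(\<Sum>u\<in>fld 1. \<psi> u) = 0"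
      unfolding fld1 by (simp add: sum.reindex[OF inj_to_ac] psi sum_phi_UNIV)
  qed
  also have "(\<Sum>x\<in>fld 1 - {0}. \<psi> (x + to_ac a / x)) = (\<Sum>x\<in>UNIV - {0}. \<phi> (x + a / x))"
    unfolding fld1
    by (rule sum.reindex_bij_witness[of _ to_ac of_ac]) (auto simp: psi simp flip: to_ac_add to_ac_divide)
  also have "\<dots> = (\<Sum>u\<in>UNIV - {0}. \<phi> (r * u + k / u))"
    by (rule sum.reindex_bij_witness[of _ "\<lambda>u. r * u" "\<lambda>x. x / r"]) (use r in \<open>auto simp: a_def field_simps\<close>)
  finally show ?thesis .
qed

end

section \<open>Fourier analysis of distances\<close>

definition dot :: "'a::comm_ring_1 ^ 'n \<Rightarrow> 'a ^ 'n \<Rightarrow> 'a" where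
  "dot x y = (\<Sum>i\<in>UNIV. x $ i * y $ i)"

lemma dot_add_left: "dot (x + y) z = dot x z + dot y z"
  by (simp add: dot_def distrib_right sum.distrib)

lemma dot_diff_right: "dot z (x - y) = dot z x - dot z y"
  by (simp add: dot_def right_diff_distrib sum_subtractf)

lemma dot_scale_right: "dot x (c *s y) = c * dot x y"
  unfolding dot_def sum_distrib_left by (rule sum.cong) simp_all

lemma dot_0_right: "dot x 0 = 0"
  by (simp add: dot_def)

lemma sqnorm_add: "sqnorm (x + y) = sqnorm x + 2 * dot x y + sqnorm y"
  unfolding sqnorm_def dot_def sum_distrib_left sum.distrib[symmetric]
  by (rule sum.cong) (simp_all add: algebra_simps)

lemma sqnorm_scale: "sqnorm (c *s x) = c * c * sqnorm x"
  unfolding sqnorm_def sum_distrib_left by (rule sum.cong) (simp_all add: mult_ac)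

lemma sqnorm_0: "sqnorm 0 = 0"
  by (simp add: sqnorm_def)

section \<open>Orthogonality and Parseval identities\<close>

context additive_character
begin

definition ft :: "('a ^ 'n) set \<Rightarrow> 'a ^ 'n \<Rightarrow> complex" where
  "ft E m = (\<Sum>x\<in>E. \<phi> (dot m x))"

text \<open>For z \<noteq> 0 there is a v with dot v z = 1, and translating m by v multiplies the
  sum by \<phi> 1 \<noteq> 1.\<close>

lemma sum_phi_dot:
  fixes z :: "'a ^ 'n"
  shows "(\<Sum>m\<in>UNIV. \<phi> (dot m z)) = (if z = 0 then of_nat (CARD('a) ^ CARD('n)) else 0)"
proof (cases "z = 0")
  case True then show ?thesis by (simp add: dot_0_right phi_0)
next
  case False
  then obtain i where i: "z $ i \<noteq> 0" by (auto simp: vec_eq_iff)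
  define v where "v = axis i (1 / z $ i)"
  have "dot v z = (\<Sum>j\<in>UNIV. if j = i then 1 else 0)"
    unfolding dot_def by (rule sum.cong) (auto simp: v_def axis_def i)
  then have dv: "dot v z = 1" by simp
  have "(\<Sum>m\<in>UNIV. \<phi> (dot (m + v) z)) = (\<Sum>m\<in>UNIV. \<phi> (dot m z))"
    by (rule sum.reindex_bij_witness[of _ "\<lambda>m. m - v" "\<lambda>m. m + v"]) auto
  then have "(\<Sum>m\<in>UNIV. \<phi> (dot m z)) * \<phi> 1 = (\<Sum>m\<in>UNIV. \<phi> (dot m z))"
    by (simp add: dot_add_left hom dv sum_distrib_right)
  then show ?thesis using nontriv False by simp
qed

lemma ft_mult_cnj: "ft E m * cnj (ft F m) = (\<Sum>x\<in>E. \<Sum>y\<in>F. \<phi> (dot m (x - y)))"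
  by (simp add: ft_def sum_product dot_diff_right phi_diff)

lemma ft_plancherel:
  fixes E F :: "('a ^ 'n) set"
  shows "(\<Sum>m\<in>UNIV. ft E m * cnj (ft F m)) = of_nat (CARD('a) ^ CARD('n) * card (E \<inter> F))"
proof -
  have "(\<Sum>m\<in>UNIV. ft E m * cnj (ft F m)) = (\<Sum>m\<in>UNIV. \<Sum>x\<in>E. \<Sum>y\<in>F. \<phi> (dot m (x - y)))"
    by (simp only: ft_mult_cnj)
  also have "\<dots> = (\<Sum>x\<in>E. \<Sum>m\<in>UNIV. \<Sum>y\<in>F. \<phi> (dot m (x - y)))" by (rule sum.swap)
  also have "\<dots> = (\<Sum>x\<in>E. \<Sum>y\<in>F. \<Sum>m\<in>UNIV. \<phi> (dot m (x - y)))"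
    by (rule sum.cong[OF refl]) (rule sum.swap)
  also have "\<dots> = (\<Sum>x\<in>E. \<Sum>y\<in>F. if y = x then of_nat (CARD('a) ^ CARD('n)) else 0)"
    by (intro sum.cong refl) (auto simp: sum_phi_dot)
  also have "\<dots> = (\<Sum>x\<in>E. if x \<in> F then of_nat (CARD('a) ^ CARD('n)) else 0)" by simp
  also have "\<dots> = (\<Sum>x\<in>E \<inter> F. of_nat (CARD('a) ^ CARD('n)))"
    by (rule sum.inter_restrict[symmetric]) simp
  finally show ?thesis by (simp add: mult.commute)
qed

lemma ft_parseval:
  fixes E :: "('a ^ 'n) set"
  shows "(\<Sum>m\<in>UNIV. (cmod (ft E m))\<^sup>2) = real (CARD('a) ^ CARD('n) * card E)"
proof -
  have "complex_of_real (\<Sum>m\<in>UNIV. (cmod (ft E m))\<^sup>2) = of_real (real (CARD('a) ^ CARD('n) * card E))"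
    using ft_plancherel[of E E] by (simp only: of_real_sum complex_norm_square Int_absorb of_real_of_nat_eq)
  then show ?thesis by (simp only: of_real_eq_iff)
qed

lemma parseval1:
  fixes f :: "'a \<Rightarrow> complex"
  shows "(\<Sum>s\<in>UNIV. (cmod (\<Sum>t\<in>UNIV. \<phi> (s * t) * f t))\<^sup>2) = real CARD('a) * (\<Sum>t\<in>UNIV. (cmod (f t))\<^sup>2)"
proof -
  have "complex_of_real (\<Sum>s\<in>UNIV. (cmod (\<Sum>t\<in>UNIV. \<phi> (s * t) * f t))\<^sup>2)
      = (\<Sum>s\<in>UNIV. \<Sum>t\<in>UNIV. \<Sum>t'\<in>UNIV. \<phi> ((t - t') * s) * (f t * cnj (f t')))"
  proof -
    have "(\<Sum>t\<in>UNIV. \<phi> (s * t) * f t) * cnj (\<Sum>t\<in>UNIV. \<phi> (s * t) * f t) =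
        (\<Sum>t\<in>UNIV. \<Sum>t'\<in>UNIV. \<phi> ((t - t') * s) * (f t * cnj (f t')))" for s
      unfolding cnj_sum sum_product
      by (intro sum.cong refl) (simp add: phi_diff mult.commute[of _ s] right_diff_distrib)
    then show ?thesis by (simp only: of_real_sum complex_norm_square)
  qed
  also have "\<dots> = (\<Sum>t\<in>UNIV. \<Sum>s\<in>UNIV. \<Sum>t'\<in>UNIV. \<phi> ((t - t') * s) * (f t * cnj (f t')))" by (rule sum.swap)
  also have "\<dots> = (\<Sum>t\<in>UNIV. \<Sum>t'\<in>UNIV. \<Sum>s\<in>UNIV. \<phi> ((t - t') * s) * (f t * cnj (f t')))"
    by (rule sum.cong[OF refl]) (rule sum.swap)
  also have "\<dots> = (\<Sum>t\<in>UNIV. \<Sum>t'\<in>UNIV. if t' = t then of_nat CARD('a) * (f t * cnj (f t')) else 0)"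
    by (intro sum.cong refl) (auto simp: sum_phi_mult simp flip: sum_distrib_right)
  also have "\<dots> = (\<Sum>t\<in>UNIV. of_nat CARD('a) * (f t * cnj (f t)))" by simp
  also have "\<dots> = complex_of_real (real CARD('a) * (\<Sum>t\<in>UNIV. (cmod (f t))\<^sup>2))"
    by (simp only: of_real_mult of_real_sum complex_norm_square of_real_of_nat_eq sum_distrib_left)
  finally show ?thesis by (simp only: of_real_eq_iff)
qed

end

locale distance_count = additive_character \<phi> for \<phi> :: "'a::{field,finite} \<Rightarrow> complex" +
  fixes E F :: "('a ^ 'n) set"
begin

text \<open>The Gauss sum of the quadratic form \<open>sqnorm\<close> on the whole space.\<close>

definition gs :: "'a \<Rightarrow> complex" where
  "gs u = (\<Sum>y\<in>(UNIV :: ('a ^ 'n) set). \<phi> (u * sqnorm y))"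

definition nu :: "'a \<Rightarrow> nat" where
  "nu t = card {(x, y). x \<in> E \<and> y \<in> F \<and> sqnorm (x - y) = t}"

definition nuhat :: "'a \<Rightarrow> complex" where
  "nuhat s = (\<Sum>t\<in>UNIV. \<phi> (s * t) * of_nat (nu t))"

definition A :: "'a \<Rightarrow> complex" where
  "A r = (\<Sum>m\<in>{m. sqnorm m = r}. ft E m * cnj (ft F m))"

definition energy :: "('a ^ 'n) set \<Rightarrow> 'a \<Rightarrow> real" where
  "energy S r = (\<Sum>m\<in>{m. sqnorm m = r}. (cmod (ft S m))\<^sup>2)"

text \<open>With x = y + h the difference of the two norms is linear in y, so the sum over y removes
  every h except 0.\<close>

lemma norm_gs:
  assumes "u \<noteq> 0"
  shows "(cmod (gs u))\<^sup>2 = real (CARD('a) ^ CARD('n))"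
proof -
  let ?V = "UNIV :: ('a ^ 'n) set"
  have "complex_of_real ((cmod (gs u))\<^sup>2) = (\<Sum>x\<in>?V. \<Sum>y\<in>?V. \<phi> (u * sqnorm x - u * sqnorm y))"
    unfolding complex_norm_square gs_def by (simp add: sum_product phi_diff)
  also have "\<dots> = (\<Sum>y\<in>?V. \<Sum>x\<in>?V. \<phi> (u * sqnorm x - u * sqnorm y))" by (rule sum.swap)
  also have "\<dots> = (\<Sum>y\<in>?V. \<Sum>h\<in>?V. \<phi> (u * sqnorm (y + h) - u * sqnorm y))"
  proof (rule sum.cong[OF refl])
    fix y :: "'a ^ 'n"
    show "(\<Sum>x\<in>?V. \<phi> (u * sqnorm x - u * sqnorm y)) = (\<Sum>h\<in>?V. \<phi> (u * sqnorm (y + h) - u * sqnorm y))"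
      by (rule sum.reindex_bij_witness[of _ "\<lambda>h. y + h" "\<lambda>x. x - y"]) auto
  qed
  also have "\<dots> = (\<Sum>h\<in>?V. \<Sum>y\<in>?V. \<phi> (u * sqnorm (y + h) - u * sqnorm y))" by (rule sum.swap)
  also have "\<dots> = (\<Sum>h\<in>?V. \<phi> (u * sqnorm h) * (\<Sum>y\<in>?V. \<phi> (dot y ((2 * u) *s h))))"
    unfolding sum_distrib_left
  proof (intro sum.cong refl)
    fix h y :: "'a ^ 'n"
    have "u * sqnorm (y + h) - u * sqnorm y = u * sqnorm h + dot y ((2 * u) *s h)"
      unfolding sqnorm_add dot_scale_right by (simp add: algebra_simps)
    then show "\<phi> (u * sqnorm (y + h) - u * sqnorm y) = \<phi> (u * sqnorm h) * \<phi> (dot y ((2 * u) *s h))"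
      by (simp add: hom)
  qed
  also have "\<dots> = (\<Sum>h\<in>?V. if h = 0 then of_nat (CARD('a) ^ CARD('n)) else 0)"
    using assms two by (intro sum.cong refl) (auto simp: sum_phi_dot sqnorm_0 phi_0 vector_mul_eq_0)
  also have "\<dots> = complex_of_real (real (CARD('a) ^ CARD('n)))" by simp
  finally show ?thesis by (simp only: of_real_eq_iff)
qed

lemma complete_square:
  fixes z :: "'a ^ 'n"
  assumes u: "u \<noteq> 0"
  shows "(\<Sum>m\<in>UNIV. \<phi> (u * sqnorm m) * \<phi> (dot m z)) = \<phi> (- (sqnorm z / (4 * u))) * gs u"
proof -
  define c where "c = 1 / (2 * u)"
  have "(4::'a) = 2 * 2" by simp
  then have four: "(4::'a) \<noteq> 0" using two by (metis mult_eq_0_iff)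
  have c: "2 * u * c = 1" "u * (c * c) = 1 / (4 * u)" using u two four by (auto simp: c_def field_simps)
  have "gs u = (\<Sum>m\<in>(UNIV :: ('a ^ 'n) set). \<phi> (u * sqnorm (m + c *s z)))"
    unfolding gs_def by (rule sum.reindex_bij_witness[of _ "\<lambda>m. m + c *s z" "\<lambda>m. m - c *s z"]) auto
  also have "\<dots> = (\<Sum>m\<in>UNIV. \<phi> (u * sqnorm m) * \<phi> (dot m z) * \<phi> (sqnorm z / (4 * u)))"
  proof (rule sum.cong[OF refl])
    fix m :: "'a ^ 'n"
    have "u * sqnorm (m + c *s z) = u * sqnorm m + (2 * u * c) * dot m z + (u * (c * c)) * sqnorm z"
      unfolding sqnorm_add sqnorm_scale dot_scale_right by (simp add: algebra_simps)
    then show "\<phi> (u * sqnorm (m + c *s z)) = \<phi> (u * sqnorm m) * \<phi> (dot m z) * \<phi> (sqnorm z / (4 * u))"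
      unfolding c by (simp add: hom)
  qed
  finally have "gs u = (\<Sum>m\<in>UNIV. \<phi> (u * sqnorm m) * \<phi> (dot m z)) * \<phi> (sqnorm z / (4 * u))"
    by (simp add: sum_distrib_right)
  moreover have "\<phi> (- (sqnorm z / (4 * u))) * \<phi> (sqnorm z / (4 * u)) = 1"
    using hom[of "- (sqnorm z / (4 * u))" "sqnorm z / (4 * u)"] by (simp add: phi_0)
  ultimately show ?thesis by (simp add: mult_ac)
qed

lemma nuhat_eq: "nuhat s = (\<Sum>x\<in>E. \<Sum>y\<in>F. \<phi> (s * sqnorm (x - y)))"
proof -
  have "(\<Sum>x\<in>E. \<Sum>y\<in>F. \<phi> (s * sqnorm (x - y))) = (\<Sum>p\<in>E \<times> F. \<phi> (s * sqnorm (fst p - snd p)))"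
    by (simp add: sum.cartesian_product case_prod_beta)
  also have "\<dots> = (\<Sum>t\<in>UNIV. \<Sum>p\<in>{p\<in>E \<times> F. sqnorm (fst p - snd p) = t}. \<phi> (s * sqnorm (fst p - snd p)))"
    by (rule sum.group[symmetric]) auto
  also have "\<dots> = (\<Sum>t\<in>UNIV. \<phi> (s * t) * of_nat (card {p\<in>E \<times> F. sqnorm (fst p - snd p) = t}))"
    by (intro sum.cong refl) (simp add: mult.commute)
  also have "\<dots> = nuhat s"
    unfolding nuhat_def nu_def by (intro sum.cong refl arg_cong2[where f="(*)"] arg_cong[where f=of_nat] arg_cong[where f=card]) auto
  finally show ?thesis by simp
qed

lemma sum_A_phi: "(\<Sum>r\<in>UNIV. \<phi> (u * r) * A r) = (\<Sum>m\<in>UNIV. \<phi> (u * sqnorm m) * (ft E m * cnj (ft F m)))"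
proof -
  have "(\<Sum>m\<in>UNIV. \<phi> (u * sqnorm m) * (ft E m * cnj (ft F m))) =
     (\<Sum>r\<in>UNIV. \<Sum>m\<in>{m\<in>UNIV. sqnorm m = r}. \<phi> (u * sqnorm m) * (ft E m * cnj (ft F m)))"
    by (rule sum.group[symmetric]) auto
  also have "\<dots> = (\<Sum>r\<in>UNIV. \<phi> (u * r) * A r)"
    unfolding A_def sum_distrib_left by (intro sum.cong refl) auto
  finally show ?thesis by simp
qed

text \<open>Expanding the product of the transforms over pairs leaves, for each pair, a sum over m
  to which \<open>complete_square\<close> applies. The frequency -1/(4u) comes from there; it runs
  through all nonzero elements as u does.\<close>

lemma nuhat_gs:
  assumes u: "u \<noteq> 0"
  shows "nuhat (- 1 / (4 * u)) * gs u = (\<Sum>r\<in>UNIV. \<phi> (u * r) * A r)"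
proof -
  have "(\<Sum>r\<in>UNIV. \<phi> (u * r) * A r) = (\<Sum>m\<in>UNIV. \<Sum>x\<in>E. \<Sum>y\<in>F. \<phi> (u * sqnorm m) * \<phi> (dot m (x - y)))"
    unfolding sum_A_phi ft_mult_cnj by (simp only: sum_distrib_left)
  also have "\<dots> = (\<Sum>x\<in>E. \<Sum>m\<in>UNIV. \<Sum>y\<in>F. \<phi> (u * sqnorm m) * \<phi> (dot m (x - y)))" by (rule sum.swap)
  also have "\<dots> = (\<Sum>x\<in>E. \<Sum>y\<in>F. \<Sum>m\<in>UNIV. \<phi> (u * sqnorm m) * \<phi> (dot m (x - y)))"
    by (rule sum.cong[OF refl]) (rule sum.swap)
  also have "\<dots> = (\<Sum>x\<in>E. \<Sum>y\<in>F. \<phi> (- 1 / (4 * u) * sqnorm (x - y)) * gs u)"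
    by (simp add: complete_square[OF u])
  also have "\<dots> = nuhat (- 1 / (4 * u)) * gs u"
    unfolding nuhat_eq by (simp add: sum_distrib_right)
  finally show ?thesis by simp
qed

lemma sum_A: "(\<Sum>r\<in>UNIV. A r) = of_nat (CARD('a) ^ CARD('n) * card (E \<inter> F))"
  using sum_A_phi[of 0] ft_plancherel[of E F] by (simp add: phi_0)

lemma sum_nu: "(\<Sum>t\<in>UNIV. nu t) = card E * card F"
proof -
  have "complex_of_nat (\<Sum>t\<in>UNIV. nu t) = nuhat 0" by (simp add: nuhat_def phi_0)
  also have "\<dots> = of_nat (card E * card F)" by (simp add: nuhat_eq phi_0)
  finally show ?thesis by (simp only: of_nat_eq_iff)
qed

lemma nuhat_0: "nuhat 0 = of_nat (card E * card F)"
  by (simp add: nuhat_eq phi_0)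

lemma sum_reciprocal: "(\<Sum>s\<in>UNIV - {0}. f s) = (\<Sum>u\<in>UNIV - {0::'a}. f (- 1 / (4 * u)))"
proof -
  have "(4::'a) = 2 * 2" by simp
  then have four: "(4::'a) \<noteq> 0" using two by (metis mult_eq_0_iff)
  show ?thesis
    by (rule sum.reindex_bij_witness[of _ "\<lambda>u. - 1 / (4 * u)" "\<lambda>u. - 1 / (4 * u)"]) (use four in \<open>auto simp: field_simps\<close>)
qed

lemma norm_nuhat:
  assumes "u \<noteq> 0"
  shows "(cmod (nuhat (- 1 / (4 * u))))\<^sup>2 = (cmod (\<Sum>r\<in>UNIV. \<phi> (u * r) * A r))\<^sup>2 / real (CARD('a) ^ CARD('n))"
proof -
  have "(cmod (nuhat (- 1 / (4 * u))))\<^sup>2 * (cmod (gs u))\<^sup>2 = (cmod (\<Sum>r\<in>UNIV. \<phi> (u * r) * A r))\<^sup>2"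
    unfolding nuhat_gs[OF assms, symmetric] by (simp add: norm_mult power_mult_distrib)
  then show ?thesis unfolding norm_gs[OF assms] by (simp add: field_simps)
qed

text \<open>Parseval is used for nu and for A, with frequency 0 split off on both sides. For nu it
  contributes |E|^2 |F|^2; for A it is the sum of all A(r), equal to Q |E \<inter> F| by Plancherel,
  whence the subtracted square. At the other frequencies the squared moduli differ by the factor |gs
  u|^2 = Q.\<close>

lemma second_moment:
  fixes q Q :: real
  defines "q \<equiv> real CARD('a)" and "Q \<equiv> real (CARD('a) ^ CARD('n))"
  shows "q * (\<Sum>t\<in>UNIV. (real (nu t))\<^sup>2) =
    (real (card E * card F))\<^sup>2 + (q * (\<Sum>r\<in>UNIV. (cmod (A r))\<^sup>2) - (Q * card (E \<inter> F))\<^sup>2) / Q"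
proof -
  have "q * (\<Sum>t\<in>UNIV. (real (nu t))\<^sup>2) = (\<Sum>s\<in>UNIV. (cmod (nuhat s))\<^sup>2)"
    using parseval1[of "\<lambda>t. of_nat (nu t)"] by (simp add: nuhat_def q_def)
  also have "\<dots> = (cmod (nuhat 0))\<^sup>2 + (\<Sum>s\<in>UNIV - {0}. (cmod (nuhat s))\<^sup>2)"
    by (subst sum.remove[of _ 0]) auto
  also have "(\<Sum>s\<in>UNIV - {0}. (cmod (nuhat s))\<^sup>2) = (\<Sum>u\<in>UNIV - {0}. (cmod (\<Sum>r\<in>UNIV. \<phi> (u * r) * A r))\<^sup>2 / Q)"
    unfolding sum_reciprocal[of "\<lambda>s. (cmod (nuhat s))\<^sup>2"]
    by (rule sum.cong[OF refl]) (simp only: norm_nuhat Q_def Diff_iff singleton_iff simp_thms)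
  also have "\<dots> = (\<Sum>u\<in>UNIV - {0}. (cmod (\<Sum>r\<in>UNIV. \<phi> (u * r) * A r))\<^sup>2) / Q"
    by (simp add: sum_divide_distrib)
  also have "(\<Sum>u\<in>UNIV - {0}. (cmod (\<Sum>r\<in>UNIV. \<phi> (u * r) * A r))\<^sup>2) =
      (\<Sum>u\<in>UNIV. (cmod (\<Sum>r\<in>UNIV. \<phi> (u * r) * A r))\<^sup>2) - (cmod (\<Sum>r\<in>UNIV. A r))\<^sup>2"
    by (subst sum.remove[of UNIV 0]) (auto simp: phi_0)
  also have "(\<Sum>u\<in>UNIV. (cmod (\<Sum>r\<in>UNIV. \<phi> (u * r) * A r))\<^sup>2) = q * (\<Sum>r\<in>UNIV. (cmod (A r))\<^sup>2)"
    unfolding q_def by (rule parseval1)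
  also have "(cmod (\<Sum>r\<in>UNIV. A r))\<^sup>2 = (Q * card (E \<inter> F))\<^sup>2"
    unfolding sum_A Q_def by (simp add: norm_mult norm_power)
  also have "(cmod (nuhat 0))\<^sup>2 = (real (card E * card F))\<^sup>2"
    unfolding nuhat_0 by (simp add: norm_mult)
  finally show ?thesis .
qed

lemma norm_A_le: "(cmod (A r))\<^sup>2 \<le> energy E r * energy F r"
proof -
  have "cmod (A r) \<le> (\<Sum>m\<in>{m. sqnorm m = r}. cmod (ft E m) * cmod (ft F m))"
    unfolding A_def by (rule order.trans[OF norm_sum]) (simp add: norm_mult)
  then have "(cmod (A r))\<^sup>2 \<le> (\<Sum>m\<in>{m. sqnorm m = r}. cmod (ft E m) * cmod (ft F m))\<^sup>2"
    by (intro power_mono) auto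
  also have "\<dots> \<le> energy E r * energy F r"
    unfolding energy_def by (rule Cauchy_Schwarz_ineq_sum)
  finally show ?thesis .
qed

lemma energy_nonneg: "energy S r \<ge> 0"
  by (simp add: energy_def sum_nonneg)

lemma sum_energy: "(\<Sum>r\<in>UNIV. energy S r) = real (CARD('a) ^ CARD('n) * card S)"
proof -
  have "(\<Sum>m\<in>UNIV. (cmod (ft S m))\<^sup>2) = (\<Sum>r\<in>UNIV. \<Sum>m\<in>{m\<in>UNIV. sqnorm m = r}. (cmod (ft S m))\<^sup>2)"
    by (rule sum.group[symmetric]) auto
  then show ?thesis unfolding ft_parseval[symmetric] energy_def by simp
qed

text \<open>On each sphere the energy of E is replaced by its upper bound M, and the energies of F
  are summed by Parseval.\<close>

lemma sum_norm_A_le: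
  assumes "\<And>r. r \<noteq> 0 \<Longrightarrow> energy E r \<le> M"
  shows "(\<Sum>r\<in>UNIV - {0}. (cmod (A r))\<^sup>2) \<le> M * real (CARD('a) ^ CARD('n) * card F)"
proof -
  have M0: "M \<ge> 0" using assms[of 1] energy_nonneg[of E 1] by simp
  have "(\<Sum>r\<in>UNIV - {0}. (cmod (A r))\<^sup>2) \<le> (\<Sum>r\<in>UNIV - {0}. M * energy F r)"
    by (rule sum_mono) (use assms energy_nonneg in \<open>auto intro!: order.trans[OF norm_A_le] mult_right_mono\<close>)
  also have "\<dots> \<le> (\<Sum>r\<in>UNIV. M * energy F r)"
    by (rule sum_mono2) (use M0 energy_nonneg in auto)
  finally show ?thesis by (simp only: sum_distrib_left[symmetric] sum_energy)
qed

lemma nu_eq_0: "t \<notin> dist_set E F \<Longrightarrow> nu t = 0"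
  by (auto simp: nu_def dist_set_def card_eq_0_iff)

text \<open>The set T makes it possible to discard distance 0 when too many pairs could be
  concentrated there.\<close>

lemma distance_cauchy_schwarz:
  "(\<Sum>t\<in>T. real (nu t))\<^sup>2 \<le> real (card (dist_set E F)) * (\<Sum>t\<in>T. (real (nu t))\<^sup>2)"
proof -
  have "(\<Sum>t\<in>T. real (nu t)) = (\<Sum>t\<in>T \<inter> dist_set E F. 1 * real (nu t))"
    using nu_eq_0 by (subst sum.inter_restrict) (auto intro!: sum.cong)
  then have "(\<Sum>t\<in>T. real (nu t))\<^sup>2 \<le> (\<Sum>t\<in>T \<inter> dist_set E F. 1\<^sup>2) * (\<Sum>t\<in>T \<inter> dist_set E F. (real (nu t))\<^sup>2)"
    by (simp only: Cauchy_Schwarz_ineq_sum)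
  also have "\<dots> \<le> real (card (dist_set E F)) * (\<Sum>t\<in>T. (real (nu t))\<^sup>2)"
    by (intro mult_mono sum_mono2 sum_nonneg) (auto intro!: card_mono)
  finally show ?thesis .
qed

end

section \<open>Even dimension\<close>

text \<open>The squares S and the set u - S each contain more than half of the field, so they
  meet.\<close>

lemma sum_of_two_squares:
  fixes u :: "'a::{field,finite}"
  obtains a b where "a * a + b * b = u"
proof -
  define S where "S = range (\<lambda>x::'a. x * x)"
  define T where "T = (\<lambda>s. u - s) ` S"
  have cT: "card T = card S" unfolding T_def by (rule card_image) (auto simp: inj_on_def)
  have S0: "0 \<in> S" unfolding S_def by (metis mult_zero_left rangeI)
  have "CARD('a) = (\<Sum>s\<in>S. card {x::'a. x * x = s})"
    using sum.group[of "UNIV::'a set" S "\<lambda>x. x * x" "\<lambda>_. 1::nat"] by (simp add: S_def)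
  also have "\<dots> = card {x::'a. x * x = 0} + (\<Sum>s\<in>S - {0}. card {x::'a. x * x = s})"
    using S0 by (subst sum.remove[of _ 0]) (auto simp: S_def)
  also have "(\<Sum>s\<in>S - {0}. card {x::'a. x * x = s}) \<le> (\<Sum>s\<in>S - {0}. 2)"
  proof (rule sum_mono)
    fix s assume "s \<in> S - {0}"
    then obtain r where r: "s = r * r" by (auto simp: S_def)
    have "x = r \<or> x = - r" if "x * x = r * r" for x using that by (simp add: square_eq_iff)
    then have "{x. x * x = s} \<subseteq> {r, -r}" using r by auto
    then have "card {x. x * x = s} \<le> card {r, -r}" by (intro card_mono) auto
    also have "\<dots> \<le> 2" by (simp add: card_insert_if)
    finally show "card {x. x * x = s} \<le> 2" .
  qed
  finally have "CARD('a) \<le> 1 + 2 * (card S - 1)" using S0 by (simp add: S_def card_Diff_subset)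
  moreover have "card S > 0" using S0 by (auto simp: card_gt_0_iff S_def)
  ultimately have "CARD('a) < card S + card T" using cT by linarith
  then have "S \<inter> T \<noteq> {}"
  proof (rule contrapos_pn)
    assume "S \<inter> T = {}"
    then have "card S + card T = card (S \<union> T)" by (subst card_Un_disjoint) auto
    also have "\<dots> \<le> CARD('a)" by (rule card_mono) auto
    finally show "\<not> CARD('a) < card S + card T" by simp
  qed
  then obtain a b where "a * a = u - b * b" by (auto simp: S_def T_def)
  then show ?thesis using that[of a b] by simp
qed

section \<open>Quadratic Gauss sums in one variable\<close>

context additive_character
begin

lemma phi_sum: "\<phi> (\<Sum>i\<in>I. f i) = (\<Prod>i\<in>I. \<phi> (f i))"
  by (induction I rule: infinite_finite_induct) (auto simp: phi_0 hom)

definition g1 :: "'a \<Rightarrow> complex" where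
  "g1 u = (\<Sum>y\<in>UNIV. \<phi> (u * (y * y)))"

text \<open>The square is a sum over pairs of \<phi>(u (x^2 + y^2)). Write u = a^2 + b^2:
  multiplication by "a + b i" is a bijection of the pairs and multiplies x^2 + y^2 by u, which
  removes the dependence on u without any quadratic character.\<close>

lemma g1_square:
  assumes "u \<noteq> 0" shows "g1 u * g1 u = g1 1 * g1 1"
proof -
  obtain a b where ab: "a * a + b * b = u" using sum_of_two_squares by blast
  have sq: "g1 v * g1 v = (\<Sum>p\<in>UNIV. \<phi> (v * (fst p * fst p + snd p * snd p)))" for v
  proof -
    have "g1 v * g1 v = (\<Sum>x\<in>UNIV. \<Sum>y\<in>UNIV. \<phi> (v * (x * x + y * y)))"
      by (simp add: g1_def sum_product hom distrib_left)
    then show ?thesis by (simp add: sum.cartesian_product case_prod_beta)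
  qed
  have "(\<Sum>p\<in>UNIV. \<phi> (1 * (fst p * fst p + snd p * snd p))) = (\<Sum>p\<in>UNIV. \<phi> (u * (fst p * fst p + snd p * snd p)))"
  proof (rule sum.reindex_bij_witness[of _ "\<lambda>p. (a * fst p - b * snd p, b * fst p + a * snd p)"
        "\<lambda>p. ((a * fst p + b * snd p) / u, (a * snd p - b * fst p) / u)"])
    fix p :: "'a \<times> 'a"
    obtain x y where p: "p = (x, y)" by fastforce
    have n: "a * (a * x + b * y) - b * (a * y - b * x) = u * x" "b * (a * x + b * y) + a * (a * y - b * x) = u * y"
      "a * (a * x - b * y) + b * (b * x + a * y) = u * x" "a * (b * x + a * y) - b * (a * x - b * y) = u * y"
      unfolding ab[symmetric] by (simp_all add: algebra_simps)
    have e1: "a * ((a * x + b * y) / u) - b * ((a * y - b * x) / u) = x"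
      by (simp only: n times_divide_eq_right diff_divide_distrib[symmetric] nonzero_mult_div_cancel_left[OF assms])
    have e2: "b * ((a * x + b * y) / u) + a * ((a * y - b * x) / u) = y"
      by (simp only: n times_divide_eq_right add_divide_distrib[symmetric] nonzero_mult_div_cancel_left[OF assms])
    show "(\<lambda>p. (a * fst p - b * snd p, b * fst p + a * snd p)) ((a * fst p + b * snd p) / u, (a * snd p - b * fst p) / u) = p"
      using e1 e2 by (simp add: p)
    have e3: "(a * (a * x - b * y) + b * (b * x + a * y)) / u = x" "(a * (b * x + a * y) - b * (a * x - b * y)) / u = y"
      unfolding n using assms by simp_all
    show "(\<lambda>p. ((a * fst p + b * snd p) / u, (a * snd p - b * fst p) / u)) (a * fst p - b * snd p, b * fst p + a * snd p) = p"
      using e3 by (simp add: p)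
    define X1 Y1 where "X1 = (a * x + b * y) / u" and "Y1 = (a * y - b * x) / u"
    have "x * x + y * y = (a * X1 - b * Y1) * (a * X1 - b * Y1) + (b * X1 + a * Y1) * (b * X1 + a * Y1)"
      using e1 e2 by (simp add: X1_def Y1_def)
    also have "\<dots> = u * (X1 * X1 + Y1 * Y1)" unfolding ab[symmetric] by (simp add: algebra_simps)
    finally show "\<phi> (u * (fst ((a * fst p + b * snd p) / u, (a * snd p - b * fst p) / u) * fst ((a * fst p + b * snd p) / u, (a * snd p - b * fst p) / u)
       + snd ((a * fst p + b * snd p) / u, (a * snd p - b * fst p) / u) * snd ((a * fst p + b * snd p) / u, (a * snd p - b * fst p) / u)))
       = \<phi> (1 * (fst p * fst p + snd p * snd p))"
      by (simp add: p X1_def Y1_def)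
  qed auto
  then show ?thesis by (simp only: sq)
qed

end

section \<open>Distance zero, radius zero and the estimate in even dimension\<close>

context distance_count
begin

lemma gs_eq_power: "gs u = g1 u ^ CARD('n)"
proof -
  have "g1 u ^ CARD('n) = (\<Prod>i\<in>(UNIV :: 'n set). \<Sum>y\<in>UNIV. \<phi> (u * (y * y)))" by (simp add: g1_def)
  also have "\<dots> = (\<Sum>g\<in>PiE (UNIV :: 'n set) (\<lambda>_. UNIV). \<Prod>i\<in>UNIV. \<phi> (u * (g i * g i)))"
    by (rule prod_sum_PiE) auto
  also have "\<dots> = (\<Sum>y\<in>(UNIV :: ('a ^ 'n) set). \<Prod>i\<in>UNIV. \<phi> (u * (y $ i * y $ i)))"
    by (rule sum.reindex_bij_witness[of _ vec_nth vec_lambda]) auto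
  also have "\<dots> = gs u" unfolding gs_def sqnorm_def sum_distrib_left phi_sum ..
  finally show ?thesis by simp
qed

text \<open>In even dimension \<open>gs u\<close> is a power of (g1 u)^2 and so is independent of u.
  Its conjugate is the value at -1, hence equal to it, and the common value is real.\<close>

lemma gs_const:
  assumes "even CARD('n)"
  obtains \<gamma> :: real where "\<gamma>\<^sup>2 = real (CARD('a) ^ CARD('n))" "\<forall>u. u \<noteq> 0 \<longrightarrow> gs u = of_real \<gamma>"
proof -
  obtain k where k: "CARD('n) = 2 * k" using assms by blast
  have c: "gs u = gs 1" if "u \<noteq> 0" for u
    using g1_square[OF that] by (simp add: gs_eq_power k power_mult power2_eq_square)
  have "cnj (gs 1) = gs (-1)" unfolding gs_def by (simp flip: phi_minus)
  also have "\<dots> = gs 1" by (rule c) simp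
  finally have "gs 1 \<in> \<real>" by (simp add: Reals_cnj_iff)
  then obtain \<gamma> where g: "gs 1 = of_real \<gamma>" by (auto elim: Reals_cases)
  have "\<gamma>\<^sup>2 = (cmod (gs 1))\<^sup>2" by (simp add: g)
  then show ?thesis using that[of \<gamma>] norm_gs[of 1] c g by simp
qed

lemma sum_nuhat: "(\<Sum>s\<in>UNIV. nuhat s) = of_nat (CARD('a) * nu 0)"
proof -
  have "(\<Sum>s\<in>UNIV. nuhat s) = (\<Sum>t\<in>UNIV. \<Sum>s\<in>UNIV. \<phi> (t * s) * of_nat (nu t))"
    unfolding nuhat_def by (subst sum.swap) (simp add: mult.commute)
  also have "\<dots> = (\<Sum>t\<in>UNIV. if t = 0 then of_nat CARD('a) * of_nat (nu t) else 0)"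
    by (intro sum.cong refl) (auto simp: sum_phi_mult simp flip: sum_distrib_right)
  finally show ?thesis by simp
qed

text \<open>Up to the factor |gs u| this is the transform of A, which is at most the sum of |ft E|
  |ft F| over the whole space; Cauchy-Schwarz and Parseval bound the latter.\<close>

lemma norm_nuhat_le:
  assumes "s \<noteq> 0"
  shows "(cmod (nuhat s))\<^sup>2 \<le> real (CARD('a) ^ CARD('n)) * real (card E * card F)"
proof -
  define Q where "Q = real (CARD('a) ^ CARD('n))"
  have Q0: "Q > 0" by (simp add: Q_def)
  define u where "u = - 1 / (4 * s)"
  have "(4::'a) = 2 * 2" by simp
  then have four: "(4::'a) \<noteq> 0" using two by (metis mult_eq_0_iff)
  have u: "u \<noteq> 0" "s = - 1 / (4 * u)" using assms four by (auto simp: u_def field_simps)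
  have "cmod (\<Sum>r\<in>UNIV. \<phi> (u * r) * A r) \<le> (\<Sum>m\<in>UNIV. cmod (ft E m) * cmod (ft F m))"
    unfolding sum_A_phi by (rule order.trans[OF norm_sum]) (simp add: norm_mult norm1)
  then have "(cmod (\<Sum>r\<in>UNIV. \<phi> (u * r) * A r))\<^sup>2 \<le> (\<Sum>m\<in>UNIV. cmod (ft E m) * cmod (ft F m))\<^sup>2"
    by (intro power_mono) auto
  also have "\<dots> \<le> (Q * card E) * (Q * card F)"
    using Cauchy_Schwarz_ineq_sum[of "\<lambda>m. cmod (ft E m)" "\<lambda>m. cmod (ft F m)" UNIV]
    unfolding ft_parseval Q_def by simp
  finally have "(cmod (\<Sum>r\<in>UNIV. \<phi> (u * r) * A r))\<^sup>2 / Q \<le> Q * real (card E * card F)"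
    using Q0 by (simp add: divide_le_eq mult_ac)
  then show ?thesis unfolding u(2) norm_nuhat[OF u(1)] Q_def by simp
qed

text \<open>Up to the factor q, nu 0 is the sum of \<open>nuhat\<close> over all frequencies, of
  which frequency 0 gives the expected share of pairs.\<close>

lemma nu0_le:
  "real CARD('a) * real (nu 0) \<le> real (card E * card F)
     + real CARD('a) * sqrt (real (CARD('a) ^ CARD('n)) * real (card E * card F))"
proof -
  define B where "B = sqrt (real (CARD('a) ^ CARD('n)) * real (card E * card F))"
  have B0: "B \<ge> 0" by (simp add: B_def)
  have "real (CARD('a) * nu 0) = cmod (\<Sum>s\<in>UNIV. nuhat s)" unfolding sum_nuhat by (simp add: norm_mult)
  also have "(\<Sum>s\<in>UNIV. nuhat s) = nuhat 0 + (\<Sum>s\<in>UNIV - {0}. nuhat s)"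
    by (subst sum.remove[of _ 0]) auto
  also have "cmod (nuhat 0 + (\<Sum>s\<in>UNIV - {0}. nuhat s)) \<le> cmod (nuhat 0) + (\<Sum>s\<in>UNIV - {0}. cmod (nuhat s))"
    by (rule order.trans[OF norm_triangle_ineq add_left_mono[OF norm_sum]])
  also have "cmod (nuhat 0) = real (card E * card F)" unfolding nuhat_0 by (simp add: norm_mult)
  also have "(\<Sum>s\<in>UNIV - {0}. cmod (nuhat s)) \<le> (\<Sum>s\<in>UNIV - {0::'a}. B)"
    by (rule sum_mono) (use norm_nuhat_le in \<open>auto simp: B_def intro!: real_le_rsqrt\<close>)
  also have "\<dots> \<le> (\<Sum>s\<in>(UNIV :: 'a set). B)" by (rule sum_mono2) (use B0 in auto)
  finally show ?thesis by (simp add: B_def)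
qed

lemma A_inversion:
  "of_nat CARD('a) * A r = (\<Sum>u\<in>UNIV. \<phi> (- (u * r)) * (\<Sum>r'\<in>UNIV. \<phi> (u * r') * A r'))"
proof -
  have "(\<Sum>u\<in>UNIV. \<phi> (- (u * r)) * (\<Sum>r'\<in>UNIV. \<phi> (u * r') * A r')) = (\<Sum>u\<in>UNIV. \<Sum>r'\<in>UNIV. \<phi> ((r' - r) * u) * A r')"
  proof (rule sum.cong[OF refl])
    fix u
    have "\<phi> (- (u * r)) * (\<phi> (u * r') * A r') = \<phi> ((r' - r) * u) * A r'" for r'
      using hom[of "- (u * r)" "u * r'"] by (simp add: algebra_simps)
    then show "\<phi> (- (u * r)) * (\<Sum>r'\<in>UNIV. \<phi> (u * r') * A r') = (\<Sum>r'\<in>UNIV. \<phi> ((r' - r) * u) * A r')"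
      by (simp only: sum_distrib_left)
  qed
  also have "\<dots> = (\<Sum>r'\<in>UNIV. \<Sum>u\<in>UNIV. \<phi> ((r' - r) * u) * A r')" by (rule sum.swap)
  also have "\<dots> = (\<Sum>r'\<in>UNIV. if r' = r then of_nat CARD('a) * A r' else 0)"
    by (intro sum.cong refl) (auto simp: sum_phi_mult simp flip: sum_distrib_right)
  finally show ?thesis by simp
qed

text \<open>Since the Gauss sum is a constant \<gamma>, it leaves the inversion sum, and A is
  expressed linearly through \<open>nuhat\<close>.\<close>

lemma A_even:
  assumes g: "\<forall>u. u \<noteq> 0 \<longrightarrow> gs u = of_real \<gamma>"
  shows "of_nat CARD('a) * A r = of_nat (CARD('a) ^ CARD('n) * card (E \<inter> F))
     + of_real \<gamma> * (\<Sum>u\<in>UNIV - {0}. \<phi> (- (u * r)) * nuhat (- 1 / (4 * u)))"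
proof -
  have "of_nat CARD('a) * A r = (\<Sum>r'\<in>UNIV. A r')
      + (\<Sum>u\<in>UNIV - {0}. \<phi> (- (u * r)) * (\<Sum>r'\<in>UNIV. \<phi> (u * r') * A r'))"
    unfolding A_inversion by (subst sum.remove[of _ 0]) (auto simp: phi_0)
  also have "(\<Sum>u\<in>UNIV - {0}. \<phi> (- (u * r)) * (\<Sum>r'\<in>UNIV. \<phi> (u * r') * A r'))
      = of_real \<gamma> * (\<Sum>u\<in>UNIV - {0}. \<phi> (- (u * r)) * nuhat (- 1 / (4 * u)))"
    unfolding sum_distrib_left[of "of_real \<gamma>"]
  proof (rule sum.cong[OF refl])
    fix u :: 'a assume "u \<in> UNIV - {0}"
    then have u: "u \<noteq> 0" by simp
    show "\<phi> (- (u * r)) * (\<Sum>r'\<in>UNIV. \<phi> (u * r') * A r') = of_real \<gamma> * (\<phi> (- (u * r)) * nuhat (- 1 / (4 * u)))"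
      unfolding nuhat_gs[OF u, symmetric] g[rule_format, OF u] by (simp only: mult_ac)
  qed
  finally show ?thesis by (simp only: sum_A)
qed

text \<open>Expanding \<open>nuhat\<close> over pairs in \<open>A_even\<close> leaves for each (x,
  y) the sum over u \<noteq> 0 of \<phi>(-r u - sqnorm (x - y)/(4u)), a Kloosterman sum because r
  \<noteq> 0.\<close>

lemma A_kloosterman:
  assumes "even CARD('n)" and r: "r \<noteq> 0"
  shows "real CARD('a) * cmod (A r) \<le> real (CARD('a) ^ CARD('n) * card (E \<inter> F))
     + sqrt (real (CARD('a) ^ CARD('n))) * (3 * sqrt CARD('a)) * real (card E * card F)"
proof -
  obtain \<gamma> where g2: "\<gamma>\<^sup>2 = real (CARD('a) ^ CARD('n))" and g: "\<forall>u. u \<noteq> 0 \<longrightarrow> gs u = of_real \<gamma>"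
    using gs_const[OF assms(1)] by blast
  have ag: "\<bar>\<gamma>\<bar> = sqrt (real (CARD('a) ^ CARD('n)))" unfolding g2[symmetric] by simp
  define K where "K = (\<lambda>x y :: 'a ^ 'n. \<Sum>u\<in>UNIV - {0}. \<phi> (- r * u + (- sqnorm (x - y) / 4) / u))"
  have "(\<Sum>u\<in>UNIV - {0}. \<phi> (- (u * r)) * nuhat (- 1 / (4 * u))) = (\<Sum>u\<in>UNIV - {0}. \<Sum>x\<in>E. \<Sum>y\<in>F. \<phi> (- r * u + (- sqnorm (x - y) / 4) / u))"
    unfolding nuhat_eq sum_distrib_left by (intro sum.cong refl) (simp add: mult.commute flip: hom)
  also have "\<dots> = (\<Sum>x\<in>E. \<Sum>u\<in>UNIV - {0}. \<Sum>y\<in>F. \<phi> (- r * u + (- sqnorm (x - y) / 4) / u))" by (rule sum.swap)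
  also have "\<dots> = (\<Sum>x\<in>E. \<Sum>y\<in>F. K x y)"
    unfolding K_def by (rule sum.cong[OF refl]) (rule sum.swap)
  finally have e: "(\<Sum>u\<in>UNIV - {0}. \<phi> (- (u * r)) * nuhat (- 1 / (4 * u))) = (\<Sum>x\<in>E. \<Sum>y\<in>F. K x y)" .
  have "cmod (\<Sum>x\<in>E. \<Sum>y\<in>F. K x y) \<le> (\<Sum>x\<in>E. \<Sum>y\<in>F. cmod (K x y))"
    by (rule order.trans[OF norm_sum sum_mono[OF norm_sum]])
  also have "\<dots> \<le> (\<Sum>x\<in>E. \<Sum>y\<in>F. 3 * sqrt CARD('a))"
    unfolding K_def using r by (intro sum_mono kloosterman) simp
  finally have K: "cmod (\<Sum>x\<in>E. \<Sum>y\<in>F. K x y) \<le> 3 * sqrt CARD('a) * real (card E * card F)" by (simp add: mult_ac)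
  have "real CARD('a) * cmod (A r) = cmod (of_nat CARD('a) * A r)" by (simp add: norm_mult)
  also have "\<dots> \<le> cmod (of_nat (CARD('a) ^ CARD('n) * card (E \<inter> F))) + cmod (of_real \<gamma> * (\<Sum>x\<in>E. \<Sum>y\<in>F. K x y))"
    using A_even[OF g, of r] unfolding e by (simp only: norm_triangle_ineq)
  also have "\<dots> = real (CARD('a) ^ CARD('n) * card (E \<inter> F)) + \<bar>\<gamma>\<bar> * cmod (\<Sum>x\<in>E. \<Sum>y\<in>F. K x y)"
    by (simp only: norm_of_nat norm_mult norm_of_real)
  also have "\<dots> \<le> real (CARD('a) ^ CARD('n) * card (E \<inter> F)) + \<bar>\<gamma>\<bar> * (3 * sqrt CARD('a) * real (card E * card F))"
    by (intro add_left_mono mult_left_mono K) simp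
  finally show ?thesis unfolding ag by (simp only: mult.assoc)
qed

text \<open>Cauchy-Schwarz is applied to nonzero distances only. In the second moment nu 0
  contributes q v^2 with v = nu 0, while A 0, equal to \<gamma> (q v - B)/q, contributes (q v -
  B)^2/q = q v^2 - 2 B v + B^2/q. The terms q v^2 cancel, and B \<ge> 0 allows the mixed term to be
  dropped.\<close>

lemma even_main:
  fixes q Q P :: real
  defines "q \<equiv> real CARD('a)" and "Q \<equiv> real (CARD('a) ^ CARD('n))" and "P \<equiv> real (card E * card F)"
  assumes ev: "even CARD('n)" and big: "P \<ge> 16 * Q" and q3: "q \<ge> 3"
    and M: "\<And>r. r \<noteq> 0 \<Longrightarrow> energy E r \<le> M"
  shows "25 * q * P\<^sup>2 \<le> 144 * real (card (dist_set E F)) * (73 / 48 * P\<^sup>2 + q * M * card F)"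
proof -
  obtain \<gamma> where g2: "\<gamma>\<^sup>2 = Q" and g: "\<forall>u. u \<noteq> 0 \<longrightarrow> gs u = of_real \<gamma>"
    using gs_const[OF ev] unfolding Q_def by blast
  have Q0: "Q > 0" by (simp add: Q_def)
  have P0: "P > 0" using big Q0 by linarith
  define D where "D = real (card (dist_set E F))"
  define W where "W = 73 / 48 * P\<^sup>2 + q * M * card F"
  define c where "c = real (card (E \<inter> F))"
  define v where "v = real (nu 0)"
  define S where "S = (\<Sum>t\<in>UNIV - {0}. (real (nu t))\<^sup>2)"
  define Y where "Y = (\<Sum>r\<in>UNIV - {0}. (cmod (A r))\<^sup>2)"
  have v0: "v \<ge> 0" by (simp add: v_def)
  have c2: "c\<^sup>2 \<le> P"
    unfolding c_def P_def power2_eq_square of_nat_mult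
    by (intro mult_mono) (auto intro!: card_mono)
  \<comment> \<open>This is where the factor 16 is used: |E \<inter> F|^2 \<le> P and Q \<le> P/16
    give (\<gamma> c)^2 \<le> (P/4)^2.\<close>
  have gc: "\<bar>\<gamma> * c\<bar> \<le> P / 4"
  proof -
    have "(\<gamma> * c)\<^sup>2 = Q * c\<^sup>2" by (simp add: power_mult_distrib g2)
    also have "\<dots> \<le> Q * P" using c2 Q0 by simp
    also have "\<dots> \<le> (P / 16) * P" using big P0 by (intro mult_right_mono) auto
    also have "\<dots> = (P / 4)\<^sup>2" by (simp add: power2_eq_square)
    finally show ?thesis using P0 by (simp add: abs_le_square_iff[symmetric])
  qed
  define B where "B = P - \<gamma> * c"
  have B: "0 \<le> B" "B \<le> 5 / 4 * P" using gc P0 unfolding B_def by linarith+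
  have A0: "(cmod (A 0))\<^sup>2 = Q * (q * v - B)\<^sup>2 / q\<^sup>2"
  proof -
    have "(\<Sum>u\<in>UNIV - {0}. \<phi> (- (u * 0)) * nuhat (- 1 / (4 * u))) = (\<Sum>s\<in>UNIV - {0}. nuhat s)"
      unfolding sum_reciprocal[of nuhat] by (simp add: phi_0)
    also have "\<dots> = (\<Sum>s\<in>UNIV. nuhat s) - nuhat 0"
      by (subst (2) sum.remove[of _ 0]) auto
    also have "\<dots> = of_real (q * v - P)"
      unfolding sum_nuhat nuhat_0 by (simp add: q_def v_def P_def)
    finally have "of_nat CARD('a) * A 0 = of_nat (CARD('a) ^ CARD('n) * card (E \<inter> F)) + of_real \<gamma> * of_real (q * v - P)"
      using A_even[OF g, of 0] by simp
    also have "\<dots> = of_real (Q * c + \<gamma> * (q * v - P))" by (simp add: Q_def c_def)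
    also have "Q * c + \<gamma> * (q * v - P) = \<gamma> * (q * v - B)"
      unfolding g2[symmetric] B_def by (simp add: algebra_simps power2_eq_square)
    finally have "cmod (of_nat CARD('a) * A 0) = \<bar>\<gamma> * (q * v - B)\<bar>" by (simp only: norm_of_real)
    then have "q * cmod (A 0) = \<bar>\<gamma> * (q * v - B)\<bar>" by (simp add: norm_mult q_def)
    then have "(q * cmod (A 0))\<^sup>2 = (\<gamma> * (q * v - B))\<^sup>2" by (simp only: power2_abs)
    then have "q\<^sup>2 * (cmod (A 0))\<^sup>2 = Q * (q * v - B)\<^sup>2" by (simp only: power_mult_distrib g2)
    then show ?thesis using q3 by (simp add: field_simps)
  qed
  have Y: "Y \<le> M * (Q * card F)" unfolding Y_def Q_def using sum_norm_A_le[OF M] by simp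
  have s1: "(\<Sum>t\<in>UNIV. (real (nu t))\<^sup>2) = v\<^sup>2 + S"
    unfolding S_def v_def by (subst sum.remove[of _ 0]) auto
  have s2: "(\<Sum>r\<in>UNIV. (cmod (A r))\<^sup>2) = (cmod (A 0))\<^sup>2 + Y"
    unfolding Y_def by (subst sum.remove[of _ 0]) auto
  have s3: "q * (v\<^sup>2 + S) = P\<^sup>2 + (q * ((cmod (A 0))\<^sup>2 + Y) - (Q * c)\<^sup>2) / Q"
    using second_moment unfolding s1 s2 q_def Q_def P_def c_def .
  have nz: "q \<noteq> 0" "Q \<noteq> 0" using q3 Q0 by auto
  define w y where "w = (q * v - B)\<^sup>2 / q" and "y = q * Y / Q"
  have s4: "q * (cmod (A 0))\<^sup>2 / Q = w"
    unfolding A0 w_def using nz by (simp add: power2_eq_square)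
  have s5: "(Q * c)\<^sup>2 / Q = Q * c\<^sup>2" using nz by (simp add: power2_eq_square)
  have t0: "q * v\<^sup>2 + q * S = P\<^sup>2 + (w + y - Q * c\<^sup>2)"
    using s3 unfolding distrib_left add_divide_distrib diff_divide_distrib s4 s5 y_def[symmetric] .
  have t1: "y \<le> q * M * card F"
  proof -
    have "Y / Q \<le> M * card F" using Y Q0 by (simp add: divide_le_eq mult_ac)
    then have "q * (Y / Q) \<le> q * (M * card F)" using q3 by (intro mult_left_mono) auto
    then show ?thesis by (simp add: y_def)
  qed
  have t2: "w = q * v\<^sup>2 - 2 * (B * v) + B\<^sup>2 / q"
  proof -
    have "(q * v - B)\<^sup>2 = q * (q * v\<^sup>2) - q * (2 * (B * v)) + B\<^sup>2"
      by (simp add: algebra_simps power2_eq_square)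
    then show ?thesis unfolding w_def by (simp only: add_divide_distrib diff_divide_distrib nonzero_mult_div_cancel_left[OF nz(1)])
  qed
  \<comment> \<open>From B \<le> 5P/4 and q \<ge> 3. Together with the main term P^2 this gives 1 +
    25/48 = 73/48.\<close>
  have t3: "B\<^sup>2 / q \<le> 25 / 48 * P\<^sup>2"
  proof -
    have "B\<^sup>2 / q \<le> (5 / 4 * P)\<^sup>2 / 3" using B q3 by (intro frac_le power_mono) auto
    then show ?thesis by (simp add: power_mult_distrib power2_eq_square)
  qed
  have t4: "B * v \<ge> 0" "Q * c\<^sup>2 \<ge> 0" using B v0 Q0 by simp_all
  have S: "q * S \<le> 73 / 48 * P\<^sup>2 + q * M * card F"
    using t0 t1 t2 t3 t4 by linarith
  \<comment> \<open>Here 7/12 = 1/3 + 1/4, the first from q \<ge> 3 and the second from P \<ge> 16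
    Q.\<close>
  have "v \<le> 7 / 12 * P"
  proof -
    have n0: "q * v \<le> P + q * sqrt (Q * P)" using nu0_le unfolding q_def v_def P_def Q_def by simp
    have "Q * P \<le> (P / 16) * P" using big P0 by (intro mult_right_mono) auto
    then have "Q * P \<le> (P / 4)\<^sup>2" by (simp add: power2_eq_square)
    then have "sqrt (Q * P) \<le> P / 4" using P0 by (intro real_le_lsqrt) auto
    then have "q * sqrt (Q * P) \<le> q * (P / 4)" using q3 by (intro mult_left_mono) auto
    moreover have "3 * P \<le> q * P" using q3 P0 by simp
    ultimately have "q * v \<le> q * (7 / 12 * P)" using n0 by simp
    then show ?thesis using q3 by simp
  qed
  moreover have "(\<Sum>t\<in>UNIV - {0}. real (nu t)) = P - v"
  proof -
    have "real (\<Sum>t\<in>UNIV. nu t) = P" unfolding sum_nu P_def ..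
    then have "(\<Sum>t\<in>UNIV. real (nu t)) = P" by simp
    then show ?thesis by (subst (asm) sum.remove[of _ 0]) (auto simp: v_def)
  qed
  ultimately have "(5 / 12 * P)\<^sup>2 \<le> (\<Sum>t\<in>UNIV - {0}. real (nu t))\<^sup>2" using P0 by (intro power_mono) auto
  also have "\<dots> \<le> D * S" unfolding S_def D_def by (rule distance_cauchy_schwarz)
  finally have u1: "25 / 144 * P\<^sup>2 \<le> D * S" by (simp add: power_mult_distrib power2_eq_square)
  have u2: "q * (25 / 144 * P\<^sup>2) \<le> q * (D * S)" by (rule mult_left_mono[OF u1]) (use q3 in simp)
  have u3: "D * (q * S) \<le> D * W" unfolding W_def by (rule mult_left_mono[OF S]) (simp add: D_def)
  have u4: "q * (D * S) = D * (q * S)" by (rule mult.left_commute)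
  have "q * (25 / 144 * P\<^sup>2) \<le> D * W" using u2 u3 unfolding u4 by linarith
  then have "25 * q * P\<^sup>2 \<le> 144 * D * W" by simp
  then show ?thesis unfolding W_def D_def .
qed

end

section \<open>Circles\<close>

lemma card_circle_inter_aux:
  fixes z :: "'a::{field,finite} ^ 'n"
  assumes two: "(2::'a) \<noteq> 0" and U: "(UNIV :: 'n set) = {i, j}" "i \<noteq> j" and z: "z $ i \<noteq> 0" and r: "r \<noteq> 0"
  shows "card {m. sqnorm m = r \<and> sqnorm (z - m) = r} \<le> 2"
proof -
  define C where "C = {m. sqnorm m = r \<and> sqnorm (z - m) = r}"
  have sq: "sqnorm m = m $ i * m $ i + m $ j * m $ j" for m :: "'a ^ 'n"
    unfolding sqnorm_def U(1) using U(2) by simp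
  define s where "s = sqnorm z"
  have "(4::'a) = 2 * 2" by simp
  then have four: "(4::'a) \<noteq> 0" using two by (metis mult_eq_0_iff)
  define p where "p = [:s * s - 4 * (z $ i * z $ i) * r, - 4 * s * z $ j, 4 * s:]"
  \<comment> \<open>If z is isotropic, that is s = 0, the coefficients of degree 1 and 2 vanish, but
    the constant term -4 (z $ i)^2 r does not.\<close>
  have p0: "p \<noteq> 0"
  proof (cases "s = 0")
    case True
    then have "coeff p 0 = - (4 * (z $ i * z $ i) * r)" by (simp add: p_def)
    then show ?thesis using four z r by auto
  next
    case False
    have "coeff p 2 = 4 * s" by (simp add: p_def numeral_2_eq_2)
    then show ?thesis using four False by auto
  qed
  have lin: "2 * (z $ i * m $ i) = s - 2 * (z $ j * m $ j)" if "m \<in> C" for m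
  proof -
    have "sqnorm m = r" "sqnorm (z - m) = r" using that by (auto simp: C_def)
    then have "sqnorm m - sqnorm (z - m) = 0" by simp
    moreover have "sqnorm m - sqnorm (z - m) = 2 * (z $ i * m $ i) - (s - 2 * (z $ j * m $ j))"
      by (simp add: s_def sq algebra_simps)
    ultimately show ?thesis by (simp only: right_minus_eq)
  qed
  have root: "poly p (m $ j) = 0" if m: "m \<in> C" for m
  proof -
    have rm: "r = m $ i * m $ i + m $ j * m $ j" using m by (simp add: C_def sq)
    have "4 * (z $ i * z $ i) * r = (2 * (z $ i * m $ i)) * (2 * (z $ i * m $ i)) + 4 * (z $ i * z $ i) * (m $ j * m $ j)"
      unfolding rm by (simp add: algebra_simps)
    then have e: "4 * (z $ i * z $ i) * r = (s - 2 * (z $ j * m $ j)) * (s - 2 * (z $ j * m $ j)) + 4 * (z $ i * z $ i) * (m $ j * m $ j)"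
      by (simp only: lin[OF m])
    have "poly p (m $ j) = s * s - 4 * (z $ i * z $ i) * r - 4 * s * (z $ j * m $ j) + 4 * s * (m $ j * m $ j)"
      by (simp add: p_def algebra_simps)
    also have "\<dots> = 4 * (s - (z $ i * z $ i + z $ j * z $ j)) * (m $ j * m $ j)"
      unfolding e by (simp add: algebra_simps)
    also have "\<dots> = 0" by (simp add: s_def sq)
    finally show ?thesis .
  qed
  have inj: "inj_on (\<lambda>m. m $ j) C"
  proof (rule inj_onI)
    fix m m' assume m: "m \<in> C" "m' \<in> C" "m $ j = m' $ j"
    then have "2 * (z $ i * m $ i) = 2 * (z $ i * m' $ i)" using lin[OF m(1)] lin[OF m(2)] by simp
    then have mi: "m $ i = m' $ i" using two z by simp
    show "m = m'"
      unfolding vec_eq_iff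
    proof
      fix k
      have "k \<in> {i, j}" unfolding U(1)[symmetric] by (rule UNIV_I)
      then show "m $ k = m' $ k" using mi m(3) by blast
    qed
  qed
  have "card C \<le> card {x. poly p x = 0}"
  proof (rule card_inj_on_le[OF inj])
    show "(\<lambda>m. m $ j) ` C \<subseteq> {x. poly p x = 0}" by (rule image_subsetI) (simp add: root)
  qed simp
  also have "\<dots> \<le> degree p" by (rule card_poly_roots_bound[OF p0])
  also have "\<dots> \<le> 2" by (simp add: p_def)
  finally show ?thesis by (simp add: C_def)
qed

lemma card_circle_inter:
  fixes z :: "'a::{field,finite} ^ 'n"
  assumes "(2::'a) \<noteq> 0" "CARD('n) = 2" "z \<noteq> 0" "r \<noteq> 0"
  shows "card {m. sqnorm m = r \<and> sqnorm (z - m) = r} \<le> 2"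
proof -
  obtain i j where ij: "(UNIV :: 'n set) = {i, j}" "i \<noteq> j" using assms(2) by (auto simp: card_2_iff)
  have "z $ i \<noteq> 0 \<or> z $ j \<noteq> 0"
    using assms(3) ij by (metis UNIV_I insertE singletonD vec_eq_iff zero_index)
  then show ?thesis
    using card_circle_inter_aux[OF assms(1) ij _ assms(4), of z]
      card_circle_inter_aux[OF assms(1) _ _ _ assms(4), of j i z] ij by (metis insert_commute)
qed

section \<open>The extension estimate from L^2 to L^4 on circles\<close>

context additive_character
begin

lemma vec_parseval:
  fixes c :: "'a ^ 'n \<Rightarrow> complex"
  shows "(\<Sum>x\<in>UNIV. (cmod (\<Sum>z\<in>UNIV. c z * \<phi> (dot x z)))\<^sup>2) = real (CARD('a) ^ CARD('n)) * (\<Sum>z\<in>UNIV. (cmod (c z))\<^sup>2)"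
proof -
  have "complex_of_real (\<Sum>x\<in>UNIV. (cmod (\<Sum>z\<in>UNIV. c z * \<phi> (dot x z)))\<^sup>2)
      = (\<Sum>x\<in>UNIV. \<Sum>z\<in>UNIV. \<Sum>z'\<in>UNIV. \<phi> (dot x (z - z')) * (c z * cnj (c z')))"
  proof -
    have "(\<Sum>z\<in>UNIV. c z * \<phi> (dot x z)) * cnj (\<Sum>z\<in>UNIV. c z * \<phi> (dot x z)) =
        (\<Sum>z\<in>UNIV. \<Sum>z'\<in>UNIV. \<phi> (dot x (z - z')) * (c z * cnj (c z')))" for x
      unfolding cnj_sum sum_product
      by (intro sum.cong refl) (simp add: dot_diff_right phi_diff)
    then show ?thesis by (simp only: of_real_sum complex_norm_square)
  qed
  also have "\<dots> = (\<Sum>z\<in>UNIV. \<Sum>x\<in>UNIV. \<Sum>z'\<in>UNIV. \<phi> (dot x (z - z')) * (c z * cnj (c z')))" by (rule sum.swap)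
  also have "\<dots> = (\<Sum>z\<in>UNIV. \<Sum>z'\<in>UNIV. \<Sum>x\<in>UNIV. \<phi> (dot x (z - z')) * (c z * cnj (c z')))"
    by (rule sum.cong[OF refl]) (rule sum.swap)
  also have "\<dots> = (\<Sum>z\<in>UNIV. \<Sum>z'\<in>UNIV. if z' = z then of_nat (CARD('a) ^ CARD('n)) * (c z * cnj (c z')) else 0)"
    by (intro sum.cong refl) (auto simp: sum_phi_dot simp flip: sum_distrib_right)
  also have "\<dots> = (\<Sum>z\<in>UNIV. of_nat (CARD('a) ^ CARD('n)) * (c z * cnj (c z)))" by simp
  also have "\<dots> = complex_of_real (real (CARD('a) ^ CARD('n)) * (\<Sum>z\<in>UNIV. (cmod (c z))\<^sup>2))"
    by (simp only: of_real_mult of_real_sum complex_norm_square of_real_of_nat_eq sum_distrib_left)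
  finally show ?thesis by (simp only: of_real_eq_iff)
qed

text \<open>The square of the extension is the Fourier transform of the convolution c, so Parseval
  reduces the claim to the L^2 norm of c. A nonzero z is a sum of two points of the circle in at
  most 2 ordered ways, which costs a factor 2; at z = 0 all antipodal pairs occur, but
  Cauchy-Schwarz still gives |c(0)|^2 \<le> W^2. Hence the constant 3 = 2 + 1.\<close>

lemma circle_extension:
  fixes g :: "'a ^ 'n \<Rightarrow> complex"
  assumes dim2: "CARD('n) = 2" and r: "r \<noteq> 0"
  defines "S \<equiv> {m :: 'a ^ 'n. sqnorm m = r}"
  shows "(\<Sum>x\<in>UNIV. (cmod (\<Sum>m\<in>S. g m * \<phi> (dot x m))) ^ 4) \<le> 3 * real (CARD('a) ^ 2) * (\<Sum>m\<in>S. (cmod (g m))\<^sup>2)\<^sup>2"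
proof -
  define W where "W = (\<Sum>m\<in>S. (cmod (g m))\<^sup>2)"
  define Rz where "Rz = (\<lambda>z. {p \<in> S \<times> S. fst p + snd p = z})"
  define c where "c = (\<lambda>z. \<Sum>p\<in>Rz z. g (fst p) * g (snd p))"
  define w where "w = (\<lambda>z. \<Sum>p\<in>Rz z. (cmod (g (fst p)) * cmod (g (snd p)))\<^sup>2)"
  have dr: "dot x (y + z) = dot x y + dot x z" for x y z :: "'a ^ 'n"
    by (simp add: dot_def distrib_left sum.distrib)
  have sqr: "(\<Sum>m\<in>S. g m * \<phi> (dot x m))\<^sup>2 = (\<Sum>z\<in>UNIV. c z * \<phi> (dot x z))" for x
  proof -
    have "(\<Sum>m\<in>S. g m * \<phi> (dot x m))\<^sup>2 = (\<Sum>m\<in>S. \<Sum>m'\<in>S. g m * g m' * \<phi> (dot x (m + m')))"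
      unfolding power2_eq_square sum_product by (intro sum.cong refl) (simp add: dr hom)
    also have "\<dots> = (\<Sum>p\<in>S \<times> S. g (fst p) * g (snd p) * \<phi> (dot x (fst p + snd p)))"
      by (simp add: sum.cartesian_product case_prod_beta)
    also have "\<dots> = (\<Sum>z\<in>UNIV. \<Sum>p\<in>{p \<in> S \<times> S. fst p + snd p = z}. g (fst p) * g (snd p) * \<phi> (dot x (fst p + snd p)))"
      by (rule sum.group[symmetric]) auto
    also have "\<dots> = (\<Sum>z\<in>UNIV. c z * \<phi> (dot x z))"
      unfolding c_def Rz_def sum_distrib_right by (intro sum.cong refl) auto
    finally show ?thesis .
  qed
  have wW: "(\<Sum>z\<in>UNIV. w z) = W\<^sup>2"
  proof -
    have "(\<Sum>z\<in>UNIV. w z) = (\<Sum>p\<in>S \<times> S. (cmod (g (fst p)) * cmod (g (snd p)))\<^sup>2)"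
      unfolding w_def Rz_def by (rule sum.group) auto
    also have "\<dots> = W\<^sup>2"
      by (simp add: W_def power2_eq_square[of "sum _ _"] sum_product sum.cartesian_product case_prod_beta power_mult_distrib)
    finally show ?thesis .
  qed
  have w0: "w z \<ge> 0" for z unfolding w_def by (rule sum_nonneg) simp
  have cz: "(cmod (c z))\<^sup>2 \<le> 2 * w z" if "z \<noteq> 0" for z
  proof -
    have "card (Rz z) \<le> card {m. sqnorm m = r \<and> sqnorm (z - m) = r}"
    proof (rule card_inj_on_le[of fst])
      have sn: "snd p = z - fst p" if "p \<in> Rz z" for p using that by (auto simp: Rz_def)
      show "inj_on fst (Rz z)" by (rule inj_onI) (metis sn prod_eqI)
      show "fst ` Rz z \<subseteq> {m. sqnorm m = r \<and> sqnorm (z - m) = r}"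
        by (rule image_subsetI) (simp only: sn[symmetric] mem_Collect_eq, simp add: Rz_def S_def mem_Times_iff)
    qed simp
    also have "\<dots> \<le> 2" by (rule card_circle_inter[OF two dim2 that r])
    finally have c2: "real (card (Rz z)) \<le> 2" by simp
    have "cmod (c z) \<le> (\<Sum>p\<in>Rz z. 1 * (cmod (g (fst p)) * cmod (g (snd p))))"
      unfolding c_def by (rule order.trans[OF norm_sum]) (simp add: norm_mult)
    then have "(cmod (c z))\<^sup>2 \<le> (\<Sum>p\<in>Rz z. 1 * (cmod (g (fst p)) * cmod (g (snd p))))\<^sup>2" by (intro power_mono) auto
    also have "\<dots> \<le> (\<Sum>p\<in>Rz z. 1\<^sup>2) * w z" unfolding w_def by (rule Cauchy_Schwarz_ineq_sum)
    also have "\<dots> \<le> 2 * w z" using c2 w0 by (intro mult_right_mono) auto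
    finally show ?thesis .
  qed
  have c0: "(cmod (c 0))\<^sup>2 \<le> W\<^sup>2"
  proof -
    have sneg: "sqnorm (- m) = sqnorm m" for m :: "'a ^ 'n" by (simp add: sqnorm_def)
    have sn: "snd p = - fst p" "fst p \<in> S" if "p \<in> Rz 0" for p using that by (auto simp: Rz_def add_eq_0_iff)
    have mem: "(m, - m) \<in> Rz 0" if "m \<in> S" for m using that by (simp add: Rz_def S_def sneg)
    have "c 0 = (\<Sum>m\<in>S. g m * g (- m))"
      unfolding c_def
      by (rule sum.reindex_bij_witness[of _ "\<lambda>m. (m, - m)" fst]) (simp_all add: sn mem prod_eq_iff)
    then have "cmod (c 0) \<le> (\<Sum>m\<in>S. cmod (g m) * cmod (g (- m)))"
      using norm_sum[of "\<lambda>m. g m * g (- m)" S] by (simp add: norm_mult)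
    then have "(cmod (c 0))\<^sup>2 \<le> (\<Sum>m\<in>S. cmod (g m) * cmod (g (- m)))\<^sup>2" by (intro power_mono) auto
    also have "\<dots> \<le> (\<Sum>m\<in>S. (cmod (g m))\<^sup>2) * (\<Sum>m\<in>S. (cmod (g (- m)))\<^sup>2)" by (rule Cauchy_Schwarz_ineq_sum)
    also have "(\<Sum>m\<in>S. (cmod (g (- m)))\<^sup>2) = W" unfolding W_def
      by (rule sum.reindex_bij_witness[of _ uminus uminus]) (auto simp: S_def sneg)
    finally show ?thesis by (simp add: W_def power2_eq_square)
  qed
  have "(\<Sum>z\<in>UNIV. (cmod (c z))\<^sup>2) = (cmod (c 0))\<^sup>2 + (\<Sum>z\<in>UNIV - {0}. (cmod (c z))\<^sup>2)"
    by (subst sum.remove[of _ 0]) auto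
  also have "\<dots> \<le> W\<^sup>2 + (\<Sum>z\<in>UNIV - {0}. 2 * w z)" by (intro add_mono c0 sum_mono cz) simp
  also have "\<dots> \<le> W\<^sup>2 + (\<Sum>z\<in>UNIV. 2 * w z)" by (intro add_left_mono sum_mono2) (use w0 in auto)
  also have "\<dots> = 3 * W\<^sup>2" unfolding sum_distrib_left[symmetric] wW by simp
  finally have c3: "(\<Sum>z\<in>UNIV. (cmod (c z))\<^sup>2) \<le> 3 * W\<^sup>2" .
  have "(\<Sum>x\<in>UNIV. (cmod (\<Sum>m\<in>S. g m * \<phi> (dot x m))) ^ 4) = (\<Sum>x\<in>UNIV. (cmod ((\<Sum>m\<in>S. g m * \<phi> (dot x m))\<^sup>2))\<^sup>2)"
    by (simp add: norm_power flip: power_mult)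
  also have "\<dots> = real (CARD('a) ^ 2) * (\<Sum>z\<in>UNIV. (cmod (c z))\<^sup>2)"
    unfolding sqr vec_parseval dim2 ..
  also have "\<dots> \<le> real (CARD('a) ^ 2) * (3 * W\<^sup>2)" by (rule mult_left_mono[OF c3]) simp
  finally show ?thesis by (simp add: W_def mult_ac)
qed

end

section \<open>Energy on spheres and the anisotropic plane\<close>

context distance_count
begin

lemma energy_le_trivial: "energy S r \<le> real (CARD('a) ^ CARD('n)) * card S"
proof -
  have "energy S r \<le> (\<Sum>r\<in>UNIV. energy S r)"
    by (rule member_le_sum) (auto simp: energy_nonneg)
  then show ?thesis unfolding sum_energy by simp
qed

text \<open>By duality the energy W is the sum over S of the extension G of the conjugate of
  \<open>ft S\<close>. Two applications of Cauchy-Schwarz give W^4 \<le> |S|^3 times the sum of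
  |G|^4, and the extension estimate bounds that sum by 3 q^2 W^2; cancelling W^2 leaves W^2 \<le> 3
  q^2 |S|^3.\<close>

lemma energy_circle:
  assumes dim2: "CARD('n) = 2" and r: "r \<noteq> 0"
  shows "energy S r \<le> sqrt 3 * real CARD('a) * (real (card S) * sqrt (card S))"
proof -
  define C where "C = {m :: 'a ^ 'n. sqnorm m = r}"
  define W where "W = energy S r"
  define a where "a = real (card S)"
  define q where "q = real CARD('a)"
  define G where "G = (\<lambda>x. \<Sum>m\<in>C. cnj (ft S m) * \<phi> (dot x m))"
  have dc: "dot x y = dot y x" for x y :: "'a ^ 'n" by (simp add: dot_def mult.commute)
  have W0: "W \<ge> 0" by (simp add: W_def energy_nonneg)
  have "complex_of_real W = (\<Sum>m\<in>C. cnj (ft S m) * (\<Sum>x\<in>S. \<phi> (dot x m)))"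
    unfolding W_def energy_def C_def of_real_sum complex_norm_square
    by (intro sum.cong refl) (simp add: ft_def dc mult.commute)
  also have "\<dots> = (\<Sum>x\<in>S. G x)"
    unfolding G_def sum_distrib_left by (rule sum.swap)
  finally have "W = cmod (\<Sum>x\<in>S. G x)" using W0 by (metis abs_of_nonneg norm_of_real)
  also have "\<dots> \<le> (\<Sum>x\<in>S. 1 * cmod (G x))" using norm_sum[of G S] by simp
  finally have "W\<^sup>2 \<le> (\<Sum>x\<in>S. 1 * cmod (G x))\<^sup>2" using W0 by (intro power_mono) auto
  also have "\<dots> \<le> (\<Sum>x\<in>S. 1\<^sup>2) * (\<Sum>x\<in>S. (cmod (G x))\<^sup>2)" by (rule Cauchy_Schwarz_ineq_sum)
  finally have w1: "W\<^sup>2 \<le> a * (\<Sum>x\<in>S. (cmod (G x))\<^sup>2)" by (simp add: a_def)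
  have "(\<Sum>x\<in>S. 1 * (cmod (G x))\<^sup>2)\<^sup>2 \<le> (\<Sum>x\<in>S. 1\<^sup>2) * (\<Sum>x\<in>S. ((cmod (G x))\<^sup>2)\<^sup>2)" by (rule Cauchy_Schwarz_ineq_sum)
  also have "\<dots> = a * (\<Sum>x\<in>S. cmod (G x) ^ 4)" by (simp add: a_def flip: power_mult)
  also have "\<dots> \<le> a * (\<Sum>x\<in>UNIV. cmod (G x) ^ 4)"
    by (intro mult_left_mono sum_mono2) (auto simp: a_def)
  also have "\<dots> \<le> a * (3 * q\<^sup>2 * W\<^sup>2)"
    using circle_extension[OF dim2 r, of "\<lambda>m. cnj (ft S m)"]
    by (intro mult_left_mono) (auto simp: a_def G_def C_def q_def W_def energy_def)
  finally have w2: "(\<Sum>x\<in>S. (cmod (G x))\<^sup>2)\<^sup>2 \<le> a * (3 * q\<^sup>2 * W\<^sup>2)" by simp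
  have a0: "a \<ge> 0" by (simp add: a_def)
  have "(W\<^sup>2)\<^sup>2 \<le> (a * (\<Sum>x\<in>S. (cmod (G x))\<^sup>2))\<^sup>2" using w1 by (intro power_mono) auto
  also have "\<dots> = a\<^sup>2 * (\<Sum>x\<in>S. (cmod (G x))\<^sup>2)\<^sup>2" by (rule power_mult_distrib)
  also have "\<dots> \<le> a\<^sup>2 * (a * (3 * q\<^sup>2 * W\<^sup>2))" using w2 by (intro mult_left_mono) auto
  finally have w3: "W\<^sup>2 * W\<^sup>2 \<le> (3 * q\<^sup>2 * a ^ 3) * W\<^sup>2" by (simp add: power2_eq_square power3_eq_cube mult_ac)
  have "W\<^sup>2 \<le> 3 * q\<^sup>2 * a ^ 3"
  proof (cases "W = 0")
    case True then show ?thesis using a0 by simp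
  next
    case False
    then have "W\<^sup>2 > 0" by simp
    then show ?thesis using w3 mult_right_le_imp_le by blast
  qed
  also have "3 * q\<^sup>2 * a ^ 3 = (sqrt 3 * q * (a * sqrt a))\<^sup>2"
    using a0 by (simp add: power_mult_distrib) (simp add: power2_eq_square power3_eq_cube)
  finally have "W \<le> sqrt 3 * q * (a * sqrt a)" by (rule power2_le_imp_le) (simp add: a0 q_def)
  then show ?thesis by (simp add: W_def q_def a_def)
qed

text \<open>For the pair (E, E) the quantity \<open>A r\<close> is the energy itself.\<close>

lemma energy_kloosterman:
  assumes "even CARD('n)" "r \<noteq> 0"
  shows "real CARD('a) * energy E r \<le> real (CARD('a) ^ CARD('n) * card E)
     + sqrt (real (CARD('a) ^ CARD('n))) * (3 * sqrt CARD('a)) * real (card E * card E)"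
proof -
  interpret EE: distance_count \<phi> E E ..
  have "EE.A r = of_real (energy E r)"
    unfolding EE.A_def energy_def of_real_sum complex_norm_square ..
  then have "cmod (EE.A r) = energy E r" using energy_nonneg[of E r] by simp
  then show ?thesis using EE.A_kloosterman[OF assms] by simp
qed

text \<open>When -1 is not a square, 0 is the only vector of norm 0 in the plane, so A 0 is exactly
  |E||F| and contributes P^2/q. This replaces the cancellation used in even dimension, and distance
  0 can be kept in Cauchy-Schwarz.\<close>

lemma anisotropic_main:
  fixes q P :: real
  defines "q \<equiv> real CARD('a)" and "P \<equiv> real (card E * card F)"
  assumes d: "CARD('n) = 2" and nsq: "\<not> (\<exists>x::'a. x * x = -1)"
    and M: "\<And>r. r \<noteq> 0 \<Longrightarrow> energy E r \<le> M"
  shows "q * P\<^sup>2 \<le> real (card (dist_set E F)) * (P\<^sup>2 + (P\<^sup>2 / q + q * M * card F))"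
proof -
  have q0: "q > 0" by (simp add: q_def)
  obtain i j where U: "(UNIV :: 'n set) = {i, j}" "i \<noteq> j" using d by (auto simp: card_2_iff)
  have sq: "sqnorm m = m $ i * m $ i + m $ j * m $ j" for m :: "'a ^ 'n"
    unfolding sqnorm_def U(1) using U(2) by simp
  have S0: "{m :: 'a ^ 'n. sqnorm m = 0} = {0}"
  proof
    show "{0} \<subseteq> {m :: 'a ^ 'n. sqnorm m = 0}" by (simp add: sqnorm_0)
    show "{m :: 'a ^ 'n. sqnorm m = 0} \<subseteq> {0}"
    proof
      fix m :: "'a ^ 'n" assume "m \<in> {m. sqnorm m = 0}"
      then have e: "m $ i * m $ i + m $ j * m $ j = 0" by (simp add: sq)
      have mj: "m $ j = 0"
      proof (rule ccontr)
        assume "m $ j \<noteq> 0"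
        moreover have "m $ i * m $ i = - (m $ j * m $ j)" using e by (simp add: eq_neg_iff_add_eq_0)
        ultimately have "(m $ i / m $ j) * (m $ i / m $ j) = -1" by simp
        then show False using nsq by blast
      qed
      then have "m $ i = 0" using e by simp
      then show "m \<in> {0}" using mj U(1) by (simp add: vec_eq_iff) (metis UNIV_I insertE singletonD)
    qed
  qed
  have "A 0 = of_nat (card E * card F)"
    unfolding A_def S0 by (simp add: ft_def dot_def phi_0)
  then have A0: "(cmod (A 0))\<^sup>2 = P\<^sup>2" by (simp add: P_def norm_mult)
  define Y where "Y = (\<Sum>r\<in>UNIV - {0}. (cmod (A r))\<^sup>2)"
  define S where "S = (\<Sum>t\<in>UNIV. (real (nu t))\<^sup>2)"
  define c where "c = real (card (E \<inter> F))"
  define D where "D = real (card (dist_set E F))"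
  have Y: "Y \<le> M * (q\<^sup>2 * card F)" unfolding Y_def q_def using sum_norm_A_le[OF M] by (simp add: d)
  have s2: "(\<Sum>r\<in>UNIV. (cmod (A r))\<^sup>2) = P\<^sup>2 + Y"
    unfolding Y_def A0[symmetric] by (subst sum.remove[of _ 0]) auto
  have Q: "real (CARD('a) ^ CARD('n)) = q\<^sup>2" by (simp add: d q_def)
  have "q * S = P\<^sup>2 + (q * (P\<^sup>2 + Y) - (q\<^sup>2 * c)\<^sup>2) / q\<^sup>2"
    using second_moment unfolding S_def s2 Q c_def unfolding q_def P_def .
  also have "\<dots> \<le> P\<^sup>2 + (q * (P\<^sup>2 + M * (q\<^sup>2 * card F))) / q\<^sup>2"
  proof -
    have "q * (P\<^sup>2 + Y) \<le> q * (P\<^sup>2 + M * (q\<^sup>2 * card F))" using Y q0 by (intro mult_left_mono) auto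
    moreover have "(q\<^sup>2 * c)\<^sup>2 \<ge> 0" by simp
    ultimately have "q * (P\<^sup>2 + Y) - (q\<^sup>2 * c)\<^sup>2 \<le> q * (P\<^sup>2 + M * (q\<^sup>2 * card F))" by linarith
    then show ?thesis by (intro add_left_mono divide_right_mono) auto
  qed
  also have "(q * (P\<^sup>2 + M * (q\<^sup>2 * card F))) / q\<^sup>2 = P\<^sup>2 / q + q * M * card F"
  proof -
    have "q * (P\<^sup>2 + M * (q\<^sup>2 * card F)) = q * P\<^sup>2 + q\<^sup>2 * (q * M * card F)" by (simp add: algebra_simps)
    moreover have "q * P\<^sup>2 / q\<^sup>2 = P\<^sup>2 / q" using q0 by (simp add: power2_eq_square)
    ultimately show ?thesis using q0 by (simp add: add_divide_distrib)
  qed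
  finally have S: "q * S \<le> P\<^sup>2 + (P\<^sup>2 / q + q * M * card F)" .
  have "real (\<Sum>t\<in>UNIV. nu t) = P" unfolding sum_nu P_def ..
  then have "P = (\<Sum>t\<in>UNIV. real (nu t))" by simp
  then have u1: "P\<^sup>2 \<le> D * S" unfolding D_def S_def using distance_cauchy_schwarz[of UNIV] by simp
  have "q * P\<^sup>2 \<le> q * (D * S)" by (rule mult_left_mono[OF u1]) (use q0 in simp)
  also have "\<dots> = D * (q * S)" by (rule mult.left_commute)
  also have "\<dots> \<le> D * (P\<^sup>2 + (P\<^sup>2 / q + q * M * card F))" by (rule mult_left_mono[OF S]) (simp add: D_def)
  finally show ?thesis unfolding D_def .
qed

end

section \<open>Lower bounds for the distance set\<close>

text \<open>In the applications N is (|E||F|)^2, W2 is the contribution of the nonzero radii and X0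
  is 144 times the bound to be shown. The constants fit with room to spare: 73/48 + 2 \<le>
  25.\<close>

lemma ratio_bound:
  fixes N q D W2 X0 :: real
  assumes main: "25 * q * N \<le> 144 * D * (73 / 48 * N + W2)" and N: "N > 0" and W2: "W2 \<ge> 0"
    and X1: "X0 \<le> q" and X2: "X0 * W2 \<le> 2 * q * N" and q: "q > 0"
  shows "1 / 144 * X0 \<le> D"
proof -
  define W where "W = 73 / 48 * N + W2"
  have W0: "W > 0" using N W2 by (simp add: W_def)
  have "X0 * (73 / 48 * N) \<le> q * (73 / 48 * N)" using X1 N by (intro mult_right_mono) auto
  moreover have "X0 * W = X0 * (73 / 48 * N) + X0 * W2" by (simp only: W_def distrib_left)
  ultimately have "X0 * W \<le> q * (73 / 48 * N) + 2 * q * N" using X2 by linarith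
  also have "\<dots> \<le> 25 * q * N"
  proof -
    have "q * N > 0" using q N by simp
    then show ?thesis by linarith
  qed
  also have "\<dots> \<le> 144 * D * W" using main by (simp add: W_def)
  finally have "X0 \<le> 144 * D" using W0 mult_right_le_imp_le by blast
  then show ?thesis by simp
qed

theorem mainTheorem2:
  fixes E F :: "('a::{field,finite} ^ 'n) set"
  assumes char_odd: "(2::'a) \<noteq> 0"
  defines "q \<equiv> real CARD('a)" and "d \<equiv> CARD('n)"
  shows
   "(even d \<and> d \<ge> 2 \<and> real (card E) * real (card F) \<ge> 16 * q ^ d \<longrightarrow>
      ((1 \<le> real (card E) \<and> real (card E) < q powr ((real d - 1) / 2) \<longrightarrow>
          real (card (dist_set E F)) \<ge> q / 144) \<and>
       (q powr ((real d - 1) / 2) \<le> real (card E) \<and> real (card E) < q powr ((real d + 1) / 2) \<longrightarrow>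
          real (card (dist_set E F)) \<ge> 1/144 * min q (real (card F) / (2 * q powr ((real d - 1) / 2)))) \<and>
       (q powr ((real d + 1) / 2) \<le> real (card E) \<and> real (card E) \<le> q ^ d \<longrightarrow>
          real (card (dist_set E F)) \<ge> 1/144 * min q (2 * real (card E) * real (card F) / q ^ d))))
    \<and>
    (d = 2 \<and> real (card E) * real (card F) \<ge> 16 * q ^ 2 \<longrightarrow>
      real (card (dist_set E F)) \<ge>
        1/72 * min (q / 2) (sqrt (real (card E)) * real (card F) / (sqrt 3 * q)))
    \<and>
    (d = 2 \<and> E \<noteq> {} \<and> F \<noteq> {} \<and> \<not> (\<exists>x::'a. x * x = -1) \<longrightarrow>
      real (card (dist_set E F)) \<ge>
        min (q / 2) (sqrt (real (card E)) * real (card F) / (2 * (sqrt 3 + 1) * q)))"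
proof -
  obtain \<phi> :: "'a \<Rightarrow> complex" where ph: "\<And>x y. \<phi> (x + y) = \<phi> x * \<phi> y" "\<And>x. cmod (\<phi> x) = 1" "\<phi> 1 \<noteq> 1"
    using exists_additive_character by blast
  interpret distance_count \<phi> E F by unfold_locales (use ph char_odd in auto)
  have "CARD('a) \<ge> 3" by (rule frobenius.q_ge3[OF frobenius_alg_closure[OF char_odd]])
  then have q3: "q \<ge> 3" by (simp add: q_def)
  then have q0: "q > 0" by simp
  define a b where "a = real (card E)" and "b = real (card F)"
  define Q where "Q = q ^ d"
  define D where "D = real (card (dist_set E F))"
  have ab0: "a \<ge> 0" "b \<ge> 0" by (simp_all add: a_def b_def)
  have Q0: "Q > 0" using q0 by (simp add: Q_def)
  have QQ: "real (CARD('a) ^ CARD('n)) = Q" by (simp add: Q_def q_def d_def)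
  have PP: "real (card E * card F) = a * b" by (simp add: a_def b_def)
  have main: "25 * q * (a * b)\<^sup>2 \<le> 144 * D * (73 / 48 * (a * b)\<^sup>2 + q * M * b)"
    if "even d" "a * b \<ge> 16 * Q" "\<And>r. r \<noteq> 0 \<Longrightarrow> energy E r \<le> M" for M
    using even_main[of M] that q3 unfolding QQ PP D_def b_def by (simp add: q_def d_def a_def b_def)
  have part1: "(1 \<le> a \<and> a < q powr ((real d - 1) / 2) \<longrightarrow> q / 144 \<le> D)
      \<and> (q powr ((real d - 1) / 2) \<le> a \<and> a < q powr ((real d + 1) / 2) \<longrightarrow>
          1 / 144 * min q (b / (2 * q powr ((real d - 1) / 2))) \<le> D)
      \<and> (q powr ((real d + 1) / 2) \<le> a \<and> a \<le> q ^ d \<longrightarrow> 1 / 144 * min q (2 * a * b / q ^ d) \<le> D)"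
    if ev: "even d" and big: "a * b \<ge> 16 * Q"
  proof -
    define h where "h = q powr ((real d - 1) / 2)"
    have h0: "h > 0" using q0 by (simp add: h_def)
    have hQ: "sqrt Q = h * sqrt q"
    proof -
      have "sqrt Q = q powr (real d / 2)"
        using q0 by (simp add: Q_def powr_half_sqrt[symmetric] powr_realpow[symmetric] powr_powr)
      also have "\<dots> = q powr ((real d - 1) / 2 + 1 / 2)" by (simp add: field_simps)
      also have "\<dots> = h * sqrt q" using q0 unfolding powr_add h_def by (simp add: powr_half_sqrt)
      finally show ?thesis .
    qed
    then have t: "sqrt Q * sqrt q = h * q" using q0 by simp
    have P0: "a * b > 0" using big Q0 by linarith
    then have a0: "a > 0" and b0: "b > 0" using ab0 by (auto simp: zero_less_mult_iff)
    \<comment> \<open>The two terms of the Kloosterman energy bound are of the same order at a = h,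
      because Q = h^2 q. Below h the first dominates, which gives \<open>c1\<close>; above h the
      second does, which gives \<open>c2\<close>.\<close>
    define M where "M = (Q * a + 3 * (h * q) * (a * a)) / q"
    have qM: "q * M = Q * a + 3 * (h * q) * (a * a)" using q0 by (simp add: M_def)
    have M0: "q * M * b \<ge> 0" unfolding qM using Q0 a0 b0 h0 q0 by simp
    have enM: "energy E r \<le> M" if "r \<noteq> 0" for r
    proof -
      have "q * energy E r \<le> Q * a + sqrt Q * (3 * sqrt q) * (a * a)"
        using energy_kloosterman[OF _ that] ev unfolding QQ by (simp add: q_def d_def a_def Q_def)
      also have "sqrt Q * (3 * sqrt q) = 3 * (h * q)" using t by simp
      finally show ?thesis using q0 by (simp add: M_def field_simps)
    qed
    note mM = main[OF ev big enM]
    have sq0: "(a * b)\<^sup>2 > 0" using P0 by (rule zero_less_power)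
    have c1: "q / 144 \<le> D" if "a < h"
    proof -
      have "h * q * a \<le> Q"
      proof -
        have "h * q * a \<le> h * q * h" using that h0 q0 by (intro mult_left_mono) auto
        also have "\<dots> = (sqrt Q)\<^sup>2" unfolding hQ using q0 by (simp add: power_mult_distrib power2_eq_square)
        finally show ?thesis using Q0 by simp
      qed
      then have "3 * (h * q * a) * (a * b) \<le> 3 * Q * (a * b)" using P0 by (intro mult_right_mono) auto
      then have "q * M * b \<le> 4 * (Q * (a * b))" unfolding qM by (simp add: algebra_simps)
      also have "\<dots> \<le> a * b * (a * b)"
      proof -
        have "16 * Q * (a * b) \<le> a * b * (a * b)" using big P0 by (intro mult_right_mono) auto
        moreover have "0 \<le> Q * (a * b)" using Q0 P0 by simp
        ultimately show ?thesis by simp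
      qed
      finally have "q * M * b \<le> (a * b)\<^sup>2" by (simp only: power2_eq_square)
      then have "q * (q * M * b) \<le> q * (a * b)\<^sup>2" using q0 by (intro mult_left_mono) auto
      moreover have "0 \<le> q * (a * b)\<^sup>2" using q0 by simp
      ultimately have "q * (q * M * b) \<le> 2 * q * (a * b)\<^sup>2" by simp
      then have "1 / 144 * q \<le> D" by (intro ratio_bound[OF mM sq0 M0 _ _ q0]) simp_all
      then show ?thesis by simp
    qed
    have c2: "1 / 144 * min q (b / (2 * h)) \<le> D" if "h \<le> a"
    proof (rule ratio_bound[OF mM sq0 M0 _ _ q0])
      show "min q (b / (2 * h)) \<le> q" by simp
      have "Q \<le> h * q * a"
      proof -
        have "Q = (sqrt Q)\<^sup>2" using Q0 by simp
        also have "\<dots> = h * q * h" unfolding hQ using q0 by (simp add: power_mult_distrib power2_eq_square)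
        also have "\<dots> \<le> h * q * a" using that h0 q0 by (intro mult_left_mono) auto
        finally show ?thesis .
      qed
      then have "Q * (a * b) \<le> h * q * a * (a * b)" using P0 by (intro mult_right_mono) auto
      then have qMb: "q * M * b \<le> 4 * (h * q * a * (a * b))" unfolding qM by (simp add: algebra_simps)
      have "min q (b / (2 * h)) * (q * M * b) \<le> (b / (2 * h)) * (4 * (h * q * a * (a * b)))"
        by (rule mult_mono[OF _ qMb _ M0]) (use h0 b0 in auto)
      also have "\<dots> = 2 * q * (a * b)\<^sup>2" using h0 by (simp add: power2_eq_square)
      finally show "min q (b / (2 * h)) * (q * M * b) \<le> 2 * q * (a * b)\<^sup>2" .
    qed
    \<comment> \<open>For the largest sets the trivial energy bound, all of Parseval on a single
      sphere, is used.\<close>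
    have c3: "1 / 144 * min q (2 * a * b / Q) \<le> D"
    proof (rule ratio_bound[OF main[OF ev big, of "Q * a"] sq0 _ _ _ q0])
      show "energy E r \<le> Q * a" for r using energy_le_trivial[of E r] unfolding QQ a_def .
      show "min q (2 * a * b / Q) \<le> q" by simp
      show n: "0 \<le> q * (Q * a) * b" using q0 Q0 ab0 by simp
      have "min q (2 * a * b / Q) * (q * (Q * a) * b) \<le> (2 * a * b / Q) * (q * (Q * a) * b)"
        using n by (intro mult_right_mono) auto
      also have "\<dots> = 2 * q * (a * b)\<^sup>2" using Q0 by (simp add: power2_eq_square)
      finally show "min q (2 * a * b / Q) * (q * (Q * a) * b) \<le> 2 * q * (a * b)\<^sup>2" .
    qed
    show ?thesis using c1 c2 c3 unfolding h_def Q_def by blast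
  qed
  have circle: "energy E r \<le> sqrt 3 * q * (a * sqrt a)" if "d = 2" "r \<noteq> 0" for r
    using energy_circle[of r E] that by (simp add: d_def q_def a_def)
  have part2: "1 / 72 * min (q / 2) (sqrt a * b / (sqrt 3 * q)) \<le> D"
    if d2: "d = 2" and big: "a * b \<ge> 16 * q ^ 2"
  proof -
    define M where "M = sqrt 3 * q * (a * sqrt a)"
    have big': "a * b \<ge> 16 * Q" using big d2 by (simp add: Q_def)
    have P0: "a * b > 0" using big' Q0 by linarith
    have mM: "25 * q * (a * b)\<^sup>2 \<le> 144 * D * (73 / 48 * (a * b)\<^sup>2 + q * M * b)"
      by (rule main[OF _ big']) (use d2 circle in \<open>auto simp: M_def\<close>)
    define Y where "Y = sqrt a * b / (sqrt 3 * q)"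
    have M0: "q * M * b \<ge> 0" using q0 ab0 by (simp add: M_def)
    \<comment> \<open>With the circle bound, the product Y * (q M b) is exactly q (a b)^2, so X0 may
      be twice the minimum; this turns 1/144 into 1/72.\<close>
    have "1 / 144 * (2 * min (q / 2) Y) \<le> D"
    proof (rule ratio_bound[OF mM _ M0 _ _ q0])
      show "(a * b)\<^sup>2 > 0" using P0 by (rule zero_less_power)
      show "2 * min (q / 2) Y \<le> q" by simp
      have "2 * min (q / 2) Y * (q * M * b) \<le> 2 * Y * (q * M * b)" using M0 by (intro mult_right_mono) auto
      also have "\<dots> = 2 * q * (a * b * (b * (sqrt a * sqrt a)))" using q0 by (simp add: Y_def M_def)
      also have "\<dots> = 2 * q * (a * b)\<^sup>2" using ab0 by (simp add: power2_eq_square)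
      finally show "2 * min (q / 2) Y * (q * M * b) \<le> 2 * q * (a * b)\<^sup>2" .
    qed
    then show ?thesis by (simp add: Y_def)
  qed
  have part3: "min (q / 2) (sqrt a * b / (2 * (sqrt 3 + 1) * q)) \<le> D"
    if d2: "d = 2" and ne: "E \<noteq> {}" "F \<noteq> {}" and nsq: "\<not> (\<exists>x::'a. x * x = -1)"
  proof -
    define M where "M = sqrt 3 * q * (a * sqrt a)"
    define V where "V = (a * b)\<^sup>2 / q + q * M * b"
    define Y where "Y = sqrt a * b / (2 * (sqrt 3 + 1) * q)"
    define Z where "Z = min (q / 2) Y"
    have a0: "a > 0" and b0: "b > 0" using ne by (auto simp: a_def b_def card_gt_0_iff)
    have s3: "sqrt 3 + 1 > 0" by (simp add: add_nonneg_pos)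
    have m: "q * (a * b)\<^sup>2 \<le> D * ((a * b)\<^sup>2 + V)"
      using anisotropic_main[OF _ nsq, of M] circle[OF d2] d2 unfolding PP D_def V_def
      by (simp add: q_def d_def b_def M_def)
    have cb: "card (S :: ('a ^ 'n) set) \<le> CARD('a) ^ 2" for S
      using card_mono[of UNIV S] d2 by (simp add: d_def)
    have aq: "a \<le> q\<^sup>2" unfolding a_def q_def using cb[of E] by (metis of_nat_le_iff of_nat_power)
    have bq: "b \<le> q\<^sup>2" unfolding b_def q_def using cb[of F] by (metis of_nat_le_iff of_nat_power)
    \<comment> \<open>The trivial bounds a, b \<le> q^2 show that (a b)^2/q is at most q^2 times a
      sqrt(a) b, the shape of the circle term; adding the two coefficients gives sqrt 3 + 1.\<close>
    have "sqrt a \<le> q" using aq q0 by (intro real_le_lsqrt) auto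
    then have "sqrt a * b \<le> q * q\<^sup>2" using bq a0 b0 q0 by (intro mult_mono) auto
    then have "(sqrt a * b) * (a * sqrt a * b) \<le> q * q\<^sup>2 * (a * sqrt a * b)" using a0 b0 by (intro mult_right_mono) auto
    moreover have "(sqrt a * b) * (a * sqrt a * b) = (a * b)\<^sup>2"
    proof -
      have "(sqrt a * b) * (a * sqrt a * b) = (sqrt a * sqrt a) * a * (b * b)" by (simp only: mult_ac)
      then show ?thesis using a0 by (simp add: power2_eq_square)
    qed
    ultimately have "(a * b)\<^sup>2 / q \<le> q\<^sup>2 * (a * sqrt a * b)" using q0 by (simp add: divide_le_eq mult_ac)
    moreover have "q * M * b = sqrt 3 * (q\<^sup>2 * (a * sqrt a * b))" by (simp add: M_def power2_eq_square)
    ultimately have V: "V \<le> (sqrt 3 + 1) * (q\<^sup>2 * (a * sqrt a * b))"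
      unfolding V_def distrib_right mult_1_left by linarith
    have V0: "V \<ge> 0" using a0 b0 q0 by (simp add: V_def M_def)
    have Y0: "Y \<ge> 0" using a0 b0 q0 s3 by (simp add: Y_def)
    have "Z * V \<le> Y * ((sqrt 3 + 1) * (q\<^sup>2 * (a * sqrt a * b)))"
      by (rule mult_mono[OF _ V Y0 V0]) (simp add: Z_def)
    also have "\<dots> = q * (a * b)\<^sup>2 / 2"
    proof -
      have "Y * ((sqrt 3 + 1) * (q\<^sup>2 * (a * sqrt a * b))) = q * ((sqrt a * b) * (a * sqrt a * b)) / 2"
      proof -
        define k where "k = sqrt 3 + 1"
        have "k \<noteq> 0" "q \<noteq> 0" using s3 q0 by (auto simp: k_def)
        then show ?thesis unfolding Y_def k_def[symmetric] by (simp add: power2_eq_square)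
      qed
      then show ?thesis using \<open>(sqrt a * b) * (a * sqrt a * b) = (a * b)\<^sup>2\<close> by simp
    qed
    finally have z1: "Z * V \<le> q * (a * b)\<^sup>2 / 2" .
    \<comment> \<open>Each summand of (a b)^2 + V takes half of the available q (a b)^2, whence q/2
      and the factor 2 in the denominator of Y.\<close>
    have z2: "Z * (a * b)\<^sup>2 \<le> q / 2 * (a * b)\<^sup>2" by (intro mult_right_mono) (auto simp: Z_def)
    have "Z * ((a * b)\<^sup>2 + V) \<le> q * (a * b)\<^sup>2" using z1 z2 by (simp add: distrib_left)
    then have "Z * ((a * b)\<^sup>2 + V) \<le> D * ((a * b)\<^sup>2 + V)" using m by linarith
    moreover have "(a * b)\<^sup>2 + V > 0" using V0 a0 b0 by (simp add: add_pos_nonneg)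
    ultimately have "Z \<le> D" using mult_right_le_imp_le by blast
    then show ?thesis by (simp add: Z_def Y_def)
  qed
  show ?thesis
    using part1 part2 part3 unfolding a_def b_def D_def Q_def by blast
qed

end
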